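(* (a) There is a nonempty open set of parameters $(a_0,a_1,a_2)$ for which the mean frequencies of the three short closed geodesics on the $2$-dimensional ellipsoid $M(a_0,a_1,a_2)$ are distinct. (b) For $n\ge3$ there is a nonempty open set of parameters $(a_0,a_1,\dots,a_n)$ for which there are at least $(n+1)/2$ different mean frequencies among the short closed geodesics on the $n$-dimensional ellipsoid $M(a_0,a_1,\dots,a_n)$.
   Context: For positive parameters $a_0<a_1<\dots<a_n$, the ellipsoid is $$M(a_0,\dots,a_n)=\Big\{(x_0,\dots,x_n)\in\mathbb{R}^{n+1}:\ \frac{x_0^2}{a_0^2}+\dots+\frac{x_n^2}{a_n^2}=1\Big\}$$ with the Riemannian metric induced from $\mathbb{R}^{n+1}$. Its $(n^2+n)/2$ short closed geodesics are the (once-traversed) ellipses obtained by intersecting it with the coordinate planes, i.e. the $(x_i,x_j)$-planes. For a closed geodesic $\gamma$ of length $\ell(\gamma)$ with iterates $\gamma^m(t)=\gamma(mt)$, $\mathrm{ind}(\gamma)$ is the index of the Hessian at $\gamma$ of $F(\gamma)=\left(\int_0^1\|\gamma'(t)\|^2dt\right)^{1/2}$ on the free loop space of $H^1$ loops. The average index is $\alpha_\gamma=\lim_{m\to\infty}\mathrm{ind}(\gamma^m)/m$, and the mean frequency is $\overline{\alpha}_\gamma=\alpha_\gamma/\ell(\gamma)$. *)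

theory Defs
  imports "HOL-Analysis.Analysis" "HOL-Library.Periodic_Fun"
begin

section \<open>The Hilbert space of $H^1$ loops\<close>

text \<open>
  A locally integrable \<open>g\<close> is an \<open>L\<^sup>2\<close> derivative of \<open>\<gamma>\<close> if \<open>\<gamma>\<close> is a primitive of \<open>g\<close> and
  \<open>\<parallel>g\<parallel>\<^sup>2\<close> is integrable on bounded intervals.  Henstock--Kurzweil integrability of \<open>g\<close> implies
  measurability, and it agrees with Lebesgue integrability for the nonnegative \<open>\<parallel>g\<parallel>\<^sup>2\<close>.
\<close>

definition has_L2_deriv :: "(real \<Rightarrow> 'a::euclidean_space) \<Rightarrow> (real \<Rightarrow> 'a) \<Rightarrow> bool" where
  "has_L2_deriv \<gamma> g \<longleftrightarrow>
     (\<forall>a b. a \<le> b \<longrightarrow> (g has_integral (\<gamma> b - \<gamma> a)) {a..b} \<and> (\<lambda>t. (norm (g t))\<^sup>2) integrable_on {a..b})"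

lemma has_L2_derivD:
  assumes "has_L2_deriv \<gamma> g" "a \<le> b"
  shows "(g has_integral (\<gamma> b - \<gamma> a)) {a..b}" "(\<lambda>t. (norm (g t))\<^sup>2) integrable_on {a..b}"
  using assms by (auto simp: has_L2_deriv_def)

lemma has_L2_deriv_measurable:
  assumes "has_L2_deriv \<gamma> g"
  shows "g \<in> borel_measurable (lebesgue_on {a..b})"
proof (cases "a \<le> b")
  case True
  have "(\<lambda>x. indicator {a..b} x *\<^sub>R g x) \<in> lebesgue \<rightarrow>\<^sub>M borel"
    using has_integral_implies_lebesgue_measurable[OF has_L2_derivD(1)[OF assms True]] .
  then show ?thesis
    by (subst borel_measurable_restrict_space_iff) auto
next
  case False
  then show ?thesis by (simp add: measurable_def space_restrict_space)
qed

lemma has_L2_deriv_inner_integrable: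
  assumes g: "has_L2_deriv \<gamma> g" and h: "has_L2_deriv \<delta> h"
  shows "(\<lambda>t. g t \<bullet> h t) integrable_on {a..b}"
proof (cases "a \<le> b")
  case True
  note m = has_L2_deriv_measurable[OF g, of a b] has_L2_deriv_measurable[OF h, of a b]
  show ?thesis
  proof (rule measurable_bounded_by_integrable_imp_integrable)
    show "(\<lambda>t. g t \<bullet> h t) \<in> borel_measurable (lebesgue_on {a..b})"
      using m by simp
    show "(\<lambda>t. (norm (g t))\<^sup>2 + (norm (h t))\<^sup>2) integrable_on {a..b}"
      by (intro integrable_add has_L2_derivD(2)[OF g True] has_L2_derivD(2)[OF h True])
    fix t
    have "\<bar>g t \<bullet> h t\<bar> \<le> norm (g t) * norm (h t)" by (rule Cauchy_Schwarz_ineq2)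
    moreover have "0 \<le> (norm (g t) - norm (h t))\<^sup>2" "0 \<le> norm (g t) * norm (h t)" by auto
    ultimately show "norm (g t \<bullet> h t) \<le> (norm (g t))\<^sup>2 + (norm (h t))\<^sup>2"
      unfolding power2_diff real_norm_def by linarith
  qed auto
next
  case False
  then have "{a..b} = {}" by simp
  then show ?thesis by (metis integrable_on_empty)
qed

lemma has_L2_deriv_continuous:
  assumes "has_L2_deriv \<gamma> g"
  shows "continuous_on {a..b} \<gamma>"
proof (cases "a \<le> b")
  case True
  have "continuous_on {a..b} (\<lambda>x. \<gamma> a + integral {a..x} g)"
    using has_L2_derivD(1)[OF assms True]
    by (intro continuous_intros indefinite_integral_continuous_1) (auto simp: integrable_on_def)
  moreover have "\<gamma> a + integral {a..x} g = \<gamma> x" if "x \<in> {a..b}" for x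
    using integral_unique[OF has_L2_derivD(1)[OF assms, of a x]] that by simp
  ultimately show ?thesis by (rule continuous_on_eq)
qed auto

lemma has_L2_deriv_const: "has_L2_deriv (\<lambda>t. c) (\<lambda>t. 0)"
  by (auto simp: has_L2_deriv_def)

lemma has_L2_deriv_scaleR:
  assumes "has_L2_deriv \<gamma> g"
  shows "has_L2_deriv (\<lambda>t. r *\<^sub>R \<gamma> t) (\<lambda>t. r *\<^sub>R g t)"
  using assms unfolding has_L2_deriv_def
  by (auto simp: power_mult_distrib simp flip: scaleR_diff_right
      intro!: has_integral_cmul integrable_on_mult_right)

lemma has_L2_deriv_add:
  assumes g: "has_L2_deriv \<gamma> g" and h: "has_L2_deriv \<delta> h"
  shows "has_L2_deriv (\<lambda>t. \<gamma> t + \<delta> t) (\<lambda>t. g t + h t)"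
  unfolding has_L2_deriv_def
proof (intro allI impI conjI)
  fix a b :: real assume ab: "a \<le> b"
  show "((\<lambda>t. g t + h t) has_integral (\<gamma> b + \<delta> b - (\<gamma> a + \<delta> a))) {a..b}"
    using has_integral_add[OF has_L2_derivD(1)[OF g ab] has_L2_derivD(1)[OF h ab]]
    by (simp add: algebra_simps)
  have "(\<lambda>t. (g t \<bullet> g t + h t \<bullet> h t) + 2 * (g t \<bullet> h t)) integrable_on {a..b}"
    by (intro integrable_add integrable_on_mult_right has_L2_deriv_inner_integrable[OF g h]
        has_L2_deriv_inner_integrable[OF g g] has_L2_deriv_inner_integrable[OF h h])
  then show "(\<lambda>t. (norm (g t + h t))\<^sup>2) integrable_on {a..b}"
    by (simp add: power2_norm_eq_inner inner_simps inner_commute algebra_simps)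
qed

lemma has_L2_deriv_unique:
  assumes g: "has_L2_deriv \<gamma> g" and h: "has_L2_deriv \<gamma> h"
  obtains N where "negligible N" "\<And>t. t \<notin> N \<Longrightarrow> g t = h t"
proof -
  have int: "((\<lambda>t. g t - h t) has_integral 0) {a..b}" for a b
  proof (cases "a \<le> b")
    case True
    show ?thesis
      using has_integral_diff[OF has_L2_derivD(1)[OF g True] has_L2_derivD(1)[OF h True]] by simp
  next
    case False
    then show ?thesis by simp
  qed
  then have int': "(\<lambda>t. g t - h t) integrable_on cbox a b" for a b
    unfolding cbox_interval by (rule has_integral_integrable)
  obtain N where N: "negligible N"
    "\<And>x e. \<lbrakk>x \<notin> N; 0 < e\<rbrakk> \<Longrightarrow> \<exists>d>0. \<forall>s. 0 < s \<and> s < d \<longrightarrow>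
       norm (integral (cbox x (x + s *\<^sub>R One)) (\<lambda>t. g t - h t) /\<^sub>R s ^ DIM(real) - (g x - h x)) < e"
    by (rule integrable_ccontinuous_explicit[OF int']) (rule that)
  have "g t = h t" if "t \<notin> N" for t
  proof (rule ccontr)
    assume "g t \<noteq> h t"
    then have "0 < norm (g t - h t)" by simp
    from N(2)[OF that this] obtain d where d: "d > 0" "\<forall>s. 0 < s \<and> s < d \<longrightarrow>
       norm (integral (cbox t (t + s *\<^sub>R One)) (\<lambda>t. g t - h t) /\<^sub>R s ^ DIM(real) - (g t - h t))
         < norm (g t - h t)" by blast
    have "integral (cbox t (t + (d/2) *\<^sub>R One)) (\<lambda>t. g t - h t) = 0"
      unfolding cbox_interval by (rule integral_unique[OF int])
    with d(2)[rule_format, of "d/2"] d(1) have "norm (0 /\<^sub>R (d/2) ^ DIM(real) - (g t - h t)) < norm (g t - h t)"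
      by simp
    then show False
      by (metis diff_0 less_irrefl norm_minus_cancel scaleR_zero_right)
  qed
  with N(1) that show thesis by blast
qed

typedef (overloaded) 'a h1_loop =
  "{\<gamma> :: real \<Rightarrow> 'a::euclidean_space. (\<forall>t. \<gamma> (t + 1) = \<gamma> t) \<and> (\<exists>g. has_L2_deriv \<gamma> g)}"
  morphisms loop_at Abs_h1_loop
  by (rule exI[of _ "\<lambda>t. 0"]) (auto intro: has_L2_deriv_const)

setup_lifting type_definition_h1_loop

text \<open>Determined up to a null set, by \<open>has_L2_deriv_unique\<close>.\<close>

definition loop_deriv :: "'a::euclidean_space h1_loop \<Rightarrow> real \<Rightarrow> 'a" where
  "loop_deriv \<gamma> = (SOME g. has_L2_deriv (loop_at \<gamma>) g)"

lemma has_L2_deriv_loop_deriv: "has_L2_deriv (loop_at \<gamma>) (loop_deriv \<gamma>)"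
proof -
  obtain g where "has_L2_deriv (loop_at \<gamma>) g"
    using loop_at[of \<gamma>] by auto
  then show ?thesis unfolding loop_deriv_def by (rule someI[of "has_L2_deriv (loop_at \<gamma>)"])
qed

lemma loop_deriv_AE:
  assumes "has_L2_deriv (loop_at \<gamma>) g"
  obtains N where "negligible N" "\<And>t. t \<notin> N \<Longrightarrow> loop_deriv \<gamma> t = g t"
  by (rule has_L2_deriv_unique[OF has_L2_deriv_loop_deriv assms]) (rule that)

lemma loop_at_continuous: "continuous_on {a..b} (loop_at \<gamma>)"
  by (rule has_L2_deriv_continuous[OF has_L2_deriv_loop_deriv])

lemma loop_at_periodic: "loop_at \<gamma> (t + 1) = loop_at \<gamma> t"
  using loop_at[of \<gamma>] by auto

lemma loop_at_frac: "loop_at \<gamma> (frac t) = loop_at \<gamma> t"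
proof -
  interpret periodic_fun_simple' "loop_at \<gamma>"
    by standard (rule loop_at_periodic)
  show ?thesis
    unfolding frac_def by (rule minus_of_int)
qed

instantiation h1_loop :: (euclidean_space) real_vector
begin

lift_definition zero_h1_loop :: "'a h1_loop" is "\<lambda>t. 0"
  by (auto intro: has_L2_deriv_const)

lift_definition plus_h1_loop :: "'a h1_loop \<Rightarrow> 'a h1_loop \<Rightarrow> 'a h1_loop"
  is "\<lambda>\<gamma> \<delta> t. \<gamma> t + \<delta> t"
  by (auto intro: has_L2_deriv_add)

lift_definition scaleR_h1_loop :: "real \<Rightarrow> 'a h1_loop \<Rightarrow> 'a h1_loop"
  is "\<lambda>r \<gamma> t. r *\<^sub>R \<gamma> t"
  by (auto intro: has_L2_deriv_scaleR)

lift_definition uminus_h1_loop :: "'a h1_loop \<Rightarrow> 'a h1_loop"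
  is "\<lambda>\<gamma> t. - \<gamma> t"
  using has_L2_deriv_scaleR[of _ _ "-1"] by fastforce

lift_definition minus_h1_loop :: "'a h1_loop \<Rightarrow> 'a h1_loop \<Rightarrow> 'a h1_loop"
  is "\<lambda>\<gamma> \<delta> t. \<gamma> t - \<delta> t"
  using has_L2_deriv_add has_L2_deriv_scaleR[of _ _ "-1"] by fastforce

instance
  by standard (transfer; simp add: algebra_simps)+

end

lemma loop_at_simps [simp]:
  "loop_at 0 t = 0"
  "loop_at (\<gamma> + \<delta>) t = loop_at \<gamma> t + loop_at \<delta> t"
  "loop_at (r *\<^sub>R \<gamma>) t = r *\<^sub>R loop_at \<gamma> t"
  "loop_at (- \<gamma>) t = - loop_at \<gamma> t"
  "loop_at (\<gamma> - \<delta>) t = loop_at \<gamma> t - loop_at \<delta> t"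
  by (simp_all add: uminus_h1_loop.rep_eq minus_h1_loop.rep_eq zero_h1_loop.rep_eq plus_h1_loop.rep_eq
      scaleR_h1_loop.rep_eq)

instantiation h1_loop :: (euclidean_space) real_inner
begin

definition inner_h1_loop :: "'a h1_loop \<Rightarrow> 'a h1_loop \<Rightarrow> real" where
  "inner_h1_loop \<gamma> \<delta> = integral {0..1} (\<lambda>t. loop_at \<gamma> t \<bullet> loop_at \<delta> t)
                     + integral {0..1} (\<lambda>t. loop_deriv \<gamma> t \<bullet> loop_deriv \<delta> t)"

definition norm_h1_loop :: "'a h1_loop \<Rightarrow> real" where
  "norm_h1_loop \<gamma> = sqrt (inner \<gamma> \<gamma>)"

definition sgn_h1_loop :: "'a h1_loop \<Rightarrow> 'a h1_loop" where
  "sgn_h1_loop \<gamma> = \<gamma> /\<^sub>R norm \<gamma>"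

definition dist_h1_loop :: "'a h1_loop \<Rightarrow> 'a h1_loop \<Rightarrow> real" where
  "dist_h1_loop \<gamma> \<delta> = norm (\<gamma> - \<delta>)"

definition uniformity_h1_loop :: "('a h1_loop \<times> 'a h1_loop) filter" where
  "uniformity_h1_loop = (INF e\<in>{0<..}. principal {(\<gamma>, \<delta>). dist \<gamma> \<delta> < e})"

definition open_h1_loop :: "'a h1_loop set \<Rightarrow> bool" where
  "open_h1_loop U \<longleftrightarrow> (\<forall>\<gamma>\<in>U. \<forall>\<^sub>F (\<gamma>', \<delta>) in uniformity. \<gamma>' = \<gamma> \<longrightarrow> \<delta> \<in> U)"

instance
proof
  fix x y z :: "'a h1_loop" and r :: real
  have int0: "(\<lambda>t. loop_at u t \<bullet> loop_at v t) integrable_on {0..1}" for u v :: "'a h1_loop"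
    by (intro integrable_continuous_interval continuous_intros loop_at_continuous)
  have int1: "(\<lambda>t. loop_deriv u t \<bullet> loop_deriv v t) integrable_on {0..1}" for u v :: "'a h1_loop"
    by (rule has_L2_deriv_inner_integrable[OF has_L2_deriv_loop_deriv has_L2_deriv_loop_deriv])
  show "dist x y = norm (x - y)" by (simp add: dist_h1_loop_def)
  show "sgn x = x /\<^sub>R norm x" by (simp add: sgn_h1_loop_def)
  show "uniformity = (INF e\<in>{0<..}. principal {(x, y :: 'a h1_loop). dist x y < e})"
    by (rule uniformity_h1_loop_def)
  show "open U \<longleftrightarrow> (\<forall>x\<in>U. \<forall>\<^sub>F (x', y) in uniformity. x' = x \<longrightarrow> y \<in> U)" for U :: "'a h1_loop set"
    by (rule open_h1_loop_def)
  show "x \<bullet> y = y \<bullet> x" by (simp add: inner_h1_loop_def inner_commute)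
  show "norm x = sqrt (x \<bullet> x)" by (rule norm_h1_loop_def)
  show "(x + y) \<bullet> z = x \<bullet> z + y \<bullet> z"
  proof -
    have "has_L2_deriv (loop_at (x + y)) (\<lambda>t. loop_deriv x t + loop_deriv y t)"
      using has_L2_deriv_add[OF has_L2_deriv_loop_deriv[of x] has_L2_deriv_loop_deriv[of y]]
      by (simp add: plus_h1_loop.rep_eq)
    then obtain N where N: "negligible N"
      "\<And>t. t \<notin> N \<Longrightarrow> loop_deriv (x + y) t = loop_deriv x t + loop_deriv y t"
      by (rule loop_deriv_AE) (rule that)
    have "integral {0..1} (\<lambda>t. loop_deriv (x + y) t \<bullet> loop_deriv z t)
        = integral {0..1} (\<lambda>t. loop_deriv x t \<bullet> loop_deriv z t + loop_deriv y t \<bullet> loop_deriv z t)"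
      by (rule integral_spike[OF N(1)]) (simp add: N(2) inner_add_left)
    then show ?thesis
      by (simp add: inner_h1_loop_def inner_add_left integral_add int0 int1)
  qed
  show "(r *\<^sub>R x) \<bullet> y = r * (x \<bullet> y)"
  proof -
    have "has_L2_deriv (loop_at (r *\<^sub>R x)) (\<lambda>t. r *\<^sub>R loop_deriv x t)"
      using has_L2_deriv_scaleR[OF has_L2_deriv_loop_deriv[of x], of r]
      by (simp add: scaleR_h1_loop.rep_eq)
    then obtain N where N: "negligible N"
      "\<And>t. t \<notin> N \<Longrightarrow> loop_deriv (r *\<^sub>R x) t = r *\<^sub>R loop_deriv x t"
      by (rule loop_deriv_AE) (rule that)
    have "integral {0..1} (\<lambda>t. loop_deriv (r *\<^sub>R x) t \<bullet> loop_deriv y t)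
        = integral {0..1} (\<lambda>t. r * (loop_deriv x t \<bullet> loop_deriv y t))"
      by (rule integral_spike[OF N(1)]) (simp add: N(2))
    then show ?thesis
      by (simp add: inner_h1_loop_def algebra_simps)
  qed
  have n0: "0 \<le> integral {0..1} (\<lambda>t. loop_at x t \<bullet> loop_at x t)"
    by (intro integral_nonneg int0) auto
  have n1: "0 \<le> integral {0..1} (\<lambda>t. loop_deriv x t \<bullet> loop_deriv x t)"
    by (intro integral_nonneg int1) auto
  show "0 \<le> x \<bullet> x" using n0 n1 by (simp add: inner_h1_loop_def)
  show "x \<bullet> x = 0 \<longleftrightarrow> x = 0"
  proof
    assume "x \<bullet> x = 0"
    then have "integral {0..1} (\<lambda>t. loop_at x t \<bullet> loop_at x t) = 0"
      using n0 n1 by (simp add: inner_h1_loop_def)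
    moreover have "continuous_on {0..1} (\<lambda>t. loop_at x t \<bullet> loop_at x t)"
      by (intro continuous_intros loop_at_continuous)
    ultimately have *: "loop_at x t = 0" if "t \<in> {0..1}" for t
      using integral_eq_0_iff[of 0 1 "\<lambda>t. loop_at x t \<bullet> loop_at x t"] that by simp
    have "loop_at x t = 0" for t
      using *[of "frac t"] frac_lt_1[of t] frac_ge_0[of t] by (simp add: loop_at_frac)
    then show "x = 0" by transfer auto
  next
    assume "x = 0"
    have "has_L2_deriv (loop_at (0 :: 'a h1_loop)) (\<lambda>t. 0)"
      using has_L2_deriv_const by (simp add: zero_h1_loop.rep_eq)
    then obtain N where N: "negligible N"
      "\<And>t. t \<notin> N \<Longrightarrow> loop_deriv (0 :: 'a h1_loop) t = 0"
      by (rule loop_deriv_AE) (rule that)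
    have "integral {0..1} (\<lambda>t. loop_deriv (0 :: 'a h1_loop) t \<bullet> loop_deriv (0 :: 'a h1_loop) t)
        = integral {0..1} (\<lambda>t :: real. 0 :: real)"
      by (rule integral_spike[OF N(1)]) (simp add: N(2))
    then show "x \<bullet> x = 0" by (simp add: \<open>x = 0\<close> inner_h1_loop_def)
  qed
qed

end

lift_definition loop_iterate :: "nat \<Rightarrow> 'a::euclidean_space h1_loop \<Rightarrow> 'a h1_loop"
  is "\<lambda>m \<gamma> t. \<gamma> (real m * t)"
proof (intro conjI allI)
  fix m :: nat and \<gamma> :: "real \<Rightarrow> 'a" and t :: real
  assume \<gamma>: "(\<forall>t. \<gamma> (t + 1) = \<gamma> t) \<and> (\<exists>g. has_L2_deriv \<gamma> g)"
  have "\<gamma> (s + real k) = \<gamma> s" for s k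
    using \<gamma> by (induction k) (auto simp: add.assoc[symmetric] add.commute[of 1])
  then show "\<gamma> (real m * (t + 1)) = \<gamma> (real m * t)" by (simp add: distrib_left)
next
  fix m :: nat and \<gamma> :: "real \<Rightarrow> 'a"
  assume \<gamma>: "(\<forall>t. \<gamma> (t + 1) = \<gamma> t) \<and> (\<exists>g. has_L2_deriv \<gamma> g)"
  then obtain g where g: "has_L2_deriv \<gamma> g" by blast
  show "\<exists>g. has_L2_deriv (\<lambda>t. \<gamma> (real m * t)) g"
  proof (cases "m = 0")
    case True
    then show ?thesis using has_L2_deriv_const by auto
  next
    case False
    then have m: "real m > 0" by simp
    have img: "(\<lambda>x. (1 / real m) *\<^sub>R x + - ((1 / real m) *\<^sub>R 0)) ` cbox (real m * a) (real m * b) = {a..b}"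
      for a b
    proof -
      have "(\<lambda>x. (1 / real m) *\<^sub>R x + - ((1 / real m) *\<^sub>R 0)) = (*) (1 / real m)"
        by (simp add: fun_eq_iff)
      moreover have "(*) (1 / real m) ` {real m * a..real m * b} = {1 / real m * (real m * a)..1 / real m * (real m * b)}"
        using m by (intro image_mult_atLeastAtMost) simp
      moreover have "1 / real m * (real m * c) = c" for c
        using m by simp
      ultimately show ?thesis by (simp only: cbox_interval)
    qed
    have "has_L2_deriv (\<lambda>t. \<gamma> (real m * t)) (\<lambda>t. real m *\<^sub>R g (real m * t))"
      unfolding has_L2_deriv_def
    proof (intro allI impI conjI)
      fix a b :: real assume "a \<le> b"
      then have ab: "real m * a \<le> real m * b" using m by simp
      have "((\<lambda>x. g (real m * x)) has_integral (\<gamma> (real m * b) - \<gamma> (real m * a)) /\<^sub>R real m) {a..b}"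
        unfolding inverse_eq_divide
        using has_integral_affinity[of g _ "real m * a" "real m * b" "real m" 0, unfolded img]
          has_L2_derivD(1)[OF g ab] m by simp
      from has_integral_cmul[OF this, of "real m"] m
      show "((\<lambda>t. real m *\<^sub>R g (real m * t)) has_integral \<gamma> (real m * b) - \<gamma> (real m * a)) {a..b}"
        by simp
      have "(\<lambda>x. (norm (g (real m * x)))\<^sup>2) integrable_on {a..b}"
        using integrable_affinity[of "\<lambda>x. (norm (g x))\<^sup>2" "real m * a" "real m * b" "real m" 0, unfolded img]
          has_L2_derivD(2)[OF g ab] m by simp
      from integrable_on_mult_right[OF this, of "(real m)\<^sup>2"]
      show "(\<lambda>t. (norm (real m *\<^sub>R g (real m * t)))\<^sup>2) integrable_on {a..b}"
        by (simp add: power_mult_distrib)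
    qed
    then show ?thesis by blast
  qed
qed

definition loop_length :: "'a::euclidean_space h1_loop \<Rightarrow> real" where
  "loop_length \<gamma> = integral {0..1} (\<lambda>t. norm (loop_deriv \<gamma> t))"

definition sqrt_energy :: "'a::euclidean_space h1_loop \<Rightarrow> real" where
  "sqrt_energy \<gamma> = sqrt (integral {0..1} (\<lambda>t. (norm (loop_deriv \<gamma> t))\<^sup>2))"

section \<open>Hessian and index at a critical point\<close>

definition C2_curve_in :: "'a::real_normed_vector set \<Rightarrow> 'a \<Rightarrow> 'a \<Rightarrow> (real \<Rightarrow> 'a) \<Rightarrow> bool" where
  "C2_curve_in S x v c \<longleftrightarrow> c 0 = x \<and>
     (\<exists>e>0. \<exists>c' c''. c' 0 = v \<and> continuous_on {-e<..<e} c'' \<and>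
       (\<forall>s\<in>{-e<..<e}. c s \<in> S \<and> (c has_vector_derivative c' s) (at s) \<and>
                     (c' has_vector_derivative c'' s) (at s)))"

text \<open>
  The quadratic form of the Hessian at a critical point \<open>x\<close> of the restriction of \<open>f\<close> to a
  submanifold \<open>S\<close> of a normed space: the second derivative of \<open>f\<close> along a \<open>C\<^sup>2\<close> curve in \<open>S\<close>
  through \<open>x\<close> with velocity \<open>v\<close>, which at a critical point depends on \<open>v\<close> only.  (Only meaningful
  for critical \<open>x\<close> and \<open>v\<close> tangent to \<open>S\<close>.)
\<close>

definition hessian_form :: "('a::real_normed_vector \<Rightarrow> real) \<Rightarrow> 'a set \<Rightarrow> 'a \<Rightarrow> 'a \<Rightarrow> real" where
  "hessian_form f S x v = (THE h. \<forall>c. C2_curve_in S x v c \<longrightarrow> deriv (deriv (\<lambda>s. f (c s))) 0 = h)"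

text \<open>
  The largest dimension of a subspace of \<open>T\<close> on which \<open>Q\<close> is negative definite, \<open>\<infinity>\<close> if there is no
  largest one; the subspaces are given by bases, since \<open>dim\<close> is \<open>0\<close> in infinite dimension.
\<close>

definition form_index :: "'a::real_vector set \<Rightarrow> ('a \<Rightarrow> real) \<Rightarrow> enat" where
  "form_index T Q = Sup {enat (card B) | B. finite B \<and> independent B \<and> span B \<subseteq> T \<and>
                                         (\<forall>v\<in>span B. v \<noteq> 0 \<longrightarrow> Q v < 0)}"

section \<open>Closed geodesics on ellipsoids\<close>

text \<open>
  The coordinates \<open>x\<^sub>0, \<dots>, x\<^sub>n\<close> are indexed by a linearly ordered type with \<open>n + 1\<close> elements.
\<close>

definition ellipsoid_params :: "(real, 'n::{finite,linorder}) vec set" where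
  "ellipsoid_params = {a. (\<forall>i. 0 < a $ i) \<and> (\<forall>i j. i < j \<longrightarrow> a $ i < a $ j)}"

definition ellipsoid :: "real ^ 'n \<Rightarrow> (real ^ 'n) set" where
  "ellipsoid a = {x. (\<Sum>i\<in>UNIV. (x $ i)\<^sup>2 / (a $ i)\<^sup>2) = 1}"

definition ellipsoid_tangent :: "real ^ 'n \<Rightarrow> real ^ 'n \<Rightarrow> (real ^ 'n) set" where
  "ellipsoid_tangent a x = {v. (\<Sum>i\<in>UNIV. x $ i * v $ i / (a $ i)\<^sup>2) = 0}"

definition loop_space :: "real ^ 'n \<Rightarrow> (real ^ 'n) h1_loop set" where
  "loop_space a = {\<gamma>. \<forall>t. loop_at \<gamma> t \<in> ellipsoid a}"

definition loop_space_tangent :: "real ^ 'n \<Rightarrow> (real ^ 'n) h1_loop \<Rightarrow> (real ^ 'n) h1_loop set" where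
  "loop_space_tangent a \<gamma> = {V. \<forall>t. loop_at V t \<in> ellipsoid_tangent a (loop_at \<gamma> t)}"

text \<open>
  Geodesics of a submanifold of Euclidean space with the induced metric: the covariant
  acceleration, which is the tangential part of \<open>\<gamma>''\<close>, vanishes.
\<close>

definition closed_geodesic :: "real ^ 'n \<Rightarrow> (real ^ 'n) h1_loop \<Rightarrow> bool" where
  "closed_geodesic a \<gamma> \<longleftrightarrow> \<gamma> \<in> loop_space a \<and> (\<exists>t. loop_at \<gamma> t \<noteq> loop_at \<gamma> 0) \<and>
     (\<exists>\<gamma>' \<gamma>''. \<forall>t. (loop_at \<gamma> has_vector_derivative \<gamma>' t) (at t) \<and>
                  (\<gamma>' has_vector_derivative \<gamma>'' t) (at t) \<and>
                  (\<forall>v\<in>ellipsoid_tangent a (loop_at \<gamma> t). \<gamma>'' t \<bullet> v = 0))"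

definition geodesic_index :: "real ^ 'n \<Rightarrow> (real ^ 'n) h1_loop \<Rightarrow> enat" where
  "geodesic_index a \<gamma> =
     form_index (loop_space_tangent a \<gamma>) (hessian_form sqrt_energy (loop_space a) \<gamma>)"

text \<open>
  The limit is taken in the extended reals; the term for \<open>m = 0\<close> is irrelevant.
\<close>

definition average_index :: "real ^ 'n \<Rightarrow> (real ^ 'n) h1_loop \<Rightarrow> ereal" where
  "average_index a \<gamma> =
     lim (\<lambda>m. ereal_of_enat (geodesic_index a (loop_iterate m \<gamma>)) / ereal (real m))"

definition mean_frequency :: "real ^ 'n \<Rightarrow> (real ^ 'n) h1_loop \<Rightarrow> ereal" where
  "mean_frequency a \<gamma> = average_index a \<gamma> / ereal (loop_length \<gamma>)"

definition is_short_geodesic :: "real ^ 'n \<Rightarrow> 'n \<Rightarrow> 'n \<Rightarrow> (real ^ 'n) h1_loop \<Rightarrow> bool" where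
  "is_short_geodesic a i j \<gamma> \<longleftrightarrow> closed_geodesic a \<gamma> \<and> inj_on (loop_at \<gamma>) {0..<1} \<and>
     range (loop_at \<gamma>) = {x \<in> ellipsoid a. \<forall>k. k \<noteq> i \<and> k \<noteq> j \<longrightarrow> x $ k = 0}"

text \<open>
  The ellipse in the \<open>(x\<^sub>i, x\<^sub>j)\<close>-plane determines its constant speed parametrization up to the
  starting point and the orientation, on which the mean frequency does not depend.
\<close>

definition short_geodesic :: "real ^ 'n \<Rightarrow> 'n \<Rightarrow> 'n \<Rightarrow> (real ^ 'n) h1_loop" where
  "short_geodesic a i j = (SOME \<gamma>. is_short_geodesic a i j \<gamma>)"

end

theory Submission
  imports Defs
begin

text \<open>
  Along the ellipse \<open>\<gamma>\<close> in the \<open>(x\<^sub>i, x\<^sub>j)\<close>-plane, \<open>\<gamma>'' = - \<lambda> A\<^sup>-\<^sup>2 \<gamma>\<close> and the Hessian is a positive multiple of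
  \<open>\<integral> \<parallel>V'\<parallel>\<^sup>2 - \<lambda> \<langle>V, A\<^sup>-\<^sup>2 V\<rangle>\<close>.  The part tangent to the plane is nonnegative, and each other coordinate \<open>k\<close>
  contributes the Hill form \<open>\<integral> u'\<^sup>2 - (\<lambda> / a\<^sub>k\<^sup>2) u\<^sup>2\<close>, whose index is estimated by Sturm comparison with
  solutions of \<open>w'' = - p w\<close>.  The coordinates of \<open>\<gamma>\<close> are such solutions, with two zeros per period; hence
  every \<open>k\<close> with \<open>a\<^sub>i < a\<^sub>k < a\<^sub>j\<close> contributes exactly \<open>2\<close> to the average index.  For the remaining \<open>k\<close>, Jacobi's
  equation is solved by means of Joachimsthal's integral, which gives an explicit rotation number.

  On the open set where \<open>a\<^sub>j\<close> exceeds a large multiple of \<open>a\<^sub>i\<close> for \<open>i < j\<close>, the length of \<open>\<gamma>\<^sub>0\<^sub>j\<close> lies between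
  \<open>4 a\<^sub>j\<close> and \<open>8 a\<^sub>j\<close>, so its mean frequency is of order \<open>1 / a\<^sub>j\<close> for \<open>j \<ge> 2\<close>; these \<open>n - 1\<close> numbers are distinct.
  For \<open>n = 2\<close> the three mean frequencies are about \<open>1 / (\<pi> a\<^sub>2)\<close>, \<open>1 / (2 a\<^sub>2)\<close> and at least \<open>1 / a\<^sub>2\<close>.
\<close>

section \<open>Primitives of integrable functions\<close>

text \<open>The index is squeezed between two counts of the same zeros. Requiring a field to vanish
  at the \<open>n\<close> zeros of a comparison solution imposes \<open>n\<close> linear conditions
  that make the Hill form nonnegative, and the \<open>n\<close> arcs between the zeros carry
  \<open>n\<close> fields with disjoint supports on which it is negative. A comparison solution
  needs two zeros one period apart but need not be periodic, so its frequency can be tuned to fit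
  any number of arcs into \<open>m\<close> periods. The index of the \<open>m\<close>-th iterate is
  thus known up to an error independent of \<open>m\<close>, and the limit exists without an index
  theorem. The obstacle is that loops are only H^1: product rules are needed for primitives of
  integrable functions, and since the Hessian is a definite description over C^2 curves, a curve
  with given velocity must be built that is C^2 in the H^1 norm. The large multiple is
  \<open>4 (n + 1)\<close>: it separates the upper bound \<open>(n + 1) / a\<^sub>k\<close> for the
  frequency of \<open>\<gamma>\<^sub>0\<^sub>k\<close> from the lower bound
  \<open>1 / (4 a\<^sub>j)\<close> for that of \<open>\<gamma>\<^sub>0\<^sub>j\<close>, where
  \<open>2 \<le> j < k\<close>. Finally, \<open>n - 1 \<ge> (n + 1) / 2\<close> exactly for
  \<open>n \<ge> 3\<close>.\<close>

lemma eq_endpoints_if_small_increments: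
  fixes F :: "real \<Rightarrow> 'a::real_normed_vector" and G :: "real \<Rightarrow> real"
  assumes "a \<le> b"
    and small: "\<And>e. e > 0 \<Longrightarrow> \<exists>d>0. \<forall>x y. a \<le> x \<longrightarrow> x \<le> y \<longrightarrow> y \<le> b \<longrightarrow> y - x < d \<longrightarrow>
           norm (F y - F x) \<le> e * (G y - G x)"
  shows "F b = F a"
proof (rule ccontr)
  assume "F b \<noteq> F a"
  then have pos: "norm (F b - F a) > 0" by simp
  \<comment> \<open>Telescoping over a partition finer than \<open>d\<close> bounds the total
    increment of \<open>F\<close> by \<open>e\<close> times that of \<open>G\<close>, for every
    \<open>e\<close>. In the applications \<open>G\<close> is an indefinite integral of norms and
    takes the place of length, since \<open>F\<close> need not be differentiable at every
    point.\<close>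
  have bound: "norm (F b - F a) \<le> e * (G b - G a)" if e: "e > 0" for e
  proof -
    obtain d where d: "d > 0" and D: "\<And>x y. a \<le> x \<Longrightarrow> x \<le> y \<Longrightarrow> y \<le> b \<Longrightarrow> y - x < d \<Longrightarrow>
           norm (F y - F x) \<le> e * (G y - G x)"
      using small[OF e] by blast
    obtain N :: nat where N: "real N > (b - a) / d" using reals_Archimedean2 by blast
    have "(b - a) / d \<ge> 0" using d assms(1) by simp
    then have N0: "N > 0" using N by (cases N) auto
    define x where "x i = a + real i * ((b - a) / N)" for i :: nat
    have step: "x (Suc i) - x i = (b - a) / N" for i by (simp add: x_def distrib_right add_divide_distrib)
    have small_step: "(b - a) / N < d" using N d N0 by (simp add: field_simps)
    have x0: "x 0 = a" by (simp add: x_def)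
    have xN: "x N = b" using N0 by (simp add: x_def)
    have mono: "x i \<le> x (Suc i)" for i
    proof -
      have "(b - a) / real N \<ge> 0" using assms(1) by simp
      then show ?thesis using step[of i] by linarith
    qed
    have low: "a \<le> x i" for i using assms(1) by (simp add: x_def)
    have high: "x i \<le> b" if "i \<le> N" for i
      using lift_Suc_mono_le[of x, OF mono that] xN by simp
    have "norm (F b - F a) = norm (\<Sum>i<N. F (x (Suc i)) - F (x i))"
      using sum_lessThan_telescope[of "\<lambda>i. F (x i)" N] by (simp add: x0 xN)
    also have "\<dots> \<le> (\<Sum>i<N. norm (F (x (Suc i)) - F (x i)))" by (rule norm_sum)
    also have "\<dots> \<le> (\<Sum>i<N. e * (G (x (Suc i)) - G (x i)))"
      by (rule sum_mono) (rule D, use low mono high step small_step in auto)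
    also have "\<dots> = e * (G b - G a)"
      using sum_lessThan_telescope[of "\<lambda>i. G (x i)" N] by (simp add: x0 xN flip: sum_distrib_left)
    finally show ?thesis .
  qed
  \<comment> \<open>\<open>e = 1\<close> forces \<open>G b > G a\<close>, so the \<open>e\<close>
    chosen next, which halves the left side, is positive.\<close>
  have G: "G b - G a > 0" using less_le_trans[OF pos bound[OF zero_less_one]] by simp
  have "norm (F b - F a) \<le> norm (F b - F a) / 2"
    using bound[of "norm (F b - F a) / (2 * (G b - G a))"] G pos by (simp add: field_simps)
  then show False using pos by simp
qed

lemma has_integral_primitive_increment:
  fixes u g :: "real \<Rightarrow> 'a::euclidean_space"
  assumes "\<And>x. a \<le> x \<Longrightarrow> x \<le> b \<Longrightarrow> (g has_integral (u x - u a)) {a..x}" "a \<le> x" "x \<le> y" "y \<le> b"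
  shows "(g has_integral (u y - u x)) {x..y}"
proof -
  have i: "g integrable_on {a..y}" using assms(1)[of y] assms(2-) by (meson has_integral_integrable order_trans)
  have "g integrable_on {x..y}" using integrable_on_subinterval[OF i, of x y] assms(2-) by auto
  moreover have "integral {x..y} g = u y - u x"
    using Henstock_Kurzweil_Integration.integral_combine[OF assms(2,3) i]
      integral_unique[OF assms(1)[of y]] integral_unique[OF assms(1)[of x]] assms(2-)
    by (simp add: algebra_simps)
  ultimately show ?thesis by (metis has_integral_integral)
qed

lemma has_integral_increment:
  fixes f :: "real \<Rightarrow> 'a::euclidean_space"
  assumes "f integrable_on {a..b}" "a \<le> x" "x \<le> y" "y \<le> b"
  shows "(f has_integral (integral {a..y} f - integral {a..x} f)) {x..y}"
proof (rule has_integral_primitive_increment[OF _ assms(2-4), of f "\<lambda>z. integral {a..z} f"])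
  fix z assume "a \<le> z" "z \<le> b"
  then show "(f has_integral integral {a..z} f - integral {a..a} f) {a..z}"
    using integrable_on_subinterval[OF assms(1), of a z] by (auto simp: has_integral_integral)
qed

lemma primitive_continuous_on:
  fixes u g :: "real \<Rightarrow> 'a::euclidean_space"
  assumes "\<And>x. a \<le> x \<Longrightarrow> x \<le> b \<Longrightarrow> (g has_integral (u x - u a)) {a..x}"
  shows "continuous_on {a..b} u"
proof (cases "a \<le> b")
  case True
  have "continuous_on {a..b} (\<lambda>x. u a + integral {a..x} g)"
    using assms[OF True]
    by (intro continuous_intros indefinite_integral_continuous_1) (auto simp: integrable_on_def)
  moreover have "u a + integral {a..x} g = u x" if "x \<in> {a..b}" for x
    using integral_unique[OF assms[of x]] that by simp
  ultimately show ?thesis by (rule continuous_on_eq)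
qed auto

lemma absolutely_integrable_bilinear_continuous:
  fixes prod :: "'a::euclidean_space \<Rightarrow> 'b::euclidean_space \<Rightarrow> 'c::euclidean_space"
  assumes "bounded_bilinear prod" "g absolutely_integrable_on {a..b::real}" "continuous_on {a..b} v"
  shows "(\<lambda>t. prod (g t) (v t)) absolutely_integrable_on {a..b}"
proof -
  interpret bounded_bilinear prod by fact
  have "(\<lambda>t. prod (v t) (g t)) absolutely_integrable_on {a..b}" if "bilinear prod"  for prod :: "'b \<Rightarrow> 'a \<Rightarrow> 'c"
    using that
  proof (rule absolutely_integrable_bounded_measurable_product)
    show "v \<in> borel_measurable (lebesgue_on {a..b})"
      using assms(3) by (intro continuous_imp_measurable_on_sets_lebesgue) auto
    show "bounded (v ` {a..b})"
      using assms(3) by (intro compact_imp_bounded compact_continuous_image) auto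
  qed (use assms in auto)
  moreover have "bilinear (\<lambda>x y. prod y x)"
    using bilinear_conv_bounded_bilinear[of prod] assms(1) by (auto simp: bilinear_def)
  ultimately show ?thesis by blast
qed

text \<open>Integration by parts where the derivatives are merely integrable. On a short interval
  the error of the Leibniz formula is at most \<open>e\<close> times the integral of
  \<open>norm (g t) + norm (h t)\<close>, because \<open>u\<close> and \<open>v\<close> are
  uniformly continuous; \<open>eq_endpoints_if_small_increments\<close> adds these errors
  up.\<close>

lemma has_integral_bilinear_product:
  fixes prod :: "'a::euclidean_space \<Rightarrow> 'b::euclidean_space \<Rightarrow> 'c::euclidean_space" and a b :: real
  assumes bil: "bounded_bilinear prod" and ab: "a \<le> b"
    and u: "\<And>x. a \<le> x \<Longrightarrow> x \<le> b \<Longrightarrow> (g has_integral (u x - u a)) {a..x}"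
    and v: "\<And>x. a \<le> x \<Longrightarrow> x \<le> b \<Longrightarrow> (h has_integral (v x - v a)) {a..x}"
    and g: "g absolutely_integrable_on {a..b}" and h: "h absolutely_integrable_on {a..b}"
  shows "((\<lambda>t. prod (g t) (v t) + prod (u t) (h t)) has_integral (prod (u b) (v b) - prod (u a) (v a))) {a..b}"
proof -
  interpret bounded_bilinear prod by fact
  define H where "H t = prod (g t) (v t) + prod (u t) (h t)" for t
  have cu: "continuous_on {a..b} u"
    by (rule primitive_continuous_on) (rule u)
  have cv: "continuous_on {a..b} v"
    by (rule primitive_continuous_on) (rule v)
  have int1: "(\<lambda>t. prod (g t) (v t)) integrable_on {a..b}"
    using absolutely_integrable_bilinear_continuous[OF bil g cv] set_lebesgue_integral_eq_integral by blast
  have int2: "(\<lambda>t. prod (u t) (h t)) integrable_on {a..b}"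
    using absolutely_integrable_bilinear_continuous[OF flip h cu] set_lebesgue_integral_eq_integral by blast
  have Hint: "H integrable_on {a..b}" unfolding H_def using int1 int2 by (rule integrable_add)
  obtain K where K: "K > 0" "\<And>x y. norm (prod x y) \<le> norm x * norm y * K"
    using pos_bounded by blast
  have ng: "(\<lambda>t. norm (g t)) integrable_on {a..b}" and nh: "(\<lambda>t. norm (h t)) integrable_on {a..b}"
    using g h by (auto simp: absolutely_integrable_on_def)
  define N where "N t = norm (g t) + norm (h t)" for t
  have Nint: "N integrable_on {a..b}" unfolding N_def using ng nh by (rule integrable_add)
  define F where "F x = prod (u x) (v x) - integral {a..x} H" for x
  define G where "G x = integral {a..x} N" for x
  have "F b = F a"
  proof (rule eq_endpoints_if_small_increments[OF ab])
    fix e :: real assume e: "e > 0"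
    then have e': "e / K > 0" using K by simp
    have "uniformly_continuous_on {a..b} u" "uniformly_continuous_on {a..b} v"
      using cu cv by (auto intro: compact_uniformly_continuous)
    then obtain d1 d2 where d: "d1 > 0" "d2 > 0"
      and d1: "\<And>x y. x \<in> {a..b} \<Longrightarrow> y \<in> {a..b} \<Longrightarrow> dist y x < d1 \<Longrightarrow> dist (u y) (u x) < e / K"
      and d2: "\<And>x y. x \<in> {a..b} \<Longrightarrow> y \<in> {a..b} \<Longrightarrow> dist y x < d2 \<Longrightarrow> dist (v y) (v x) < e / K"
      unfolding uniformly_continuous_on_def using e' by metis
    show "\<exists>d>0. \<forall>x y. a \<le> x \<longrightarrow> x \<le> y \<longrightarrow> y \<le> b \<longrightarrow> y - x < d \<longrightarrow> norm (F y - F x) \<le> e * (G y - G x)"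
    proof (intro exI conjI allI impI)
      show "min d1 d2 > 0" using d by simp
      fix x y assume xy: "a \<le> x" "x \<le> y" "y \<le> b" "y - x < min d1 d2"
      have sub: "{x..y} \<subseteq> {a..b}" using xy by auto
      have gi: "(g has_integral (u y - u x)) {x..y}"
        using has_integral_primitive_increment[OF u xy(1,2,3)] by simp
      have hi: "(h has_integral (v y - v x)) {x..y}"
        using has_integral_primitive_increment[OF v xy(1,2,3)] by simp
      have Hi: "(H has_integral (integral {a..y} H - integral {a..x} H)) {x..y}"
        by (rule has_integral_increment[OF Hint xy(1,2,3)])
      have Ni: "(N has_integral (G y - G x)) {x..y}"
        unfolding G_def by (rule has_integral_increment[OF Nint xy(1,2,3)])
      \<comment> \<open>Freezing \<open>v\<close> at the right end and \<open>u\<close> at the left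
        end makes the discrete Leibniz rule exact, so \<open>F y - F x\<close> is the integral of a
        single small integrand.\<close>
      have i1: "((\<lambda>s. prod (g s) (v y)) has_integral prod (u y - u x) (v y)) {x..y}"
        using has_integral_linear[OF gi bounded_linear_left[of "v y"]] by (simp add: o_def)
      have i2: "((\<lambda>s. prod (u x) (h s)) has_integral prod (u x) (v y - v x)) {x..y}"
        using has_integral_linear[OF hi bounded_linear_right[of "u x"]] by (simp add: o_def)
      have "((\<lambda>s. prod (g s) (v y) + prod (u x) (h s) - H s) has_integral
              prod (u y - u x) (v y) + prod (u x) (v y - v x) - (integral {a..y} H - integral {a..x} H)) {x..y}"
        by (intro has_integral_diff has_integral_add i1 i2 Hi)
      moreover have "prod (u y - u x) (v y) + prod (u x) (v y - v x) - (integral {a..y} H - integral {a..x} H) = F y - F x"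
        by (simp add: F_def diff_left diff_right)
      ultimately have D: "((\<lambda>s. prod (g s) (v y) + prod (u x) (h s) - H s) has_integral (F y - F x)) {x..y}"
        by simp
      have "norm (F y - F x) \<le> integral {x..y} (\<lambda>s. e * N s)"
        unfolding integral_unique[OF D, symmetric]
      proof (rule integral_norm_bound_integral)
        show "(\<lambda>s. e * N s) integrable_on {x..y}"
          using has_integral_mult_right[OF Ni] by blast
        fix s assume s: "s \<in> {x..y}"
        have "prod (g s) (v y) + prod (u x) (h s) - H s = prod (g s) (v y - v s) + prod (u x - u s) (h s)"
          by (simp add: H_def diff_left diff_right)
        moreover have "norm (prod (g s) (v y - v s)) \<le> norm (g s) * (e / K) * K"
        proof (rule order_trans[OF K(2)], intro mult_right_mono mult_left_mono)
          have "dist y s < d2" using s xy by (auto simp: dist_real_def)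
          then show "norm (v y - v s) \<le> e / K" using d2[of s y] s sub xy by (force simp: dist_norm)
        qed (use K in auto)
        moreover have "norm (prod (u x - u s) (h s)) \<le> (e / K) * norm (h s) * K"
        proof (rule order_trans[OF K(2)], intro mult_right_mono)
          have "dist x s < d1" using s xy by (auto simp: dist_real_def)
          then show "norm (u x - u s) \<le> e / K" using d1[of s x] s sub xy by (force simp: dist_norm)
        qed (use K in auto)
        ultimately show "norm (prod (g s) (v y) + prod (u x) (h s) - H s) \<le> e * N s"
          using K(1) norm_triangle_ineq[of "prod (g s) (v y - v s)" "prod (u x - u s) (h s)"]
          by (simp add: N_def distrib_left mult.commute)
      qed (use D in blast)
      then show "norm (F y - F x) \<le> e * (G y - G x)"
        using integral_unique[OF Ni] by simp
    qed
  qed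
  then have "integral {a..b} H = prod (u b) (v b) - prod (u a) (v a)"
    by (simp add: F_def algebra_simps)
  then have "(H has_integral prod (u b) (v b) - prod (u a) (v a)) {a..b}"
    using Hint by (metis has_integral_integral)
  then show ?thesis by (simp add: H_def[abs_def])
qed

text \<open>The scheme used for products, now based on
  \<open>1 / f y - 1 / f x = - (f y - f x) / (f x * f y)\<close> and on the uniform continuity of
  \<open>1 / (f x * f y)\<close> on the square.\<close>

lemma has_integral_reciprocal:
  fixes f g :: "real \<Rightarrow> real"
  assumes ab: "a \<le> b"
    and f: "\<And>x. a \<le> x \<Longrightarrow> x \<le> b \<Longrightarrow> (g has_integral (f x - f a)) {a..x}"
    and g: "g absolutely_integrable_on {a..b}" and pos: "\<And>x. a \<le> x \<Longrightarrow> x \<le> b \<Longrightarrow> f x \<ge> 1"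
  shows "((\<lambda>t. - g t / (f t)\<^sup>2) has_integral (1 / f b - 1 / f a)) {a..b}"
proof -
  define H where "H t = - g t / (f t)\<^sup>2" for t
  define k where "k t = - 1 / (f t)\<^sup>2" for t
  have cf: "continuous_on {a..b} f" using f by (rule primitive_continuous_on)
  have nz: "f x \<noteq> 0" if "x \<in> {a..b}" for x using pos[of x] that by auto
  have ck: "continuous_on {a..b} k" unfolding k_def using cf nz by (intro continuous_intros) auto
  have Hk: "H t = g t * k t" for t by (simp add: H_def k_def)
  have Hint: "H integrable_on {a..b}"
    unfolding Hk[abs_def]
    using absolutely_integrable_bilinear_continuous[OF bounded_bilinear_mult g ck] set_lebesgue_integral_eq_integral by blast
  have Nint: "(\<lambda>t. \<bar>g t\<bar>) integrable_on {a..b}"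
    using g by (auto simp: absolutely_integrable_on_def)
  define F where "F x = 1 / f x - integral {a..x} H" for x
  define G where "G x = integral {a..x} (\<lambda>t. \<bar>g t\<bar>)" for x
  have "F b = F a"
  proof (rule eq_endpoints_if_small_increments[OF ab])
    fix e :: real assume e: "e > 0"
    have "uniformly_continuous_on ({a..b} \<times> {a..b}) (\<lambda>(x, y). 1 / (f x * f y))"
      using nz by (intro compact_uniformly_continuous compact_Times)
        (auto simp: case_prod_unfold intro!: continuous_intros continuous_on_compose2[OF cf])
    from this[unfolded uniformly_continuous_on_def, rule_format, OF e]
    obtain d where d: "d > 0" and dd: "\<And>p q. p \<in> {a..b} \<times> {a..b} \<Longrightarrow> q \<in> {a..b} \<times> {a..b} \<Longrightarrow> dist q p < d \<Longrightarrow>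
        dist (1 / (f (fst q) * f (snd q))) (1 / (f (fst p) * f (snd p))) < e"
      by (auto simp: case_prod_unfold)
    show "\<exists>d>0. \<forall>x y. a \<le> x \<longrightarrow> x \<le> y \<longrightarrow> y \<le> b \<longrightarrow> y - x < d \<longrightarrow> norm (F y - F x) \<le> e * (G y - G x)"
    proof (intro exI conjI allI impI)
      show "d / 2 > 0" using d by simp
      fix x y assume xy: "a \<le> x" "x \<le> y" "y \<le> b" "y - x < d / 2"
      have gi: "(g has_integral (f y - f x)) {x..y}"
        using has_integral_primitive_increment[OF f xy(1,2,3)] by simp
      have Hi: "(H has_integral (integral {a..y} H - integral {a..x} H)) {x..y}"
        by (rule has_integral_increment[OF Hint xy(1,2,3)])
      have Ni: "((\<lambda>t. \<bar>g t\<bar>) has_integral (G y - G x)) {x..y}"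
        unfolding G_def by (rule has_integral_increment[OF Nint xy(1,2,3)])
      have i1: "((\<lambda>s. g s * (- 1 / (f x * f y))) has_integral (f y - f x) * (- 1 / (f x * f y))) {x..y}"
        using has_integral_mult_left[OF gi] .
      have "((\<lambda>s. g s * (- 1 / (f x * f y)) - H s) has_integral
              (f y - f x) * (- 1 / (f x * f y)) - (integral {a..y} H - integral {a..x} H)) {x..y}"
        by (intro has_integral_diff i1 Hi)
      moreover have "(f y - f x) * (- 1 / (f x * f y)) - (integral {a..y} H - integral {a..x} H) = F y - F x"
        using nz[of x] nz[of y] xy by (simp add: F_def field_simps)
      ultimately have D: "((\<lambda>s. g s * (- 1 / (f x * f y)) - H s) has_integral (F y - F x)) {x..y}"
        by simp
      have "norm (F y - F x) \<le> integral {x..y} (\<lambda>s. e * \<bar>g s\<bar>)"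
        unfolding integral_unique[OF D, symmetric]
      proof (rule integral_norm_bound_integral)
        show "(\<lambda>s. e * \<bar>g s\<bar>) integrable_on {x..y}"
          using has_integral_mult_right[OF Ni] by blast
        fix s assume s: "s \<in> {x..y}"
        have "dist (s, s) (x, y) \<le> dist s x + dist s y"
          using dist_triangle[of "(s,s)" "(x,y)" "(x,s)"] by (simp add: dist_Pair_Pair)
        also have "\<dots> < d" using s xy by (auto simp: dist_real_def)
        finally have "dist (1 / (f s * f s)) (1 / (f x * f y)) < e"
          using dd[of "(x, y)" "(s, s)"] s xy by auto
        moreover have "g s * (- 1 / (f x * f y)) - H s = g s * (1 / (f s * f s) - 1 / (f x * f y))"
          by (simp add: H_def power2_eq_square algebra_simps)
        ultimately show "norm (g s * (- 1 / (f x * f y)) - H s) \<le> e * \<bar>g s\<bar>"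
          using mult_left_mono[of "\<bar>1 / (f s * f s) - 1 / (f x * f y)\<bar>" e "\<bar>g s\<bar>"]
          by (simp add: abs_mult dist_real_def mult.commute)
      qed (use D in blast)
      then show "norm (F y - F x) \<le> e * (G y - G x)"
        using integral_unique[OF Ni] by simp
    qed
  qed
  then have "integral {a..b} H = 1 / f b - 1 / f a"
    by (simp add: F_def algebra_simps)
  then have "(H has_integral 1 / f b - 1 / f a) {a..b}"
    using Hint by (metis has_integral_integral)
  then show ?thesis by (simp add: H_def[abs_def])
qed

text \<open>Cauchy-Schwarz against the constant 1: integrate the square of \<open>h\<close> minus
  its mean \<open>c\<close>.\<close>

lemma integral_square_ge:
  fixes h :: "real \<Rightarrow> real"
  assumes "a \<le> b" "h integrable_on {a..b}" "(\<lambda>t. (h t)\<^sup>2) integrable_on {a..b}"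
  shows "(integral {a..b} h)\<^sup>2 \<le> (b - a) * integral {a..b} (\<lambda>t. (h t)\<^sup>2)"
proof (cases "a < b")
  case True
  define I where "I = integral {a..b} h"
  define c where "c = I / (b - a)"
  have h: "(h has_integral I) {a..b}" using assms(2) by (simp add: I_def has_integral_integral)
  have "((\<lambda>t. (h t)\<^sup>2 - 2 * c * h t + c\<^sup>2) has_integral
      (integral {a..b} (\<lambda>t. (h t)\<^sup>2) - 2 * c * I + (b - a) *\<^sub>R c\<^sup>2)) {a..b}"
    using has_integral_const_real[of "c\<^sup>2" a b] assms(1)
    by (intro has_integral_add has_integral_diff has_integral_mult_right h integrable_integral assms(3)) auto
  then have "0 \<le> integral {a..b} (\<lambda>t. (h t)\<^sup>2) - 2 * c * I + (b - a) * c\<^sup>2"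
  proof (rule has_integral_nonneg[THEN order_trans])
    fix t
    have "(h t)\<^sup>2 - 2 * c * h t + c\<^sup>2 = (h t - c)\<^sup>2" by (simp add: power2_diff algebra_simps)
    then show "0 \<le> (h t)\<^sup>2 - 2 * c * h t + c\<^sup>2" by simp
  qed simp
  also have "\<dots> = integral {a..b} (\<lambda>t. (h t)\<^sup>2) - I\<^sup>2 / (b - a)"
  proof -
    have "2 * c * I = 2 * (I\<^sup>2 / (b - a))" "(b - a) * c\<^sup>2 = I\<^sup>2 / (b - a)"
      using True by (simp_all add: c_def power2_eq_square)
    then show ?thesis by simp
  qed
  finally show ?thesis using True by (simp add: I_def field_simps)
next
  case False
  then have "a = b" using assms(1) by simp
  then show ?thesis by simp
qed

text \<open>Serves for two changes of variable: arc length on an ellipse and the phase of the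
  Liouville substitution. Gaining a fixed \<open>C > 0\<close> in each period makes the primitive
  unbounded in both directions, hence a bijection of the line with differentiable inverse.\<close>

lemma ex_periodic_antiderivative:
  fixes f :: "real \<Rightarrow> real"
  assumes cont: "continuous_on UNIV f" and pos: "\<And>t. f t > 0" and T: "T > 0" and per: "\<And>t. f (t + T) = f t"
  obtains F G C where "\<And>t. (F has_real_derivative f t) (at t)" "\<And>t. F (t + T) = F t + C" "C > 0"
    "F 0 = 0" "\<And>t. G (F t) = t" "\<And>s. F (G s) = s" "\<And>s. (G has_real_derivative 1 / f (G s)) (at s)"
    "strict_mono F" "strict_mono G"
proof -
  have "\<exists>F. \<forall>x. -\<infinity> < ereal x \<longrightarrow> ereal x < \<infinity> \<longrightarrow> (F has_vector_derivative f x) (at x)"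
    using cont by (intro einterval_antiderivative) (auto simp: continuous_on_eq_continuous_at)
  then obtain F0 where F0: "\<And>x. (F0 has_real_derivative f x) (at x)"
    by (auto simp: has_real_derivative_iff_has_vector_derivative)
  define F where "F t = F0 t - F0 0" for t
  have D: "(F has_real_derivative f x) (at x)" for x
    unfolding F_def by (auto intro!: derivative_eq_intros F0)
  have inc: "F x < F y" if "x < y" for x y
    using DERIV_pos_imp_increasing[OF that, of F] D pos by blast
  then have sm: "strict_mono F" by (simp add: strict_mono_def)
  define C where "C = F T"
  have F00: "F 0 = 0" by (simp add: F_def)
  have C: "C > 0" using inc[of 0 T] T by (simp add: C_def F00)
  have DT: "((\<lambda>t. F (t + T)) has_real_derivative f x) (at x)" for x
    using DERIV_shift[of F "f x" x T] D[of "x + T"] by (simp add: per)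
  have perF: "F (t + T) = F t + C" for t
  proof -
    have "\<forall>x. ((\<lambda>t. F (t + T) - F t) has_real_derivative 0) (at x)"
      by (auto intro!: derivative_eq_intros DT D)
    from DERIV_const_ratio_const[of t 0 "\<lambda>t. F (t + T) - F t" 0] this
    have "F (t + T) - F t = F (0 + T) - F 0"
      using DERIV_isconst_all by blast
    then show ?thesis by (simp add: C_def F00)
  qed
  have pn: "F (t + real n * T) = F t + real n * C" for t n
  proof (induction n)
    case (Suc n)
    have "F (t + real (Suc n) * T) = F ((t + real n * T) + T)" by (simp add: algebra_simps)
    then show ?case unfolding perF Suc by (simp add: algebra_simps)
  qed simp
  have surj: "\<exists>t. F t = s" for s
  proof -
    obtain n :: nat where n: "real n > \<bar>s\<bar> / C" using reals_Archimedean2 by blast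
    then have nC: "real n * C > \<bar>s\<bar>" using C by (simp add: field_simps)
    have "F (real n * T) = real n * C" using pn[of 0 n] by (simp add: F00)
    moreover have "F (- (real n * T)) = - (real n * C)" using pn[of "- (real n * T)" n] by (simp add: F00)
    ultimately have "F (- (real n * T)) \<le> s" "s \<le> F (real n * T)" using nC by auto
    moreover have "- (real n * T) \<le> real n * T" using T by simp
    ultimately show ?thesis
      using IVT[of F "- (real n * T)" s "real n * T"] D DERIV_isCont by blast
  qed
  define G where "G s = (SOME t. F t = s)" for s
  have FG: "F (G s) = s" for s unfolding G_def by (rule someI_ex[OF surj])
  have GF: "G (F t) = t" for t using FG[of "F t"] sm strict_mono_eq by blast
  have contG: "isCont G s" for s
    using isCont_inverse_function[of 1 "G s" G F] GF DERIV_isCont[OF D] unfolding FG by simp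
  have DG: "(G has_real_derivative 1 / f (G s)) (at s)" for s
    using DERIV_inverse_function[where f = F and g = G and x = s and a = "s - 1" and b = "s + 1", OF D]
      FG contG pos[of "G s"]
    by (simp add: inverse_eq_divide)
  have smG: "strict_mono G"
    by (rule strict_monoI) (metis FG sm strict_mono_less)
  show thesis by (rule that[OF D perF C F00 GF FG DG sm smG])
qed

text \<open>The exceptional set \<open>N\<close> is there because an L^2 derivative of a periodic
  function is periodic only up to a null set.\<close>

lemma integral_periodic_shift:
  fixes h :: "real \<Rightarrow> real"
  assumes N: "negligible N" and per: "\<And>t. t \<notin> N \<Longrightarrow> h (t + 1) = h t" and int: "\<And>a b. h integrable_on {a..b}" and c: "0 \<le> c" "c \<le> 1"
  shows "integral {c..c + 1} h = integral {0..1} h"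
proof -
  have "integral {1..c + 1} h = integral {0..c} (\<lambda>t. h (t + 1))"
    using integral_shift_real_ivl[of "1" "1" "c + 1" h] by simp
  also have "\<dots> = integral {0..c} h" by (rule integral_spike[OF N]) (simp add: per)
  finally have *: "integral {1..c + 1} h = integral {0..c} h" .
  have "integral {c..c + 1} h = integral {c..1} h + integral {1..c + 1} h"
    using Henstock_Kurzweil_Integration.integral_combine[of c 1 "c + 1" h] int c by simp
  moreover have "integral {0..1} h = integral {0..c} h + integral {c..1} h"
    using Henstock_Kurzweil_Integration.integral_combine[of 0 c 1 h] int c by simp
  ultimately show ?thesis using * by simp
qed

section \<open>Calculus in the space of \<open>H\<^sup>1\<close> loops\<close>

lemma has_integral_measurable_on:
  fixes f :: "real \<Rightarrow> 'a::euclidean_space"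
  assumes "(f has_integral y) {a..b}"
  shows "f \<in> borel_measurable (lebesgue_on {a..b})"
  using has_integral_implies_lebesgue_measurable[OF assms]
  by (subst borel_measurable_restrict_space_iff) auto

lemma has_L2_deriv_abs_integrable:
  assumes "has_L2_deriv u g"
  shows "g absolutely_integrable_on {a..b}"
proof (cases "a \<le> b")
  case True
  show ?thesis
  proof (rule measurable_bounded_by_integrable_imp_absolutely_integrable)
    show "g \<in> borel_measurable (lebesgue_on {a..b})" by (rule has_L2_deriv_measurable[OF assms])
    show "(\<lambda>t. 1 + (norm (g t))\<^sup>2) integrable_on {a..b}"
      by (intro integrable_add has_L2_derivD(2)[OF assms True] integrable_const_ivl)
    fix t
    have "0 \<le> (norm (g t) - 1)\<^sup>2" "0 \<le> norm (g t)" by auto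
    then show "norm (g t) \<le> 1 + (norm (g t))\<^sup>2" unfolding power2_diff one_power2 mult_1_right by linarith
  qed auto
next
  case False
  then show ?thesis by simp
qed

lemma has_L2_deriv_isCont: "has_L2_deriv u g \<Longrightarrow> isCont u t"
  using has_L2_deriv_continuous[of u g "t - 1" "t + 1"]
  by (auto intro!: continuous_on_interior[of "{t - 1..t + 1}"])

lemma has_L2_deriv_continuous_on: "has_L2_deriv u g \<Longrightarrow> continuous_on S u"
  using has_L2_deriv_isCont continuous_at_imp_continuous_on by blast

lemma has_L2_derivI_bounded:
  fixes u g :: "real \<Rightarrow> 'a::euclidean_space"
  assumes "\<And>a b. a \<le> b \<Longrightarrow> (g has_integral (u b - u a)) {a..b}" and "\<And>t. norm (g t) \<le> k t" and "continuous_on UNIV k"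
  shows "has_L2_deriv u g"
  unfolding has_L2_deriv_def
proof (intro allI impI conjI assms)
  fix a b :: real assume ab: "a \<le> b"
  have m: "g \<in> borel_measurable (lebesgue_on {a..b})"
    by (rule has_integral_measurable_on[OF assms(1)[OF ab]])
  show "(\<lambda>t. (norm (g t))\<^sup>2) integrable_on {a..b}"
  proof (rule measurable_bounded_by_integrable_imp_integrable)
    show "(\<lambda>t. (norm (g t))\<^sup>2) \<in> borel_measurable (lebesgue_on {a..b})" using m by measurable
    show "(\<lambda>t. (k t)\<^sup>2) integrable_on {a..b}"
      by (intro integrable_continuous_interval continuous_intros continuous_on_subset[OF assms(3)]) auto
    show "norm ((norm (g t))\<^sup>2) \<le> (k t)\<^sup>2" for t
      using power_mono[OF assms(2)[of t], of 2] by simp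
  qed auto
qed

lemma has_L2_deriv_C1:
  fixes u g :: "real \<Rightarrow> 'a::euclidean_space"
  assumes "\<And>t. (u has_vector_derivative g t) (at t)" "continuous_on UNIV g"
  shows "has_L2_deriv u g"
proof (rule has_L2_derivI_bounded)
  show "(g has_integral (u b - u a)) {a..b}" if "a \<le> b" for a b
    using that assms(1) by (intro fundamental_theorem_of_calculus) (auto intro: has_vector_derivative_at_within)
  show "continuous_on UNIV (\<lambda>t. norm (g t))" using assms(2) by (intro continuous_intros)
qed auto

text \<open>On a bounded interval both factors are bounded by some \<open>M\<close>, so the
  derivative of the product is at most \<open>M * K\<close> times
  \<open>norm (g t) + norm (h t)\<close>, which is square integrable.\<close>

lemma has_L2_deriv_bilinear:
  fixes prod :: "'a::euclidean_space \<Rightarrow> 'b::euclidean_space \<Rightarrow> 'c::euclidean_space"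
  assumes bil: "bounded_bilinear prod" and u: "has_L2_deriv u g" and v: "has_L2_deriv v h"
  shows "has_L2_deriv (\<lambda>t. prod (u t) (v t)) (\<lambda>t. prod (g t) (v t) + prod (u t) (h t))"
  unfolding has_L2_deriv_def
proof (intro allI impI conjI)
  interpret bounded_bilinear prod by fact
  fix a b :: real assume ab: "a \<le> b"
  show P: "((\<lambda>t. prod (g t) (v t) + prod (u t) (h t)) has_integral prod (u b) (v b) - prod (u a) (v a)) {a..b}"
    by (rule has_integral_bilinear_product[OF bil ab])
      (use has_L2_derivD(1)[OF u] has_L2_derivD(1)[OF v] has_L2_deriv_abs_integrable[OF u] has_L2_deriv_abs_integrable[OF v] in auto)
  note m = has_integral_measurable_on[OF P]
  obtain K where K: "K > 0" "\<And>x y. norm (prod x y) \<le> norm x * norm y * K"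
    using pos_bounded by blast
  have "bounded (u ` {a..b})" "bounded (v ` {a..b})"
    using compact_continuous_image[OF has_L2_deriv_continuous[OF u]] compact_continuous_image[OF has_L2_deriv_continuous[OF v]]
    by (auto intro: compact_imp_bounded)
  then obtain M where M: "M > 0" "\<And>t. t \<in> {a..b} \<Longrightarrow> norm (u t) \<le> M" "\<And>t. t \<in> {a..b} \<Longrightarrow> norm (v t) \<le> M"
    unfolding bounded_pos by (metis imageI less_max_iff_disj max.coboundedI1 max.coboundedI2)
  show "(\<lambda>t. (norm (prod (g t) (v t) + prod (u t) (h t)))\<^sup>2) integrable_on {a..b}"
  proof (rule measurable_bounded_by_integrable_imp_integrable)
    show "(\<lambda>t. (norm (prod (g t) (v t) + prod (u t) (h t)))\<^sup>2) \<in> borel_measurable (lebesgue_on {a..b})"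
      using m by measurable
    show "(\<lambda>t. (2 * (M * K)\<^sup>2) * ((norm (g t))\<^sup>2 + (norm (h t))\<^sup>2)) integrable_on {a..b}"
      by (intro integrable_on_mult_right integrable_add has_L2_derivD(2)[OF u ab] has_L2_derivD(2)[OF v ab])
    fix t assume t: "t \<in> {a..b}"
    have 1: "norm (prod (g t) (v t)) \<le> norm (g t) * M * K"
      by (rule order_trans[OF K(2)]) (use K M(3)[OF t] in \<open>auto intro!: mult_right_mono mult_left_mono\<close>)
    have 2: "norm (prod (u t) (h t)) \<le> M * norm (h t) * K"
      by (rule order_trans[OF K(2)]) (use K M(2)[OF t] in \<open>auto intro!: mult_right_mono mult_left_mono\<close>)
    have "norm (prod (g t) (v t) + prod (u t) (h t)) \<le> (M * K) * (norm (g t) + norm (h t))"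
      using 1 2 norm_triangle_ineq[of "prod (g t) (v t)" "prod (u t) (h t)"] by (simp add: algebra_simps)
    then have "(norm (prod (g t) (v t) + prod (u t) (h t)))\<^sup>2 \<le> ((M * K) * (norm (g t) + norm (h t)))\<^sup>2"
      by (intro power_mono) auto
    also have "\<dots> = (M * K)\<^sup>2 * (norm (g t) + norm (h t))\<^sup>2" by (simp add: power_mult_distrib)
    also have "\<dots> \<le> (M * K)\<^sup>2 * (2 * ((norm (g t))\<^sup>2 + (norm (h t))\<^sup>2))"
    proof (intro mult_left_mono)
      have "0 \<le> (norm (g t) - norm (h t))\<^sup>2" by simp
      then show "(norm (g t) + norm (h t))\<^sup>2 \<le> 2 * ((norm (g t))\<^sup>2 + (norm (h t))\<^sup>2)"
        by (simp add: power2_diff power2_sum)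
    qed simp
    finally show "norm ((norm (prod (g t) (v t) + prod (u t) (h t)))\<^sup>2) \<le> (2 * (M * K)\<^sup>2) * ((norm (g t))\<^sup>2 + (norm (h t))\<^sup>2)"
      by (simp add: algebra_simps)
  qed auto
qed

text \<open>The product rule with the constant scalar factor 1.\<close>

lemma has_L2_deriv_linear:
  fixes f :: "'a::euclidean_space \<Rightarrow> 'b::euclidean_space"
  assumes f: "bounded_linear f" and u: "has_L2_deriv u g"
  shows "has_L2_deriv (\<lambda>t. f (u t)) (\<lambda>t. f (g t))"
proof -
  interpret f: bounded_linear f by fact
  have bil: "bounded_bilinear (\<lambda>(r::real) x. r *\<^sub>R f x)"
    using bounded_bilinear.comp[OF bounded_bilinear_scaleR bounded_linear_ident f] .
  show ?thesis using has_L2_deriv_bilinear[OF bil has_L2_deriv_const[of 1] u] by simp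
qed

text \<open>For \<open>f \<ge> 1\<close> the derivative of the reciprocal is dominated by that of
  \<open>f\<close>. The denominators that occur later have the form \<open>1 + s^2 w\<close> with
  \<open>w \<ge> 0\<close>.\<close>

lemma has_L2_deriv_reciprocal:
  fixes f g :: "real \<Rightarrow> real"
  assumes f: "has_L2_deriv f g" and pos: "\<And>t. f t \<ge> 1"
  shows "has_L2_deriv (\<lambda>t. 1 / f t) (\<lambda>t. - g t / (f t)\<^sup>2)"
  unfolding has_L2_deriv_def
proof (intro allI impI conjI)
  fix a b :: real assume ab: "a \<le> b"
  show P: "((\<lambda>t. - g t / (f t)\<^sup>2) has_integral 1 / f b - 1 / f a) {a..b}"
    by (rule has_integral_reciprocal[OF ab])
      (use has_L2_derivD(1)[OF f] has_L2_deriv_abs_integrable[OF f] pos in auto)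
  note m = has_integral_measurable_on[OF P]
  show "(\<lambda>t. (norm (- g t / (f t)\<^sup>2))\<^sup>2) integrable_on {a..b}"
  proof (rule measurable_bounded_by_integrable_imp_integrable[OF _ has_L2_derivD(2)[OF f ab]])
    show "(\<lambda>t. (norm (- g t / (f t)\<^sup>2))\<^sup>2) \<in> borel_measurable (lebesgue_on {a..b})" using m by measurable
    fix t
    have "1 \<le> (f t)\<^sup>2" using pos[of t] by (simp add: one_le_power)
    then have "\<bar>g t\<bar> / (f t)\<^sup>2 \<le> \<bar>g t\<bar>" by (simp add: divide_le_eq mult_le_cancel_left1)
    then have "(\<bar>g t\<bar> / (f t)\<^sup>2)\<^sup>2 \<le> \<bar>g t\<bar>\<^sup>2" by (intro power_mono) auto
    then show "norm ((norm (- g t / (f t)\<^sup>2))\<^sup>2) \<le> (norm (g t))\<^sup>2" by simp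
  qed auto
qed

lemma has_L2_deriv_norm_integrable:
  assumes "has_L2_deriv \<gamma> g"
  shows "(\<lambda>t. norm (g t)) integrable_on {a..b}"
  using has_L2_deriv_abs_integrable[OF assms, of a b] by (simp add: absolutely_integrable_on_def)

section \<open>The energy as a bounded bilinear form\<close>

definition energy_form :: "'a::euclidean_space h1_loop \<Rightarrow> 'a h1_loop \<Rightarrow> real" where
  "energy_form \<gamma> \<delta> = integral {0..1} (\<lambda>t. loop_deriv \<gamma> t \<bullet> loop_deriv \<delta> t)"

definition L2_form :: "'a::euclidean_space h1_loop \<Rightarrow> 'a h1_loop \<Rightarrow> real" where
  "L2_form \<gamma> \<delta> = integral {0..1} (\<lambda>t. loop_at \<gamma> t \<bullet> loop_at \<delta> t)"

lemma loop_at_continuous_on [continuous_intros]: "continuous_on S (loop_at \<gamma>)"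
  by (rule has_L2_deriv_continuous_on[OF has_L2_deriv_loop_deriv])

lemma loop_deriv_inner_integrable: "(\<lambda>t. loop_deriv u t \<bullet> loop_deriv v t) integrable_on {a..b}"
  by (rule has_L2_deriv_inner_integrable[OF has_L2_deriv_loop_deriv has_L2_deriv_loop_deriv])

lemma loop_at_inner_integrable: "(\<lambda>t. loop_at u t \<bullet> loop_at v t) integrable_on {a..b}"
  by (intro integrable_continuous_interval continuous_intros)

text \<open>\<open>loop_deriv\<close> is an arbitrary choice; this lets a computation use any
  explicit derivative instead.\<close>

lemma energy_form_eq:
  assumes "has_L2_deriv (loop_at \<gamma>) g" "has_L2_deriv (loop_at \<delta>) h"
  shows "energy_form \<gamma> \<delta> = integral {0..1} (\<lambda>t. g t \<bullet> h t)"
proof -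
  obtain N where N: "negligible N" "\<And>t. t \<notin> N \<Longrightarrow> loop_deriv \<gamma> t = g t"
    by (rule loop_deriv_AE[OF assms(1)]) blast
  obtain M where M: "negligible M" "\<And>t. t \<notin> M \<Longrightarrow> loop_deriv \<delta> t = h t"
    by (rule loop_deriv_AE[OF assms(2)]) blast
  show ?thesis unfolding energy_form_def
    by (rule integral_spike[of "N \<union> M"]) (use N M in auto)
qed

lemma bilinear_L2_form:
  "L2_form (x + y) z = L2_form x z + L2_form y z" "L2_form z (x + y) = L2_form z x + L2_form z y"
  "L2_form (r *\<^sub>R x) z = r * L2_form x z" "L2_form z (r *\<^sub>R x) = r * L2_form z x"
  by (simp_all add: L2_form_def inner_add_left inner_add_right integral_add loop_at_inner_integrable)

lemma inner_eq_forms: "inner x y = L2_form x y + energy_form x y"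
  by (simp add: inner_h1_loop_def energy_form_def L2_form_def)

text \<open>\<open>loop_deriv\<close> is additive only almost everywhere. Subtracting the L^2 part
  from the inner product gives bilinearity without another argument about null sets.\<close>

lemma bilinear_energy_form:
  "energy_form (x + y) z = energy_form x z + energy_form y z"
  "energy_form z (x + y) = energy_form z x + energy_form z y"
  "energy_form (r *\<^sub>R x) z = r * energy_form x z" "energy_form z (r *\<^sub>R x) = r * energy_form z x"
  using inner_eq_forms[of "x + y" z] inner_eq_forms[of x z] inner_eq_forms[of y z]
    inner_eq_forms[of z "x + y"] inner_eq_forms[of z x] inner_eq_forms[of z y]
    inner_eq_forms[of "r *\<^sub>R x" z] inner_eq_forms[of z "r *\<^sub>R x"]
  by (simp_all add: inner_add_left inner_add_right bilinear_L2_form algebra_simps)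

lemma energy_form_commute: "energy_form x y = energy_form y x"
  by (simp add: energy_form_def inner_commute)

lemma L2_form_nonneg: "L2_form x x \<ge> 0" 
  unfolding L2_form_def by (intro integral_nonneg loop_at_inner_integrable) auto

lemma energy_form_nonneg: "energy_form x x \<ge> 0" 
  unfolding energy_form_def by (intro integral_nonneg loop_deriv_inner_integrable) auto

lemma norm_h1_loop_sq: "(norm x)\<^sup>2 = L2_form x x + energy_form x x"
  by (simp add: power2_norm_eq_inner inner_eq_forms)

text \<open>The form is only semidefinite, as it vanishes on constant loops; its Cauchy-Schwarz
  inequality comes from the sign of a quadratic polynomial in \<open>s\<close>.\<close>

lemma energy_form_le: "\<bar>energy_form x y\<bar> \<le> norm x * norm y"
proof -
  have le: "energy_form x x \<le> (norm x)\<^sup>2" for x :: "'a h1_loop"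
    using L2_form_nonneg[of x] by (simp add: norm_h1_loop_sq)
  have poly: "0 \<le> energy_form x x * s\<^sup>2 + 2 * s * energy_form x y + energy_form y y" for s
    using energy_form_nonneg[of "s *\<^sub>R x + y"]
    by (simp add: bilinear_energy_form energy_form_commute[of y x] power2_eq_square algebra_simps)
  have "(energy_form x y)\<^sup>2 \<le> (norm x)\<^sup>2 * (norm y)\<^sup>2"
  proof -
    have "(energy_form x y)\<^sup>2 \<le> energy_form x x * energy_form y y"
    proof (cases "energy_form x x = 0")
      case True
      have "energy_form x y = 0"
      proof (rule ccontr)
        assume n: "energy_form x y \<noteq> 0"
        \<comment> \<open>When the leading coefficient vanishes, this choice of \<open>s\<close>
          would give the polynomial the value -1.\<close>
        have "0 \<le> - (energy_form y y + 1) + energy_form y y"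
          using poly[of "- (energy_form y y + 1) / (2 * energy_form x y)"] n True by (simp add: field_simps)
        then show False by simp
      qed
      then show ?thesis using True by simp
    next
      case False
      then have p: "energy_form x x > 0" using energy_form_nonneg[of x] by simp
      have "0 \<le> energy_form x x * (- energy_form x y / energy_form x x)\<^sup>2
          + 2 * (- energy_form x y / energy_form x x) * energy_form x y + energy_form y y" by (rule poly)
      also have "\<dots> = energy_form y y - (energy_form x y)\<^sup>2 / energy_form x x"
        using p by (simp add: power2_eq_square)
      finally show ?thesis using p by (simp add: field_simps)
    qed
    also have "\<dots> \<le> (norm x)\<^sup>2 * (norm y)\<^sup>2"
      by (intro mult_mono le energy_form_nonneg) auto
    finally show ?thesis .
  qed
  then have "(energy_form x y)\<^sup>2 \<le> (norm x * norm y)\<^sup>2" by (simp add: power_mult_distrib)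
  then show ?thesis using abs_le_square_iff[of "energy_form x y" "norm x * norm y"] by simp
qed

lemma bounded_bilinear_energy_form: "bounded_bilinear energy_form"
  by standard (auto simp: bilinear_energy_form intro!: exI[of _ 1] energy_form_le)

lemma sqrt_energy_eq: "sqrt_energy \<gamma> = sqrt (energy_form \<gamma> \<gamma>)"
  by (simp add: sqrt_energy_def energy_form_def power2_norm_eq_inner)

text \<open>The Sobolev embedding on the circle: values of \<open>V\<close> at two points differ by
  at most the integral \<open>A\<close> of the speed. Averaging over the second point leaves the
  mean of the norm of \<open>V\<close> plus \<open>A\<close>, each at most \<open>norm V\<close>.
  Evaluation at a point is therefore continuous, so constraints on curves of loops can be
  differentiated pointwise.\<close>

lemma norm_loop_at_le: "norm (loop_at V t) \<le> 2 * norm V"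
proof -
  have le: "norm (loop_at V t) \<le> 2 * norm V" if t: "t \<in> {0..1}" for t
  proof -
    let ?g = "loop_deriv V"
    define A where "A = integral {0..1} (\<lambda>s. norm (?g s))"
    have ng: "(\<lambda>s. norm (?g s)) integrable_on {a..b}" for a b
      by (rule has_L2_deriv_norm_integrable[OF has_L2_deriv_loop_deriv])
    have inc: "norm (loop_at V y - loop_at V x) \<le> A" if "0 \<le> x" "x \<le> y" "y \<le> 1" for x y
    proof -
      have I: "(?g has_integral (loop_at V y - loop_at V x)) {x..y}"
        using has_L2_derivD(1)[OF has_L2_deriv_loop_deriv that(2)] .
      have "norm (loop_at V y - loop_at V x) \<le> integral {x..y} (\<lambda>s. norm (?g s))"
        unfolding integral_unique[OF I, symmetric]
        by (rule integral_norm_bound_integral) (use I ng in auto)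
      also have "\<dots> \<le> A" unfolding A_def
        by (rule integral_subset_le) (use that ng in auto)
      finally show ?thesis .
    qed
    have inc2: "norm (loop_at V t) \<le> norm (loop_at V s) + A" if "s \<in> {0..1}" for s
    proof -
      have "norm (loop_at V t - loop_at V s) \<le> A"
        using inc[of s t] inc[of t s] that t by (cases "s \<le> t") (auto simp: norm_minus_commute)
      then show ?thesis using norm_triangle_ineq2[of "loop_at V t" "loop_at V s"] by linarith
    qed
    have nV: "(\<lambda>s. norm (loop_at V s)) integrable_on {0..1}"
      by (intro integrable_continuous_interval continuous_intros)
    have "integral {0..1} (\<lambda>s::real. norm (loop_at V t)) \<le> integral {0..1} (\<lambda>s. norm (loop_at V s) + A)"
      by (rule integral_le) (use inc2 nV in \<open>auto intro!: integrable_add\<close>)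
    then have 1: "norm (loop_at V t) \<le> integral {0..1} (\<lambda>s. norm (loop_at V s)) + A"
      by (subst (asm) integral_add) (use nV in auto)
    have "(integral {0..1} (\<lambda>s. norm (loop_at V s)))\<^sup>2 \<le> (norm V)\<^sup>2"
      using integral_square_ge[of 0 1 "\<lambda>s. norm (loop_at V s)"] nV loop_at_inner_integrable[of V V]
        energy_form_nonneg[of V]
      by (simp add: norm_h1_loop_sq L2_form_def power2_norm_eq_inner)
    then have 2: "integral {0..1} (\<lambda>s. norm (loop_at V s)) \<le> norm V"
      by (rule power2_le_imp_le) simp
    have "A\<^sup>2 \<le> (norm V)\<^sup>2" unfolding A_def
      using integral_square_ge[of 0 1 "\<lambda>s. norm (?g s)"] ng loop_deriv_inner_integrable[of V V]
        L2_form_nonneg[of V]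
      by (simp add: norm_h1_loop_sq energy_form_def power2_norm_eq_inner)
    then have 3: "A \<le> norm V" by (rule power2_le_imp_le) simp
    show ?thesis using 1 2 3 by simp
  qed
  show ?thesis using le[of "frac t"] frac_lt_1[of t] frac_ge_0[of t] by (simp add: loop_at_frac)
qed

lemma bounded_linear_loop_at: "bounded_linear (\<lambda>V. loop_at V t)"
  by (rule bounded_linear_intro[of _ 2]) (use norm_loop_at_le in \<open>auto simp: mult.commute\<close>)

lift_definition loop_scale :: "real h1_loop \<Rightarrow> 'a::euclidean_space h1_loop \<Rightarrow> 'a h1_loop"
  is "\<lambda>f V t. f t *\<^sub>R V t"
  using has_L2_deriv_bilinear[OF bounded_bilinear_scaleR] by fastforce

lemma loop_at_scale [simp]: "loop_at (loop_scale f V) t = loop_at f t *\<^sub>R loop_at V t"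
  by (simp add: loop_scale.rep_eq)

lemma h1_loop_eqI: "(\<And>t. loop_at V t = loop_at W t) \<Longrightarrow> V = W"
  using loop_at_inject by blast

text \<open>The H^1 norm is submultiplicative up to a constant. The squared sup bound gives factors
  4, the square of a sum another 2, and \<open>4 + 8 + 8 = 20 \<le> 25\<close>.\<close>

lemma norm_loop_scale_le: "norm (loop_scale f V) \<le> norm f * norm V * 5"
proof -
  let ?f = "loop_at f" and ?V = "loop_at V" and ?g = "loop_deriv f" and ?h = "loop_deriv V"
  have D: "has_L2_deriv (loop_at (loop_scale f V)) (\<lambda>t. ?g t *\<^sub>R ?V t + ?f t *\<^sub>R ?h t)"
    unfolding loop_scale.rep_eq
    by (rule has_L2_deriv_bilinear[OF bounded_bilinear_scaleR has_L2_deriv_loop_deriv has_L2_deriv_loop_deriv])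
  have fb: "(?f t)\<^sup>2 \<le> 4 * (norm f)\<^sup>2" for t
    using power_mono[OF norm_loop_at_le[of f t], of 2] by (simp add: power_mult_distrib)
  have Vb: "(norm (?V t))\<^sup>2 \<le> 4 * (norm V)\<^sup>2" for t
    using power_mono[OF norm_loop_at_le[of V t], of 2] by (simp add: power_mult_distrib)
  have "energy_form (loop_scale f V) (loop_scale f V)
      = integral {0..1} (\<lambda>t. (?g t *\<^sub>R ?V t + ?f t *\<^sub>R ?h t) \<bullet> (?g t *\<^sub>R ?V t + ?f t *\<^sub>R ?h t))"
    by (rule energy_form_eq[OF D D])
  also have "\<dots> \<le> integral {0..1} (\<lambda>t. 8 * (norm V)\<^sup>2 * (?g t \<bullet> ?g t) + 8 * (norm f)\<^sup>2 * (?h t \<bullet> ?h t))"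
  proof (rule integral_le)
    fix t
    let ?x = "?g t *\<^sub>R ?V t" and ?y = "?f t *\<^sub>R ?h t"
    have "(?x + ?y) \<bullet> (?x + ?y) \<le> 2 * (norm ?x)\<^sup>2 + 2 * (norm ?y)\<^sup>2"
    proof -
      have "0 \<le> (?x - ?y) \<bullet> (?x - ?y)" by simp
      then show ?thesis by (simp only: power2_norm_eq_inner inner_add_left inner_add_right inner_diff_left inner_diff_right inner_commute[of ?y ?x])
    qed
    also have "\<dots> = 2 * ((?g t \<bullet> ?g t) * (norm (?V t))\<^sup>2) + 2 * ((?f t)\<^sup>2 * (?h t \<bullet> ?h t))"
    proof -
      have "?g t \<bullet> ?g t = (?g t)\<^sup>2" "?h t \<bullet> ?h t = (norm (?h t))\<^sup>2"
        by (simp_all add: power2_eq_square power2_norm_eq_inner[symmetric])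
      then show ?thesis by (simp add: power_mult_distrib)
    qed
    also have "\<dots> \<le> 2 * ((?g t \<bullet> ?g t) * (4 * (norm V)\<^sup>2)) + 2 * ((4 * (norm f)\<^sup>2) * (?h t \<bullet> ?h t))"
      by (intro add_mono mult_left_mono mult_right_mono fb Vb) auto
    finally show "(?x + ?y) \<bullet> (?x + ?y) \<le> 8 * (norm V)\<^sup>2 * (?g t \<bullet> ?g t) + 8 * (norm f)\<^sup>2 * (?h t \<bullet> ?h t)"
      by (simp add: mult_ac)
  qed (intro has_L2_deriv_inner_integrable[OF D D] integrable_add integrable_on_mult_right loop_deriv_inner_integrable)+
  also have "\<dots> = 8 * (norm V)\<^sup>2 * energy_form f f + 8 * (norm f)\<^sup>2 * energy_form V V"
    unfolding energy_form_def
    by (subst integral_add) (intro integrable_on_mult_right loop_deriv_inner_integrable | simp add: integral_mult_right)+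
  finally have E: "energy_form (loop_scale f V) (loop_scale f V)
      \<le> 8 * (norm V)\<^sup>2 * energy_form f f + 8 * (norm f)\<^sup>2 * energy_form V V" .
  have "L2_form (loop_scale f V) (loop_scale f V) \<le> integral {0..1} (\<lambda>t. 4 * (norm f)\<^sup>2 * (?V t \<bullet> ?V t))"
    unfolding L2_form_def
  proof (rule integral_le)
    show "loop_at (loop_scale f V) t \<bullet> loop_at (loop_scale f V) t \<le> 4 * (norm f)\<^sup>2 * (?V t \<bullet> ?V t)" for t
      using mult_right_mono[OF fb[of t], of "?V t \<bullet> ?V t"] by (simp add: power2_eq_square)
  qed (intro loop_at_inner_integrable integrable_on_mult_right)+
  also have "\<dots> = 4 * (norm f)\<^sup>2 * L2_form V V" by (simp add: L2_form_def)
  finally have L: "L2_form (loop_scale f V) (loop_scale f V) \<le> 4 * (norm f)\<^sup>2 * L2_form V V" .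
  have "(norm (loop_scale f V))\<^sup>2 \<le> 4 * (norm f)\<^sup>2 * L2_form V V + (8 * (norm V)\<^sup>2 * energy_form f f + 8 * (norm f)\<^sup>2 * energy_form V V)"
    using E L unfolding norm_h1_loop_sq[of "loop_scale f V"] by linarith
  also have "\<dots> \<le> 4 * (norm f)\<^sup>2 * (norm V)\<^sup>2 + (8 * (norm V)\<^sup>2 * (norm f)\<^sup>2 + 8 * (norm f)\<^sup>2 * (norm V)\<^sup>2)"
    using L2_form_nonneg[of f] L2_form_nonneg[of V] energy_form_nonneg[of V] energy_form_nonneg[of f]
    by (intro add_mono mult_left_mono) (simp_all add: norm_h1_loop_sq)
  also have "\<dots> \<le> (norm f * norm V * 5)\<^sup>2" by (simp add: power_mult_distrib mult.commute)
  finally show ?thesis by (rule power2_le_imp_le) simp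
qed

lemma bounded_bilinear_loop_scale: "bounded_bilinear loop_scale"
proof
  show "\<exists>K. \<forall>a b. norm (loop_scale a b) \<le> norm a * norm b * K" using norm_loop_scale_le by blast
qed (auto intro!: h1_loop_eqI simp: algebra_simps)

lift_definition const_loop :: "'a::euclidean_space \<Rightarrow> 'a h1_loop" is "\<lambda>c t. c"
  using has_L2_deriv_const by blast

lemma loop_at_const [simp]: "loop_at (const_loop c) t = c"
  by (simp add: const_loop.rep_eq)

text \<open>The norm bound makes the family \<open>1 / (1 + s^2 w)\<close> locally bounded in
  \<open>s\<close>, from which its continuity is deduced.\<close>

lemma ex_reciprocal_loop:
  fixes f :: "real h1_loop"
  assumes f: "\<And>t. loop_at f t \<ge> 1"
  shows "\<exists>X :: real h1_loop. (\<forall>t. loop_at X t = 1 / loop_at f t) \<and> norm X \<le> 1 + norm f"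
proof -
  have D: "has_L2_deriv (\<lambda>t. 1 / loop_at f t) (\<lambda>t. - loop_deriv f t / (loop_at f t)\<^sup>2)"
    by (rule has_L2_deriv_reciprocal[OF has_L2_deriv_loop_deriv f])
  define X where "X = Abs_h1_loop (\<lambda>t. 1 / loop_at f t)"
  have X: "loop_at X = (\<lambda>t. 1 / loop_at f t)"
    unfolding X_def by (rule Abs_h1_loop_inverse) (use D in \<open>auto simp: loop_at_periodic\<close>)
  have DX: "has_L2_deriv (loop_at X) (\<lambda>t. - loop_deriv f t / (loop_at f t)\<^sup>2)"
    using D by (simp add: X)
  have "energy_form X X \<le> energy_form f f"
    unfolding energy_form_eq[OF DX DX] unfolding energy_form_def
  proof (rule integral_le)
    fix t
    have "1 \<le> (loop_at f t)\<^sup>2" using f[of t] by (simp add: one_le_power)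
    then have "\<bar>loop_deriv f t\<bar> / (loop_at f t)\<^sup>2 \<le> \<bar>loop_deriv f t\<bar>"
      by (simp add: divide_le_eq mult_le_cancel_left1)
    then have "(\<bar>loop_deriv f t\<bar> / (loop_at f t)\<^sup>2)\<^sup>2 \<le> \<bar>loop_deriv f t\<bar>\<^sup>2" by (intro power_mono) auto
    then show "(- loop_deriv f t / (loop_at f t)\<^sup>2) \<bullet> (- loop_deriv f t / (loop_at f t)\<^sup>2) \<le> loop_deriv f t \<bullet> loop_deriv f t"
      by (simp add: power2_eq_square)
  qed (intro has_L2_deriv_inner_integrable[OF DX DX] loop_deriv_inner_integrable)+
  moreover have "L2_form X X \<le> integral {0..1} (\<lambda>t::real. 1::real)"
    unfolding L2_form_def
  proof (rule integral_le)
    show "loop_at X t \<bullet> loop_at X t \<le> 1" for t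
      using f[of t] mult_mono[of "1 / loop_at f t" 1 "1 / loop_at f t" 1] by (simp add: X)
  qed (rule loop_at_inner_integrable, rule integrable_const_ivl)
  ultimately have "(norm X)\<^sup>2 \<le> 1 + (norm f)\<^sup>2"
    using L2_form_nonneg[of f] by (simp add: norm_h1_loop_sq)
  also have "\<dots> \<le> (1 + norm f)\<^sup>2" by (simp add: power2_sum)
  finally have "norm X \<le> 1 + norm f" by (rule power2_le_imp_le) simp
  then show ?thesis using X by (intro exI[of _ X]) simp
qed

text \<open>Smoothness in \<open>s\<close> is clear for each fixed \<open>t\<close>; here it is
  needed in the H^1 norm. The resolvent identity
  \<open>X y - X s = - (y^2 - s^2) w (X s) (X y)\<close> in the algebra of loops gives continuity,
  then the derivative \<open>- 2 s w (X s)^2\<close>, and this formula can be differentiated again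
  by the product rule.\<close>

lemma ex_C2_reciprocal_family:
  assumes w: "\<And>t. loop_at w t \<ge> 0"
  obtains X X' X'' where "\<And>s t. loop_at (X s) t = 1 / (1 + s\<^sup>2 * loop_at w t)"
    "\<And>s. (X has_vector_derivative X' s) (at s)" "\<And>s. (X' has_vector_derivative X'' s) (at s)"
    "continuous_on UNIV X''" "X' 0 = 0"
proof -
  interpret bb: bounded_bilinear "loop_scale :: real h1_loop \<Rightarrow> real h1_loop \<Rightarrow> real h1_loop"
    by (rule bounded_bilinear_loop_scale)
  have "\<exists>X. (\<forall>t. loop_at X t = 1 / (1 + s\<^sup>2 * loop_at w t)) \<and> norm X \<le> 1 + norm (const_loop (1::real)) + s\<^sup>2 * norm w" for s
  proof -
    have "\<exists>X. (\<forall>t. loop_at X t = 1 / loop_at (const_loop 1 + s\<^sup>2 *\<^sub>R w) t) \<and> norm X \<le> 1 + norm (const_loop 1 + s\<^sup>2 *\<^sub>R w)"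
      by (rule ex_reciprocal_loop) (use w in simp)
    then obtain X where "\<And>t. loop_at X t = 1 / loop_at (const_loop 1 + s\<^sup>2 *\<^sub>R w) t" "norm X \<le> 1 + norm (const_loop 1 + s\<^sup>2 *\<^sub>R w)"
      by blast
    then show ?thesis
      using norm_triangle_ineq[of "const_loop (1::real)" "s\<^sup>2 *\<^sub>R w"] by (intro exI[of _ X]) auto
  qed
  then obtain X where X: "\<And>s t. loop_at (X s) t = 1 / (1 + s\<^sup>2 * loop_at w t)"
    and nX: "\<And>s. norm (X s) \<le> 1 + norm (const_loop (1::real)) + s\<^sup>2 * norm w" by metis
  have pos: "1 + s\<^sup>2 * loop_at w t > 0" for s t
    using w[of t] by (simp add: add_pos_nonneg)
  have diff: "X y - X s = - (y\<^sup>2 - s\<^sup>2) *\<^sub>R loop_scale w (loop_scale (X s) (X y))" for y s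
  proof (rule h1_loop_eqI)
    fix t
    show "loop_at (X y - X s) t = loop_at (- (y\<^sup>2 - s\<^sup>2) *\<^sub>R loop_scale w (loop_scale (X s) (X y))) t"
    proof -
      define p q where "p = 1 + s\<^sup>2 * loop_at w t" and "q = 1 + y\<^sup>2 * loop_at w t"
      have pq: "p \<noteq> 0" "q \<noteq> 0" using pos[of s t] pos[of y t] by (auto simp: p_def q_def)
      have "1 / q - 1 / p = (p - q) * (1 / p * (1 / q))" using pq by (simp add: divide_simps)
      also have "p - q = - (y\<^sup>2 - s\<^sup>2) * loop_at w t" by (simp add: p_def q_def algebra_simps)
      finally show ?thesis by (simp add: X p_def[symmetric] q_def[symmetric])
    qed
  qed
  have cont: "isCont X s" for s
  proof -
    have bnd: "norm (X y - X s) \<le> \<bar>y\<^sup>2 - s\<^sup>2\<bar> * (norm w * (norm (X s) * (1 + norm (const_loop (1::real)) + y\<^sup>2 * norm w) * 5) * 5)" for y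
      unfolding diff norm_scaleR abs_minus_cancel
      by (intro mult_left_mono order_trans[OF norm_loop_scale_le] mult_right_mono)
         (auto intro!: order_trans[OF norm_loop_scale_le] mult_left_mono nX mult_right_mono)
    have "((\<lambda>y. X y - X s) \<longlongrightarrow> 0) (at s)"
    proof (rule Lim_null_comparison[OF always_eventually])
      show "\<forall>y. norm (X y - X s) \<le> \<bar>y\<^sup>2 - s\<^sup>2\<bar> * (norm w * (norm (X s) * (1 + norm (const_loop (1::real)) + y\<^sup>2 * norm w) * 5) * 5)"
        using bnd by blast
      have "((\<lambda>y. \<bar>y\<^sup>2 - s\<^sup>2\<bar> * (norm w * (norm (X s) * (1 + norm (const_loop (1::real)) + y\<^sup>2 * norm w) * 5) * 5)) \<longlongrightarrow>
         \<bar>s\<^sup>2 - s\<^sup>2\<bar> * (norm w * (norm (X s) * (1 + norm (const_loop (1::real)) + s\<^sup>2 * norm w) * 5) * 5)) (at s)"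
        by (intro tendsto_intros)
      then show "((\<lambda>y. \<bar>y\<^sup>2 - s\<^sup>2\<bar> * (norm w * (norm (X s) * (1 + norm (const_loop (1::real)) + y\<^sup>2 * norm w) * 5) * 5)) \<longlongrightarrow> 0) (at s)"
        by simp
    qed
    then show ?thesis by (simp add: isCont_def LIM_zero_iff)
  qed
  define X' where "X' s = - (2 * s) *\<^sub>R loop_scale w (loop_scale (X s) (X s))" for s
  have DX: "(X has_vector_derivative X' s) (at s)" for s
    unfolding has_vector_derivative_def has_derivative_at2
  proof (intro conjI bounded_linear_scaleR_left)

    \<comment> \<open>The remainder quotient is a factor \<open>sgn (y - s)\<close> of norm 1 times
      the difference between the slope of the secant and its limit.\<close>
    have eq: "(1 / norm (y - s)) *\<^sub>R (X y - (X s + (y - s) *\<^sub>R X' s))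
      = (sgn (y - s)) *\<^sub>R ((- (y + s)) *\<^sub>R loop_scale w (loop_scale (X s) (X y)) - X' s)" if "y \<noteq> s" for y
    proof -
      have "X y - (X s + (y - s) *\<^sub>R X' s) = (y - s) *\<^sub>R ((- (y + s)) *\<^sub>R loop_scale w (loop_scale (X s) (X y)) - X' s)"
        using diff[of y s] by (simp add: scaleR_diff_right power2_eq_square algebra_simps)
      then show ?thesis using that by (simp add: sgn_div_norm divide_inverse mult.commute)
    qed
    have "((\<lambda>y. (- (y + s)) *\<^sub>R loop_scale w (loop_scale (X s) (X y)) - X' s) \<longlongrightarrow>
        (- (s + s)) *\<^sub>R loop_scale w (loop_scale (X s) (X s)) - X' s) (at s)"
      using cont[of s] unfolding isCont_def
      by (intro tendsto_intros bb.tendsto)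
    then have lim0: "((\<lambda>y. (- (y + s)) *\<^sub>R loop_scale w (loop_scale (X s) (X y)) - X' s) \<longlongrightarrow> 0) (at s)"
      by (simp add: X'_def)
    have "((\<lambda>y. (sgn (y - s)) *\<^sub>R ((- (y + s)) *\<^sub>R loop_scale w (loop_scale (X s) (X y)) - X' s)) \<longlongrightarrow> 0) (at s)"
    proof (rule Lim_null_comparison[OF always_eventually])
      show "\<forall>y. norm ((sgn (y - s)) *\<^sub>R ((- (y + s)) *\<^sub>R loop_scale w (loop_scale (X s) (X y)) - X' s))
          \<le> norm ((- (y + s)) *\<^sub>R loop_scale w (loop_scale (X s) (X y)) - X' s)"
        by (auto simp: sgn_if)
      show "((\<lambda>y. norm ((- (y + s)) *\<^sub>R loop_scale w (loop_scale (X s) (X y)) - X' s)) \<longlongrightarrow> 0) (at s)"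
        using tendsto_norm_zero[OF lim0] .
    qed
    then show "((\<lambda>y. (1 / norm (y - s)) *\<^sub>R (X y - (X s + (y - s) *\<^sub>R X' s))) \<longlongrightarrow> 0) (at s)"
    proof (rule Lim_transform_eventually)
      have "\<forall>\<^sub>F y in at s. y \<noteq> s" by (simp add: eventually_at_filter)
      then show "\<forall>\<^sub>F y in at s. (sgn (y - s)) *\<^sub>R ((- (y + s)) *\<^sub>R loop_scale w (loop_scale (X s) (X y)) - X' s)
          = (1 / norm (y - s)) *\<^sub>R (X y - (X s + (y - s) *\<^sub>R X' s))"
        by eventually_elim (rule eq[symmetric])
    qed
  qed
  define X'' where "X'' s = - (2 * s) *\<^sub>R loop_scale w (loop_scale (X s) (X' s) + loop_scale (X' s) (X s))
      + (- 2) *\<^sub>R loop_scale w (loop_scale (X s) (X s))" for s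
  have X'_eq: "X' = (\<lambda>s. - (2 * s) *\<^sub>R loop_scale w (loop_scale (X s) (X s)))"
    by (simp add: fun_eq_iff X'_def)
  have "((\<lambda>s. - (2 * s) *\<^sub>R loop_scale w (loop_scale (X s) (X s))) has_vector_derivative X'' s) (at s)" for s
    unfolding X''_def
  proof (rule has_vector_derivative_scaleR)
    show "((\<lambda>s. - (2 * s)) has_real_derivative - 2) (at s)"
      by (auto intro!: derivative_eq_intros)
    show "((\<lambda>x. loop_scale w (loop_scale (X x) (X x))) has_vector_derivative
         loop_scale w (loop_scale (X s) (X' s) + loop_scale (X' s) (X s))) (at s)"
      using bb.has_vector_derivative[OF has_vector_derivative_const[of w] bb.has_vector_derivative[OF DX[of s] DX[of s]]]
      by (simp add: bb.zero_left)
  qed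
  then have DX': "(X' has_vector_derivative X'' s) (at s)" for s
    by (simp only: X'_eq)
  have cX: "continuous_on UNIV X" "continuous_on UNIV X'"
    using DX DX' by (auto intro!: continuous_at_imp_continuous_on has_vector_derivative_continuous)
  have "continuous_on UNIV X''"
    unfolding X''_def by (intro continuous_intros bb.continuous_on cX)
  with X DX DX' show thesis by (intro that[of X X' X'']) (auto simp: X'_def)
qed

section \<open>The Hessian at a closed geodesic of an ellipsoid\<close>

text \<open>Half the gradient of the quadratic form that defines the ellipsoid;
  \<open>A\<^sup>-\<^sup>2 x\<close> in the notation of the overview.\<close>

definition normal_at :: "real ^ 'n \<Rightarrow> real ^ 'n \<Rightarrow> real ^ 'n" where
  "normal_at a x = (\<chi> i. x $ i / (a $ i)\<^sup>2)"

lemma bounded_linear_normal_at: "bounded_linear (normal_at a)"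
  by (intro linear_conv_bounded_linear[THEN iffD1] linearI)
     (auto simp: normal_at_def vec_eq_iff add_divide_distrib)

lemma normal_at_inner: "x \<bullet> normal_at a y = (\<Sum>i\<in>UNIV. x $ i * y $ i / (a $ i)\<^sup>2)"
  by (simp add: normal_at_def inner_vec_def)

lemma normal_at_inner_commute: "x \<bullet> normal_at a y = y \<bullet> normal_at a x"
  by (simp add: normal_at_inner mult.commute)

lemma ellipsoid_iff: "x \<in> ellipsoid a \<longleftrightarrow> x \<bullet> normal_at a x = 1"
  by (simp add: ellipsoid_def normal_at_inner power2_eq_square)

lemma ellipsoid_tangent_iff: "v \<in> ellipsoid_tangent a x \<longleftrightarrow> v \<bullet> normal_at a x = 0"
  by (simp add: ellipsoid_tangent_def normal_at_inner mult.commute)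

lemma normal_at_inner_nonneg: "0 \<le> x \<bullet> normal_at a x"
  unfolding normal_at_inner by (intro sum_nonneg) auto

text \<open>
  The curve is \<open>c s = (1 - s\<^sup>2 w) / (1 + s\<^sup>2 w) \<gamma> + s / (1 + s\<^sup>2 w) V\<close> with \<open>4 w = \<langle>V, A\<^sup>-\<^sup>2 V\<rangle>\<close>: the
  rational parametrization of the unit circle, applied pointwise.
\<close>

lemma ex_C2_curve_in_loop_space:
  assumes \<gamma>: "\<gamma> \<in> loop_space a" and V: "V \<in> loop_space_tangent a \<gamma>"
  obtains c where "C2_curve_in (loop_space a) \<gamma> V c"
proof -
  interpret N: bounded_linear "normal_at a" by (rule bounded_linear_normal_at)
  define wf where "wf t = (loop_at V t \<bullet> normal_at a (loop_at V t)) / 4" for t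
  have "has_L2_deriv wf (\<lambda>t. (loop_deriv V t \<bullet> normal_at a (loop_at V t) + loop_at V t \<bullet> normal_at a (loop_deriv V t)) / 4)"
    unfolding wf_def
    by (intro has_L2_deriv_linear[where f = "\<lambda>x. x / 4"] bounded_linear_divide
        has_L2_deriv_bilinear[OF bounded_bilinear_inner] has_L2_deriv_loop_deriv
        has_L2_deriv_linear[OF bounded_linear_normal_at])
  moreover have "wf (t + 1) = wf t" for t by (simp add: wf_def loop_at_periodic)
  ultimately have w: "loop_at (Abs_h1_loop wf) = wf"
    by (intro Abs_h1_loop_inverse) auto
  define w where "w = Abs_h1_loop wf"
  have lw: "loop_at w t = wf t" for t by (simp add: w w_def)
  have wpos: "loop_at w t \<ge> 0" for t using normal_at_inner_nonneg[of "loop_at V t" a] by (simp add: lw wf_def)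
  obtain X X' X'' where X: "\<And>s t. loop_at (X s) t = 1 / (1 + s\<^sup>2 * loop_at w t)"
    and DX: "\<And>s. (X has_vector_derivative X' s) (at s)" and DX': "\<And>s. (X' has_vector_derivative X'' s) (at s)"
    and cX'': "continuous_on UNIV X''" and X'0: "X' 0 = 0"
    using ex_C2_reciprocal_family[OF wpos] by blast
  interpret bb: bounded_bilinear "loop_scale :: real h1_loop \<Rightarrow> (real ^ 'a) h1_loop \<Rightarrow> (real ^ 'a) h1_loop"
    by (rule bounded_bilinear_loop_scale)
  \<comment> \<open>As \<open>(1 - s^2 w) / (1 + s^2 w) = 2 / (1 + s^2 w) - 1\<close>, the curve is
    \<open>- \<gamma>\<close> plus the reciprocal family times a loop that is affine in
    \<open>s\<close>.\<close>
  define L where "L s = 2 *\<^sub>R \<gamma> + s *\<^sub>R V" for s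
  have DL: "(L has_vector_derivative V) (at s)" for s
    unfolding L_def by (auto intro!: derivative_eq_intros)
  define c where "c s = - \<gamma> + loop_scale (X s) (L s)" for s
  define c' where "c' s = loop_scale (X s) V + loop_scale (X' s) (L s)" for s
  define c'' where "c'' s = loop_scale (X' s) V + (loop_scale (X' s) V + loop_scale (X'' s) (L s))" for s
  have Dc: "(c has_vector_derivative c' s) (at s)" for s
    unfolding c_def[abs_def] c'_def
    using has_vector_derivative_add[OF has_vector_derivative_const bb.has_vector_derivative[OF DX[of s] DL[of s]], of "- \<gamma>"]
    by simp
  have Dc': "(c' has_vector_derivative c'' s) (at s)" for s
    unfolding c'_def[abs_def] c''_def
    using has_vector_derivative_add[OF bb.has_vector_derivative[OF DX[of s] has_vector_derivative_const[of V]]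
       bb.has_vector_derivative[OF DX'[of s] DL[of s]]]
    by (simp add: bb.zero_right)
  have cc'': "continuous_on UNIV c''"
  proof -
    have "continuous_on UNIV X'" "continuous_on UNIV L"
      using DX' DL by (auto intro!: continuous_at_imp_continuous_on has_vector_derivative_continuous)
    then show ?thesis unfolding c''_def by (intro continuous_intros bb.continuous_on cX'')
  qed
  have inS: "c s \<in> loop_space a" for s
    unfolding loop_space_def mem_Collect_eq ellipsoid_iff
  proof
    fix t
    define g v where "g = loop_at \<gamma> t" and "v = loop_at V t"
    define z where "z = 1 / (1 + s\<^sup>2 * wf t)"
    have gg: "g \<bullet> normal_at a g = 1" using \<gamma> by (auto simp: loop_space_def ellipsoid_iff g_def)
    have vg: "v \<bullet> normal_at a g = 0" using V by (auto simp: loop_space_tangent_def ellipsoid_tangent_iff g_def v_def)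
    have gv: "g \<bullet> normal_at a v = 0" using vg normal_at_inner_commute by metis
    have vv: "v \<bullet> normal_at a v = 4 * wf t" by (simp add: wf_def v_def)
    have ct: "loop_at (c s) t = (2 * z - 1) *\<^sub>R g + (z * s) *\<^sub>R v"
      by (simp add: c_def L_def X lw z_def g_def v_def algebra_simps)
    have p: "1 + s\<^sup>2 * wf t > 0" using wpos[of t] by (simp add: lw add_pos_nonneg)
    have "loop_at (c s) t \<bullet> normal_at a (loop_at (c s) t) = (2 * z - 1)\<^sup>2 + (z * s)\<^sup>2 * (4 * wf t)"
      unfolding ct by (simp add: N.add N.scaleR inner_add_left inner_add_right gg vg gv vv power2_eq_square)
    also have "\<dots> = 4 * z * (z * (1 + s\<^sup>2 * wf t)) - 4 * z + 1"
      by (simp add: power2_eq_square algebra_simps)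
    also have "z * (1 + s\<^sup>2 * wf t) = 1" using p by (simp add: z_def)
    finally show "loop_at (c s) t \<bullet> normal_at a (loop_at (c s) t) = 1" by simp
  qed
  have X0: "X 0 = const_loop 1" by (rule h1_loop_eqI) (simp add: X)
  have "c 0 = \<gamma>" by (rule h1_loop_eqI) (simp add: c_def X0 L_def scaleR_2)
  moreover have "c' 0 = V" by (rule h1_loop_eqI) (simp add: c'_def X0 X'0 L_def)
  ultimately have "C2_curve_in (loop_space a) \<gamma> V c"
    unfolding C2_curve_in_def using Dc Dc' inS continuous_on_subset[OF cc'' subset_UNIV]
    by (intro conjI exI[of _ 1] exI[of _ c'] exI[of _ c'']) auto
  then show thesis by (rule that)
qed

text \<open>Derivatives are parameters rather than values of \<open>loop_deriv\<close>, so that they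
  are given at every point; \<open>lam\<close> is the Lagrange multiplier of the constraint.\<close>

locale ellipsoid_geodesic =
  fixes a :: "real ^ 'n" and \<Gamma> :: "(real ^ 'n) h1_loop" and \<Gamma>' :: "real \<Rightarrow> real ^ 'n" and lam :: "real \<Rightarrow> real"
  assumes a_pos: "\<And>i. 0 < a $ i"
    and in_space: "\<Gamma> \<in> loop_space a"
    and deriv: "\<And>t. (loop_at \<Gamma> has_vector_derivative \<Gamma>' t) (at t)"
    and deriv': "\<And>t. (\<Gamma>' has_vector_derivative (- lam t) *\<^sub>R normal_at a (loop_at \<Gamma> t)) (at t)"
    and nonconst: "\<exists>t. loop_at \<Gamma> t \<noteq> loop_at \<Gamma> 0"
begin

abbreviation "N \<equiv> normal_at a"
abbreviation "G \<equiv> loop_at \<Gamma>"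

sublocale N: bounded_linear N by (rule bounded_linear_normal_at)

lemma GG: "G t \<bullet> N (G t) = 1"
  using in_space by (auto simp: loop_space_def ellipsoid_iff)

lemma NG_nz: "N (G t) \<noteq> 0"
  using GG[of t] by auto

lemma N_deriv: "((\<lambda>t. N (G t)) has_vector_derivative N (\<Gamma>' t)) (at t)"
  by (rule N.has_vector_derivative[OF deriv])

lemma G'_NG: "\<Gamma>' t \<bullet> N (G t) = 0"
proof -
  have "((\<lambda>t. G t \<bullet> N (G t)) has_vector_derivative (G t \<bullet> N (\<Gamma>' t) + \<Gamma>' t \<bullet> N (G t))) (at t)"
    by (rule bounded_bilinear.has_vector_derivative[OF bounded_bilinear_inner deriv N_deriv])
  moreover have "((\<lambda>t. G t \<bullet> N (G t)) has_vector_derivative 0) (at t)"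
    unfolding GG by simp
  ultimately have "G t \<bullet> N (\<Gamma>' t) + \<Gamma>' t \<bullet> N (G t) = 0"
    by (rule vector_derivative_unique_at)
  then show ?thesis using normal_at_inner_commute[of "G t" a "\<Gamma>' t"] by simp
qed

text \<open>Differentiate the tangency relation \<open>G'_NG\<close> once more. Continuity,
  periodicity and positivity of \<open>lam\<close> are read off from this.\<close>

lemma lam_eq: "lam t * (N (G t) \<bullet> N (G t)) = \<Gamma>' t \<bullet> N (\<Gamma>' t)"
proof -
  have "((\<lambda>t. \<Gamma>' t \<bullet> N (G t)) has_vector_derivative (\<Gamma>' t \<bullet> N (\<Gamma>' t) + ((- lam t) *\<^sub>R N (G t)) \<bullet> N (G t))) (at t)"
    by (rule bounded_bilinear.has_vector_derivative[OF bounded_bilinear_inner deriv' N_deriv])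
  moreover have "((\<lambda>t. \<Gamma>' t \<bullet> N (G t)) has_vector_derivative 0) (at t)"
    unfolding G'_NG by simp
  ultimately have "\<Gamma>' t \<bullet> N (\<Gamma>' t) + ((- lam t) *\<^sub>R N (G t)) \<bullet> N (G t) = 0"
    by (rule vector_derivative_unique_at)
  then show ?thesis by simp
qed

lemma lam_formula: "lam t = (\<Gamma>' t \<bullet> N (\<Gamma>' t)) / (N (G t) \<bullet> N (G t))"
  using lam_eq[of t] NG_nz[of t] by (simp add: field_simps)

lemma cont_G: "continuous_on S G" by (rule loop_at_continuous_on)

lemma cont_G': "continuous_on S \<Gamma>'"
  using deriv' by (auto intro!: continuous_at_imp_continuous_on has_vector_derivative_continuous)

lemma cont_lam: "continuous_on S lam"
  unfolding lam_formula[abs_def] using NG_nz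
  by (intro continuous_intros N.continuous_on cont_G cont_G') auto

lemma G_periodic: "G (t + 1) = G t" by (rule loop_at_periodic)

lemma G'_periodic: "\<Gamma>' (t + 1) = \<Gamma>' t"
proof -
  have "((\<lambda>t. G (t + 1)) has_vector_derivative \<Gamma>' (t + 1)) (at t)"
  proof -
    have "((\<lambda>t. t + 1) has_vector_derivative (1::real)) (at t)"
      unfolding has_real_derivative_iff_has_vector_derivative[symmetric] by (auto intro!: derivative_eq_intros)
    from vector_diff_chain_at[OF this deriv[of "t + 1"]] show ?thesis by (simp add: o_def)
  qed
  then show ?thesis using deriv[of t] unfolding G_periodic by (rule vector_derivative_unique_at)
qed

lemma lam_periodic: "lam (t + 1) = lam t"
  by (simp add: lam_formula G_periodic G'_periodic)

lemma speed_const: "\<Gamma>' t \<bullet> \<Gamma>' t = \<Gamma>' 0 \<bullet> \<Gamma>' 0"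
proof -
  have "((\<lambda>t. \<Gamma>' t \<bullet> \<Gamma>' t) has_real_derivative 0) (at t)" for t
    using bounded_bilinear.has_vector_derivative[OF bounded_bilinear_inner deriv'[of t] deriv'[of t]] G'_NG[of t]
    by (simp add: has_real_derivative_iff_has_vector_derivative inner_commute)
  then show ?thesis using DERIV_isconst_all by blast
qed

definition "speed = norm (\<Gamma>' 0)"

lemma norm_G': "norm (\<Gamma>' t) = speed"
  using speed_const[of t] by (simp add: speed_def norm_eq_sqrt_inner)

lemma speed_pos: "speed > 0"
proof (rule ccontr)
  assume "\<not> speed > 0"
  then have z: "\<Gamma>' t = 0" for t using norm_G'[of t] norm_ge_zero[of "\<Gamma>' t"] by (simp add: not_less)
  have "G t = G 0" for t
    by (rule has_derivative_zero_unique[of UNIV G t 0]) (use deriv z in \<open>auto simp: has_vector_derivative_def\<close>)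
  then show False using nonconst by blast
qed

lemma G'G': "\<Gamma>' t \<bullet> \<Gamma>' t = speed\<^sup>2"
  using norm_G'[of t] by (simp add: power2_norm_eq_inner[symmetric])

lemma lam_pos: "lam t > 0"
proof -
  have "\<Gamma>' t \<noteq> 0" using norm_G'[of t] speed_pos by auto
  then obtain i where i: "\<Gamma>' t $ i \<noteq> 0" by (auto simp: vec_eq_iff)
  have "0 < \<Gamma>' t $ i * \<Gamma>' t $ i / (a $ i)\<^sup>2" using i a_pos[of i] by (intro divide_pos_pos) (auto simp: power2_eq_square[symmetric])
  also have "\<dots> \<le> \<Gamma>' t \<bullet> N (\<Gamma>' t)" unfolding normal_at_inner
    by (rule member_le_sum) auto
  finally show ?thesis using NG_nz[of t] by (simp add: lam_formula)
qed

lemma G_L2: "has_L2_deriv G \<Gamma>'"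
  by (rule has_L2_deriv_C1[OF deriv cont_G'])

lemma G'_L2: "has_L2_deriv \<Gamma>' (\<lambda>t. (- lam t) *\<^sub>R N (G t))"
  by (rule has_L2_deriv_C1[OF deriv']) (intro continuous_intros cont_lam N.continuous_on cont_G)

lemma loop_length_eq: "loop_length \<Gamma> = speed"
proof -
  obtain M where M: "negligible M" "\<And>t. t \<notin> M \<Longrightarrow> loop_deriv \<Gamma> t = \<Gamma>' t"
    by (rule loop_deriv_AE[OF G_L2]) blast
  have "loop_length \<Gamma> = integral {0..1} (\<lambda>t. norm (\<Gamma>' t))"
    unfolding loop_length_def by (rule integral_spike[OF M(1)]) (simp add: M(2))
  then show ?thesis by (simp add: norm_G')
qed

lemma energy_G: "energy_form \<Gamma> \<Gamma> = speed\<^sup>2"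
  unfolding energy_form_eq[OF G_L2 G_L2] by (simp add: G'G')

section \<open>Second variation along a closed geodesic\<close>

definition curv :: "(real ^ 'n) h1_loop \<Rightarrow> (real ^ 'n) h1_loop \<Rightarrow> real" where
  "curv V W = integral {0..1} (\<lambda>t. lam t * (loop_at V t \<bullet> N (loop_at W t)))"

definition jacobi_form :: "(real ^ 'n) h1_loop \<Rightarrow> (real ^ 'n) h1_loop \<Rightarrow> real" where
  "jacobi_form V W = energy_form V W - curv V W"

lemma curv_integrable: "(\<lambda>t. lam t * (loop_at V t \<bullet> N (loop_at W t))) integrable_on {b..c}"
  by (intro integrable_continuous_interval continuous_intros cont_lam N.continuous_on)

lemma bilinear_curv:
  "curv (x + y) z = curv x z + curv y z" "curv z (x + y) = curv z x + curv z y"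
  "curv (r *\<^sub>R x) z = r * curv x z" "curv z (r *\<^sub>R x) = r * curv z x"
  using curv_integrable[of _ _ 0 1]
  by (simp_all add: curv_def N.add N.scaleR inner_add_left inner_add_right distrib_left integral_add
      mult.left_commute[of _ r] )

lemma bilinear_jacobi_form:
  "jacobi_form (x + y) z = jacobi_form x z + jacobi_form y z" "jacobi_form z (x + y) = jacobi_form z x + jacobi_form z y"
  "jacobi_form (r *\<^sub>R x) z = r * jacobi_form x z" "jacobi_form z (r *\<^sub>R x) = r * jacobi_form z x"
  by (simp_all add: jacobi_form_def bilinear_curv bilinear_energy_form algebra_simps)

text \<open>Integration by parts against the geodesic equation. It serves twice: for tangent
  \<open>W\<close> the right side is zero, which is criticality, and for the acceleration of a curve
  of loops it yields the curvature term of the Hessian.\<close>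

lemma energy_G_left: "energy_form \<Gamma> W = curv W \<Gamma>"
proof -
  let ?h = "loop_deriv W"
  have W: "has_L2_deriv (loop_at W) ?h" by (rule has_L2_deriv_loop_deriv)
  have E: "energy_form \<Gamma> W = integral {0..1} (\<lambda>t. \<Gamma>' t \<bullet> ?h t)"
    by (rule energy_form_eq[OF G_L2 W])
  have "((\<lambda>t. ((- lam t) *\<^sub>R N (G t)) \<bullet> loop_at W t + \<Gamma>' t \<bullet> ?h t) has_integral
          (\<Gamma>' 1 \<bullet> loop_at W 1 - \<Gamma>' 0 \<bullet> loop_at W 0)) {0..1}"
    using has_L2_derivD(1)[OF has_L2_deriv_bilinear[OF bounded_bilinear_inner G'_L2 W], of 0 1] by simp
  moreover have "\<Gamma>' 1 \<bullet> loop_at W 1 - \<Gamma>' 0 \<bullet> loop_at W 0 = 0"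
    using G'_periodic[of 0] loop_at_periodic[of W 0] by simp
  ultimately have "((\<lambda>t. ((- lam t) *\<^sub>R N (G t)) \<bullet> loop_at W t + \<Gamma>' t \<bullet> ?h t) has_integral 0) {0..1}"
    by simp
  moreover have "((\<lambda>t. lam t * (loop_at W t \<bullet> N (G t))) has_integral curv W \<Gamma>) {0..1}"
    unfolding curv_def using curv_integrable by (rule integrable_integral)
  ultimately have "((\<lambda>t. (((- lam t) *\<^sub>R N (G t)) \<bullet> loop_at W t + \<Gamma>' t \<bullet> ?h t) + lam t * (loop_at W t \<bullet> N (G t)))
      has_integral (0 + curv W \<Gamma>)) {0..1}"
    by (rule has_integral_add)
  then have "((\<lambda>t. \<Gamma>' t \<bullet> ?h t) has_integral curv W \<Gamma>) {0..1}"
    by (simp add: inner_commute)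
  then show ?thesis unfolding E by (rule integral_unique)
qed

text \<open>Along a C^2 curve with velocity \<open>V\<close> and acceleration \<open>W\<close>, the
  second derivative of half the energy is \<open>energy_form V V + energy_form \<Gamma> W\<close>.
  Differentiating the constraint twice at each \<open>t\<close> fixes the normal component of
  \<open>W\<close> in terms of \<open>V\<close>, so the value does not depend on the curve.\<close>

lemma hessian_form_eq:
  assumes V: "V \<in> loop_space_tangent a \<Gamma>"
  shows "hessian_form sqrt_energy (loop_space a) \<Gamma> V = jacobi_form V V / speed"
proof -
  interpret B: bounded_bilinear "energy_form :: (real^'n) h1_loop \<Rightarrow> _" by (rule bounded_bilinear_energy_form)
  have VG: "energy_form \<Gamma> V = 0"
    using V by (simp add: energy_G_left curv_def loop_space_tangent_def ellipsoid_tangent_iff)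
  have main: "deriv (deriv (\<lambda>s. sqrt_energy (c s))) 0 = jacobi_form V V / speed"
    if C: "C2_curve_in (loop_space a) \<Gamma> V c" for c
  proof -
    obtain e c' c'' where e: "e > 0" and c0: "c 0 = \<Gamma>" "c' 0 = V" and cc: "continuous_on {-e<..<e} c''"
      and cs: "\<And>s. s \<in> {-e<..<e} \<Longrightarrow> c s \<in> loop_space a"
      and Dc: "\<And>s. s \<in> {-e<..<e} \<Longrightarrow> (c has_vector_derivative c' s) (at s)"
      and Dc': "\<And>s. s \<in> {-e<..<e} \<Longrightarrow> (c' has_vector_derivative c'' s) (at s)"
      using C unfolding C2_curve_in_def by blast
    have e0: "0 \<in> {-e<..<e}" using e by simp
    define W where "W = c'' 0"
    have pw: "W_t \<bullet> N (G t) = - (V_t \<bullet> N V_t)" if "W_t = loop_at W t" "V_t = loop_at V t" for t W_t V_t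
    proof -
      define x x' where "x s = loop_at (c s) t" and "x' s = loop_at (c' s) t" for s
      have Dx: "(x has_vector_derivative x' s) (at s)" if "s \<in> {-e<..<e}" for s
        unfolding x_def[abs_def] x'_def using bounded_linear.has_vector_derivative[OF bounded_linear_loop_at Dc[OF that]] .
      have Dx': "(x' has_vector_derivative loop_at (c'' s) t) (at s)" if "s \<in> {-e<..<e}" for s
        unfolding x'_def[abs_def] using bounded_linear.has_vector_derivative[OF bounded_linear_loop_at Dc'[OF that]] .
      have one: "x s \<bullet> N (x s) = 1" if "s \<in> {-e<..<e}" for s
        using cs[OF that] by (auto simp: x_def loop_space_def ellipsoid_iff)
      have zero: "x' s \<bullet> N (x s) = 0" if s: "s \<in> {-e<..<e}" for s
      proof -
        have "((\<lambda>s. x s \<bullet> N (x s)) has_vector_derivative (x s \<bullet> N (x' s) + x' s \<bullet> N (x s))) (at s)"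
          by (intro bounded_bilinear.has_vector_derivative[OF bounded_bilinear_inner] N.has_vector_derivative Dx s)
        moreover have "((\<lambda>s. x s \<bullet> N (x s)) has_vector_derivative 0) (at s)"
        proof (rule has_vector_derivative_transform_within_open[of "\<lambda>_. 1" _ _ "{-e<..<e}"])
          show "((\<lambda>_. 1) has_vector_derivative 0) (at s)" by simp
        qed (use s one in auto)
        ultimately have "x s \<bullet> N (x' s) + x' s \<bullet> N (x s) = 0" by (rule vector_derivative_unique_at)
        then show ?thesis using normal_at_inner_commute[of "x s" a "x' s"] by simp
      qed
      have "((\<lambda>s. x' s \<bullet> N (x s)) has_vector_derivative (x' 0 \<bullet> N (x' 0) + loop_at (c'' 0) t \<bullet> N (x 0))) (at 0)"
        by (intro bounded_bilinear.has_vector_derivative[OF bounded_bilinear_inner] N.has_vector_derivative Dx Dx' e0)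
      moreover have "((\<lambda>s. x' s \<bullet> N (x s)) has_vector_derivative 0) (at 0)"
      proof (rule has_vector_derivative_transform_within_open[of "\<lambda>_. 0" _ _ "{-e<..<e}"])
        show "((\<lambda>_. 0) has_vector_derivative 0) (at 0)" by simp
      qed (use e0 zero in auto)
      ultimately have "x' 0 \<bullet> N (x' 0) + loop_at (c'' 0) t \<bullet> N (x 0) = 0" by (rule vector_derivative_unique_at)
      then show ?thesis using that by (simp add: x_def x'_def c0 W_def)
    qed
    have GW: "energy_form \<Gamma> W = - curv V V"
      unfolding energy_G_left curv_def by (simp add: pw)
    define E where "E s = energy_form (c s) (c s)" for s
    define F where "F s = energy_form (c s) (c' s)" for s
    have DE: "(E has_real_derivative (2 * F s)) (at s)" if "s \<in> {-e<..<e}" for s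
      unfolding E_def[abs_def] F_def has_real_derivative_iff_has_vector_derivative
      using B.has_vector_derivative[OF Dc[OF that] Dc[OF that]] by (simp add: energy_form_commute[of "c' s"])
    have DF: "(F has_real_derivative (energy_form V V - curv V V)) (at 0)"
      unfolding F_def[abs_def] has_real_derivative_iff_has_vector_derivative
      using B.has_vector_derivative[OF Dc[OF e0] Dc'[OF e0]] GW by (simp add: c0 W_def)
    have E0: "E 0 = speed\<^sup>2" by (simp add: E_def c0 energy_G)
    have F0: "F 0 = 0" by (simp add: F_def c0 VG)
    have "isCont E 0" using DE[OF e0] DERIV_isCont by blast
    then have "\<forall>\<^sub>F s in at 0. E s > 0"
      using speed_pos order_tendstoD(1)[of E "speed\<^sup>2" "at 0" 0] by (simp add: E0 isCont_def)
    then have evE: "\<forall>\<^sub>F s in nhds 0. E s > 0" using E0 speed_pos by (simp add: eventually_nhds_conv_at)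
    have ev: "\<forall>\<^sub>F s in nhds 0. s \<in> {-e<..<e}" using e0 by (intro eventually_nhds_in_open) auto
    have d1: "\<forall>\<^sub>F s in nhds 0. deriv (\<lambda>s. sqrt_energy (c s)) s = F s / sqrt (E s)"
      using evE ev
    proof eventually_elim
      case (elim s)
      have "((\<lambda>s. sqrt (E s)) has_real_derivative F s / sqrt (E s)) (at s)"
        using elim by (auto intro!: derivative_eq_intros DE simp: field_simps)
      then show ?case by (simp add: sqrt_energy_eq E_def[symmetric] DERIV_imp_deriv)
    qed
    \<comment> \<open>Since \<open>F 0 = 0\<close>, the variation of the denominator does not
      contribute; only the factor \<open>1 / speed\<close> survives.\<close>
    have "((\<lambda>s. F s / sqrt (E s)) has_real_derivative (energy_form V V - curv V V) / speed) (at 0)"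
    proof -
      have "((\<lambda>s. sqrt (E s)) has_real_derivative (inverse (sqrt (E 0)) / 2 * (2 * F 0))) (at 0)"
        using DERIV_chain2[OF DERIV_real_sqrt DE[OF e0]] speed_pos E0 by simp
      then have "((\<lambda>s. sqrt (E s)) has_real_derivative 0) (at 0)" by (simp add: F0)
      from DERIV_divide[OF DF this] show ?thesis
        using speed_pos by (simp add: E0 F0)
    qed
    then have "deriv (\<lambda>s. F s / sqrt (E s)) 0 = jacobi_form V V / speed"
      by (simp add: DERIV_imp_deriv jacobi_form_def)
    then show ?thesis using deriv_cong_ev[OF d1 refl] by simp
  qed
  \<comment> \<open>Without at least one such curve every number would satisfy the
    description.\<close>
  obtain c where "C2_curve_in (loop_space a) \<Gamma> V c"
    using ex_C2_curve_in_loop_space[OF in_space V] .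
  then show ?thesis unfolding hessian_form_def using main by (intro the_equality) auto
qed

lemma geodesic_index_eq:
  "geodesic_index a \<Gamma> = form_index (loop_space_tangent a \<Gamma>) (\<lambda>V. jacobi_form V V)"
proof -
  have "(\<forall>v\<in>span B. v \<noteq> 0 \<longrightarrow> hessian_form sqrt_energy (loop_space a) \<Gamma> v < 0) \<longleftrightarrow>
        (\<forall>v\<in>span B. v \<noteq> 0 \<longrightarrow> jacobi_form v v < 0)" if "span B \<subseteq> loop_space_tangent a \<Gamma>" for B
  proof -
    have "hessian_form sqrt_energy (loop_space a) \<Gamma> v < 0 \<longleftrightarrow> jacobi_form v v < 0" if "v \<in> loop_space_tangent a \<Gamma>" for v
      using hessian_form_eq[OF that] speed_pos by (simp add: divide_less_0_iff)
    then show ?thesis using that by blast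
  qed
  then show ?thesis unfolding geodesic_index_def form_index_def
    by (intro arg_cong[of _ _ Sup] Collect_cong ex_cong1 conj_cong refl) blast
qed

end

text \<open>The part \<open>v\<close> of the acceleration orthogonal to the normal is itself
  tangent, hence orthogonal to the acceleration, hence zero.\<close>

lemma closed_geodesic_imp_ellipsoid_geodesic:
  assumes "\<And>i. 0 < a $ i" and "closed_geodesic a \<gamma>"
  obtains \<gamma>' lam where "ellipsoid_geodesic a \<gamma> \<gamma>' lam"
proof -
  obtain \<gamma>' \<gamma>'' where D: "\<And>t. (loop_at \<gamma> has_vector_derivative \<gamma>' t) (at t)"
    "\<And>t. (\<gamma>' has_vector_derivative \<gamma>'' t) (at t)"
    and orth: "\<And>t v. v \<in> ellipsoid_tangent a (loop_at \<gamma> t) \<Longrightarrow> \<gamma>'' t \<bullet> v = 0"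
    using assms(2) unfolding closed_geodesic_def by metis
  define n where "n t = normal_at a (loop_at \<gamma> t)" for t
  define lam where "lam t = - (\<gamma>'' t \<bullet> n t) / (n t \<bullet> n t)" for t
  have "\<gamma>'' t = (- lam t) *\<^sub>R n t" for t
  proof -
    define v where "v = \<gamma>'' t - (- lam t) *\<^sub>R n t"
    have "loop_at \<gamma> t \<bullet> n t = 1"
      using assms(2) by (auto simp: closed_geodesic_def loop_space_def ellipsoid_iff n_def)
    then have "n t \<noteq> 0" by auto
    then have vn: "v \<bullet> n t = 0" by (simp add: v_def inner_diff_left lam_def)
    then have "v \<in> ellipsoid_tangent a (loop_at \<gamma> t)" by (simp add: ellipsoid_tangent_iff n_def)
    then have "\<gamma>'' t \<bullet> v = 0" by (rule orth)
    moreover have "v \<bullet> v = \<gamma>'' t \<bullet> v + lam t * (v \<bullet> n t)"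
      by (subst (1) v_def) (simp add: inner_add_left inner_add_right inner_commute)
    ultimately have "v \<bullet> v = 0" using vn by simp
    then show ?thesis by (simp add: v_def eq_neg_iff_add_eq_0)
  qed
  then have "ellipsoid_geodesic a \<gamma> \<gamma>' lam"
    using assms D by unfold_locales (auto simp: n_def closed_geodesic_def)
  then show thesis by (rule that)
qed

section \<open>The index of a quadratic form\<close>

text \<open>One functional lowers the dimension by at most one: \<open>b0\<close> with
  \<open>\<phi> b0 \<noteq> 0\<close> and a basis of the kernel in \<open>span B\<close> together
  span \<open>B\<close>. The count runs over finite bases because the spaces of loops are
  infinite-dimensional.\<close>

lemma ex_common_zero_in_span:
  fixes B :: "'a::real_vector set" and \<Phi> :: "('a \<Rightarrow> real) set"
  assumes "finite \<Phi>" "\<And>\<phi>. \<phi> \<in> \<Phi> \<Longrightarrow> linear \<phi>" "finite B" "independent B" "card \<Phi> < card B"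
  shows "\<exists>v\<in>span B. v \<noteq> 0 \<and> (\<forall>\<phi>\<in>\<Phi>. \<phi> v = 0)"
  using assms
proof (induction \<Phi> arbitrary: B rule: finite_induct)
  case empty
  then have "B \<noteq> {}" by auto
  then obtain b where "b \<in> B" by blast
  then have "b \<noteq> 0" using empty.prems(3) dependent_zero[of B] by metis
  then show ?case using span_base[OF \<open>b \<in> B\<close>] by blast
next
  case (insert \<phi> \<Phi>)
  have lin: "linear \<phi>" using insert.prems by simp
  interpret \<phi>: linear \<phi> by (rule lin)
  show ?case
  proof (cases "\<forall>b\<in>B. \<phi> b = 0")
    case True
    have z: "\<phi> v = 0" if "v \<in> span B" for v by (rule linear_eq_0_on_span[OF lin _ that]) (use True in simp)
    have "card \<Phi> < card B" using insert.prems(4) insert.hyps by simp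
    then obtain v where "v \<in> span B" "v \<noteq> 0" "\<forall>\<phi>\<in>\<Phi>. \<phi> v = 0"
      using insert.IH[OF insert.prems(1)[OF insertI2] insert.prems(2,3)] by blast
    then show ?thesis using z[of v] by (intro bexI[of _ v]) auto
  next
    case False
    then obtain b0 where b0: "b0 \<in> B" "\<phi> b0 \<noteq> 0" by blast
    define W where "W = span B \<inter> {v. \<phi> v = 0}"
    have subW: "subspace W" unfolding W_def
      unfolding subspace_def
      by (simp add: \<phi>.zero \<phi>.add \<phi>.scaleR span_zero span_add span_scale)
    obtain B' where B': "B' \<subseteq> W" "independent B'" "W \<subseteq> span B'"
      using maximal_independent_subset[of W] by blast
    have fin: "finite B'"
      using independent_span_bound[OF insert.prems(2) B'(2)] B'(1) unfolding W_def by blast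
    have "B \<subseteq> span (insert b0 B')"
    proof
      fix b assume b: "b \<in> B"
      define c where "c = \<phi> b / \<phi> b0"
      have "b - c *\<^sub>R b0 \<in> W" unfolding W_def
        using b0(2) span_diff[OF span_base[OF b] span_scale[OF span_base[OF b0(1)], of c]]
        by (simp add: c_def \<phi>.diff \<phi>.scaleR)
      then have "b - c *\<^sub>R b0 \<in> span (insert b0 B')"
        using B'(3) span_mono[of B' "insert b0 B'"] by blast
      from span_add[OF this span_scale[OF span_base[OF insertI1], of c]]
      show "b \<in> span (insert b0 B')" by simp
    qed
    then have "card B \<le> card (insert b0 B')"
      using independent_span_bound[of "insert b0 B'" B] fin insert.prems(3) by simp
    also have "\<dots> \<le> card B' + 1" by (simp add: card_insert_if fin)
    finally have "card \<Phi> < card B'" using insert.prems(4) insert.hyps by simp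
    then obtain v where v: "v \<in> span B'" "v \<noteq> 0" "\<forall>\<phi>\<in>\<Phi>. \<phi> v = 0"
      using insert.IH[OF insert.prems(1)[OF insertI2] fin B'(2)] by blast
    have "v \<in> W" using v(1) span_minimal[OF B'(1) subW] by blast
    then have "\<phi> v = 0" "v \<in> span B" by (auto simp: W_def)
    then show ?thesis using v(2,3) by (intro bexI[of _ v]) auto
  qed
qed

text \<open>A negative definite subspace of larger dimension would contain a nonzero common zero of
  \<open>\<Phi>\<close>.\<close>

lemma form_index_le:
  fixes T :: "'a::real_vector set" and \<Phi> :: "('a \<Rightarrow> real) set"
  assumes "finite \<Phi>" "\<And>\<phi>. \<phi> \<in> \<Phi> \<Longrightarrow> linear \<phi>"
    and nonneg: "\<And>v. v \<in> T \<Longrightarrow> (\<And>\<phi>. \<phi> \<in> \<Phi> \<Longrightarrow> \<phi> v = 0) \<Longrightarrow> 0 \<le> Q v"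
  shows "form_index T Q \<le> enat (card \<Phi>)"
  unfolding form_index_def
proof (rule Sup_least)
  fix x assume "x \<in> {enat (card B) |B. finite B \<and> independent B \<and> span B \<subseteq> T \<and> (\<forall>v\<in>span B. v \<noteq> 0 \<longrightarrow> Q v < 0)}"
  then obtain B where B: "x = enat (card B)" "finite B" "independent B" "span B \<subseteq> T" "\<forall>v\<in>span B. v \<noteq> 0 \<longrightarrow> Q v < 0"
    by (elim CollectE exE conjE) (rule that)
  have "card B \<le> card \<Phi>"
  proof (rule ccontr)
    assume "\<not> card B \<le> card \<Phi>"
    then have less: "card \<Phi> < card B" by simp
    obtain v where v: "v \<in> span B" "v \<noteq> 0" "\<forall>\<phi>\<in>\<Phi>. \<phi> v = 0"
      using ex_common_zero_in_span[OF assms(1) _ B(2,3) less] assms(2) by blast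
    have "0 \<le> Q v" using nonneg[OF subsetD[OF B(4) v(1)]] v(3) by simp
    moreover have "Q v < 0" using B(5)[rule_format, OF v(1,2)] .
    ultimately show False by simp
  qed
  then show "x \<le> enat (card \<Phi>)" using B(1) by simp
qed

text \<open>Orthogonality makes the form diagonal on combinations of the \<open>V x\<close>, so it
  is negative unless all coefficients vanish; negativity and independence follow at once.\<close>

lemma form_index_ge:
  fixes T :: "'a::real_vector set" and V :: "'x \<Rightarrow> 'a"
  assumes fin: "finite X" and bil: "bilinear B" and T: "subspace T" "\<And>x. x \<in> X \<Longrightarrow> V x \<in> T"
    and orth: "\<And>x y. x \<in> X \<Longrightarrow> y \<in> X \<Longrightarrow> x \<noteq> y \<Longrightarrow> B (V x) (V y) = 0"
    and neg: "\<And>x. x \<in> X \<Longrightarrow> B (V x) (V x) < (0::real)"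
  shows "enat (card X) \<le> form_index T (\<lambda>v. B v v)"
proof -
  have inj: "inj_on V X"
  proof (rule inj_onI, rule ccontr)
    fix x y assume "x \<in> X" "y \<in> X" "V x = V y" "x \<noteq> y"
    then show False using orth[of x y] neg[of x] by simp
  qed
  have Q: "B (\<Sum>x\<in>X. c x *\<^sub>R V x) (\<Sum>x\<in>X. c x *\<^sub>R V x) = (\<Sum>x\<in>X. (c x)\<^sup>2 * B (V x) (V x))" for c
  proof -
    have "B (\<Sum>x\<in>X. c x *\<^sub>R V x) (\<Sum>x\<in>X. c x *\<^sub>R V x) = (\<Sum>x\<in>X. \<Sum>y\<in>X. B (c x *\<^sub>R V x) (c y *\<^sub>R V y))"
      by (simp only: bilinear_sum[OF bil] sum.cartesian_product)
    also have "\<dots> = (\<Sum>x\<in>X. \<Sum>y\<in>X. if y = x then (c x)\<^sup>2 * B (V x) (V x) else 0)"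
    proof (intro sum.cong refl)
      fix x y assume "x \<in> X" "y \<in> X"
      then show "B (c x *\<^sub>R V x) (c y *\<^sub>R V y) = (if y = x then (c x)\<^sup>2 * B (V x) (V x) else 0)"
        using orth[of x y] by (simp add: bilinear_lmul[OF bil] bilinear_rmul[OF bil] power2_eq_square)
    qed
    also have "\<dots> = (\<Sum>x\<in>X. (c x)\<^sup>2 * B (V x) (V x))" using fin by simp
    finally show ?thesis .
  qed
  have neg': "B (\<Sum>x\<in>X. c x *\<^sub>R V x) (\<Sum>x\<in>X. c x *\<^sub>R V x) < 0" if "x0 \<in> X" "c x0 \<noteq> 0" for c x0
  proof -
    have nn: "0 \<le> (c x)\<^sup>2 * - B (V x) (V x)" if "x \<in> X" for x
      by (rule mult_nonneg_nonneg) (use neg[OF that] in auto)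
    have "0 < (c x0)\<^sup>2 * - B (V x0) (V x0)"
      by (rule mult_pos_pos) (use that neg[OF that(1)] in auto)
    then have "0 < (\<Sum>x\<in>X. (c x)\<^sup>2 * - B (V x) (V x))"
      by (intro sum_pos2[OF fin that(1)] nn)
    then show ?thesis by (simp add: Q sum_negf)
  qed
  have comb: "\<exists>c. v = (\<Sum>x\<in>X. c x *\<^sub>R V x)" if v: "v \<in> span (V ` X)" for v
  proof -
    have "v \<in> range (\<lambda>u. \<Sum>v\<in>V ` X. u v *\<^sub>R v)" using v span_finite[of "V ` X"] fin by simp
    then obtain u where "v = (\<Sum>w\<in>V ` X. u w *\<^sub>R w)" by blast
    then have "v = (\<Sum>x\<in>X. u (V x) *\<^sub>R V x)" by (simp only: sum.reindex[OF inj] o_def)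
    then show ?thesis by (rule exI[of _ "\<lambda>x. u (V x)"])
  qed
  have "independent (V ` X)"
  proof
    assume "dependent (V ` X)"
    then obtain u where u: "\<exists>w\<in>V ` X. u w \<noteq> 0" "(\<Sum>w\<in>V ` X. u w *\<^sub>R w) = 0"
      using dependent_finite[of "V ` X"] fin by auto
    then obtain x0 where "x0 \<in> X" "u (V x0) \<noteq> 0" by blast
    from neg'[OF this(1), of "\<lambda>x. u (V x)", OF this(2)]
    moreover have "(\<Sum>x\<in>X. u (V x) *\<^sub>R V x) = 0" using u(2) by (simp only: sum.reindex[OF inj] o_def)
    ultimately show False using bilinear_lzero[OF bil, of 0] by simp
  qed
  moreover have "\<forall>v\<in>span (V ` X). v \<noteq> 0 \<longrightarrow> B v v < 0"
  proof (intro ballI impI)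
    fix v assume v: "v \<in> span (V ` X)" "v \<noteq> 0"
    obtain c where c: "v = (\<Sum>x\<in>X. c x *\<^sub>R V x)" using comb[OF v(1)] by blast
    have "\<exists>x0\<in>X. c x0 \<noteq> 0"
    proof (rule ccontr)
      assume "\<not> (\<exists>x0\<in>X. c x0 \<noteq> 0)"
      then have "v = 0" unfolding c by (intro sum.neutral) simp
      then show False using v(2) by simp
    qed
    then obtain x0 where "x0 \<in> X" "c x0 \<noteq> 0" by blast
    then show "B v v < 0" unfolding c by (rule neg')
  qed
  moreover have "span (V ` X) \<subseteq> T" using T(2) by (intro span_minimal T(1)) blast
  moreover have "finite (V ` X)" "card (V ` X) = card X" using fin inj by (auto simp: card_image)
  ultimately show ?thesis unfolding form_index_def
    by (intro Sup_upper CollectI exI[of _ "V ` X"]) simp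
qed

section \<open>Sturm comparison for Hill forms\<close>

text \<open>An H^1 function vanishing at \<open>z\<close> need not be differentiable there, but
  \<open>(u t)^2 = o(|t - z|)\<close>: Cauchy-Schwarz bounds it by \<open>|t - z|\<close> times the
  energy of \<open>u\<close> between \<open>z\<close> and \<open>t\<close>, which tends to 0. This
  beats \<open>w' / w\<close>, of order \<open>1 / |t - z|\<close> at a simple zero.\<close>

lemma picone_boundary_term:
  fixes u g w w' :: "real \<Rightarrow> real"
  assumes u: "has_L2_deriv u g" "u z = 0" and w: "(w has_real_derivative D) (at z)" "D \<noteq> 0" "w z = 0" "isCont w' z"
  shows "((\<lambda>t. (u t)\<^sup>2 * (w' t / w t)) \<longlongrightarrow> 0) (at z)"
proof -
  define E where "E t = integral {z - 1..t} (\<lambda>t. (g t)\<^sup>2)" for t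
  have gint: "(\<lambda>t. (g t)\<^sup>2) integrable_on {x..y}" for x y
    using has_L2_deriv_inner_integrable[OF u(1) u(1)] by (simp add: power2_eq_square)
  have g1: "g integrable_on {x..y}" for x y
    using has_L2_deriv_abs_integrable[OF u(1)] set_lebesgue_integral_eq_integral by blast
  have contE: "isCont E z"
  proof -
    have "continuous_on {z - 1..z + 1} E" unfolding E_def
      by (rule indefinite_integral_continuous_1[OF gint])
    then show ?thesis by (rule continuous_on_interior) simp
  qed
  have bound: "(u t)\<^sup>2 \<le> \<bar>t - z\<bar> * \<bar>E t - E z\<bar>" if t: "\<bar>t - z\<bar> < 1" for t
  proof -
    have main: "(u y - u x)\<^sup>2 \<le> (y - x) * (E y - E x)" if "z - 1 \<le> x" "x \<le> y" for x y
    proof -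
      have "E y - E x = integral {x..y} (\<lambda>t. (g t)\<^sup>2)"
        unfolding E_def using Henstock_Kurzweil_Integration.integral_combine[of "z - 1" x y "\<lambda>t. (g t)\<^sup>2"] that gint
        by (simp add: algebra_simps)
      moreover have "u y - u x = integral {x..y} g"
        using integral_unique[OF has_L2_derivD(1)[OF u(1) that(2)]] by simp
      ultimately show ?thesis using integral_square_ge[OF that(2) g1 gint] by simp
    qed
    have E_mono: "E x \<le> E y" if "z - 1 \<le> x" "x \<le> y" for x y
    proof -
      have "E y = E x + integral {x..y} (\<lambda>t. (g t)\<^sup>2)"
        unfolding E_def using Henstock_Kurzweil_Integration.integral_combine[of "z - 1" x y "\<lambda>t. (g t)\<^sup>2"] that gint
        by simp
      moreover have "0 \<le> integral {x..y} (\<lambda>t. (g t)\<^sup>2)" by (intro integral_nonneg gint) auto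
      ultimately show ?thesis by simp
    qed
    show ?thesis
    proof (cases "z \<le> t")
      case True
      then show ?thesis using main[of z t] E_mono[of z t] u(2) by simp
    next
      case False
      then show ?thesis using main[of t z] E_mono[of t z] u(2) t by simp
    qed
  qed
  have quot: "((\<lambda>t. (t - z) / w t) \<longlongrightarrow> 1 / D) (at z)"
  proof -
    have "((\<lambda>t. (w t - w z) / (t - z)) \<longlongrightarrow> D) (at z)"
      using w(1) by (simp add: has_field_derivative_iff)
    from tendsto_divide[OF tendsto_const[of 1] this w(2)] show ?thesis by (simp add: w(3))
  qed
  show ?thesis
  proof (rule Lim_null_comparison)
    have "\<forall>\<^sub>F t in at z. \<bar>t - z\<bar> < 1"
      unfolding eventually_at by (intro exI[of _ 1]) (auto simp: dist_real_def)
    then show "\<forall>\<^sub>F t in at z. norm ((u t)\<^sup>2 * (w' t / w t)) \<le> \<bar>E t - E z\<bar> * \<bar>(t - z) / w t\<bar> * \<bar>w' t\<bar>"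
    proof eventually_elim
      case (elim t)
      have "norm ((u t)\<^sup>2 * (w' t / w t)) = (u t)\<^sup>2 * \<bar>w' t / w t\<bar>" by (simp add: abs_mult)
      also have "\<dots> \<le> (\<bar>t - z\<bar> * \<bar>E t - E z\<bar>) * \<bar>w' t / w t\<bar>"
        by (rule mult_right_mono[OF bound[OF elim]]) simp
      finally show ?case by (simp add: mult_ac)
    qed
    have "((\<lambda>t. \<bar>E t - E z\<bar> * \<bar>(t - z) / w t\<bar> * \<bar>w' t\<bar>) \<longlongrightarrow> \<bar>E z - E z\<bar> * \<bar>1 / D\<bar> * \<bar>w' z\<bar>) (at z)"
      using contE w(4) unfolding isCont_def by (intro tendsto_intros quot)
    then show "((\<lambda>t. \<bar>E t - E z\<bar> * \<bar>(t - z) / w t\<bar> * \<bar>w' t\<bar>) \<longlongrightarrow> 0) (at z)" by simp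
  qed
qed

text \<open>Picone's identity: \<open>g\<^sup>2 - p u\<^sup>2 = (g - u w'/w)\<^sup>2 + (u\<^sup>2 w'/w)'\<close>.\<close>

lemma picone_nonneg:
  fixes u g w w' p :: "real \<Rightarrow> real"
  assumes ab: "a < b"
    and w: "\<And>t. (w has_real_derivative w' t) (at t)" and w': "\<And>t. (w' has_real_derivative - p t * w t) (at t)"
    and p: "continuous_on UNIV p" and wz: "w a = 0" "w b = 0" "w' a \<noteq> 0" "w' b \<noteq> 0"
    and wnz: "\<And>t. a < t \<Longrightarrow> t < b \<Longrightarrow> w t \<noteq> 0"
    and u: "has_L2_deriv u g" "u a = 0" "u b = 0"
  shows "0 \<le> integral {a..b} (\<lambda>t. (g t)\<^sup>2 - p t * (u t)\<^sup>2)"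
proof -
  define h where "h t = (g t)\<^sup>2 - p t * (u t)\<^sup>2" for t
  define v where "v t = w' t / w t" for t
  have cw: "continuous_on S w" "continuous_on S w'" for S
    using w w' by (auto intro!: continuous_at_imp_continuous_on DERIV_isCont)
  have cu: "continuous_on S u" for S by (rule has_L2_deriv_continuous_on[OF u(1)])
  have cp: "continuous_on S p" for S using p continuous_on_subset by blast
  have gint: "(\<lambda>t. (g t)\<^sup>2) integrable_on {x..y}" for x y
    using has_L2_deriv_inner_integrable[OF u(1) u(1)] by (simp add: power2_eq_square)
  have hint: "h integrable_on {x..y}" for x y
    unfolding h_def by (intro integrable_diff gint integrable_continuous_interval continuous_intros cp cu)
  define F where "F t = integral {a..t} h" for t
  have key: "(u d)\<^sup>2 * v d - (u c)\<^sup>2 * v c \<le> F d - F c" if cd: "a < c" "c \<le> d" "d < b" for c d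
  proof -
    have u2: "has_L2_deriv (\<lambda>t. u t * u t) (\<lambda>t. g t * u t + u t * g t)"
      by (rule has_L2_deriv_bilinear[OF bounded_bilinear_mult u(1) u(1)])
    \<comment> \<open>The quotient \<open>v = w' / w\<close> solves the Riccati equation
      \<open>v' = - p - v^2\<close>.\<close>
    define dv where "dv t = - p t - (v t)\<^sup>2" for t
    have nz: "w t \<noteq> 0" if "t \<in> {c..d}" for t using wnz[of t] that cd by auto
    have Dv: "(v has_real_derivative dv t) (at t)" if "t \<in> {c..d}" for t
      unfolding v_def[abs_def] dv_def using nz[OF that]
      by (auto intro!: derivative_eq_intros w w' simp: power2_eq_square field_simps)
    have cdv: "continuous_on {c..d} dv"
      unfolding dv_def v_def using nz by (intro continuous_intros cp cw) auto
    have I: "((\<lambda>t. (g t * u t + u t * g t) * v t + (u t * u t) * dv t) has_integral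
        (u d * u d * v d - u c * u c * v c)) {c..d}"
    proof (rule has_integral_bilinear_product[OF bounded_bilinear_mult])
      show "((\<lambda>t. g t * u t + u t * g t) has_integral u x * u x - u c * u c) {c..x}" if "c \<le> x" for x
        using has_L2_derivD(1)[OF u2 that] .
      show "(dv has_integral v x - v c) {c..x}" if "c \<le> x" "x \<le> d" for x
      proof (rule fundamental_theorem_of_calculus[OF that(1)])
        fix t assume "t \<in> {c..x}"
        then show "(v has_vector_derivative dv t) (at t within {c..x})"
          using Dv[of t] that by (auto simp: has_real_derivative_iff_has_vector_derivative intro: has_vector_derivative_at_within)
      qed
      show "(\<lambda>t. g t * u t + u t * g t) absolutely_integrable_on {c..d}"
        by (rule has_L2_deriv_abs_integrable[OF u2])
      show "dv absolutely_integrable_on {c..d}"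
        using cdv by (rule absolutely_integrable_continuous_real)
    qed (use cd in auto)
    have "u d * u d * v d - u c * u c * v c \<le> integral {c..d} h"
      unfolding integral_unique[OF I, symmetric]
    proof (rule integral_le[OF has_integral_integrable[OF I] hint])
      fix t
      have "h t - ((g t * u t + u t * g t) * v t + (u t * u t) * dv t) = (g t - u t * v t)\<^sup>2"
        by (simp add: h_def dv_def power2_eq_square algebra_simps)
      then show "(g t * u t + u t * g t) * v t + (u t * u t) * dv t \<le> h t"
        using zero_le_power2[of "g t - u t * v t"] by linarith
    qed
    also have "integral {c..d} h = F d - F c" unfolding F_def
      using Henstock_Kurzweil_Integration.integral_combine[of a c d h] cd hint by simp
    finally show ?thesis by (simp add: power2_eq_square)
  qed
  \<comment> \<open>The identity makes sense only where \<open>w\<close> is nonzero, so it is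
    applied on \<open>[c n, d n]\<close> and the boundary terms disappear in the limit.\<close>
  define c where "c n = a + (b - a) / 2 / real (Suc n)" for n
  define d where "d n = b - (b - a) / 2 / real (Suc n)" for n
  have step: "0 < (b - a) / 2 / real (Suc n)" "(b - a) / 2 / real (Suc n) \<le> (b - a) / 2" for n
  proof -
    show "0 < (b - a) / 2 / real (Suc n)" using ab by simp
    show "(b - a) / 2 / real (Suc n) \<le> (b - a) / 2"
      using ab divide_left_mono[of 1 "real (Suc n)" "(b - a) / 2"] by simp
  qed
  have cd: "a < c n" "c n \<le> d n" "d n < b" for n
  proof -
    define r where "r = (b - a) / 2 / real (Suc n)"
    have "c n = a + r" "d n = b - r" "0 < r" "r \<le> (b - a) / 2"
      using step[of n] by (simp_all only: c_def d_def r_def)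
    then show "a < c n" "c n \<le> d n" "d n < b" by (simp_all add: field_simps)
  qed
  have to0: "(\<lambda>n. (b - a) / 2 / real (Suc n)) \<longlonglongrightarrow> 0"
    by (rule LIMSEQ_Suc[OF lim_const_over_n])
  have cl: "c \<longlonglongrightarrow> a" and dl: "d \<longlonglongrightarrow> b"
    unfolding c_def d_def using tendsto_add[OF tendsto_const to0, of a] tendsto_diff[OF tendsto_const to0, of b] by auto
  have ca: "filterlim c (at a) sequentially" and da: "filterlim d (at b) sequentially"
  proof -
    have "c n \<noteq> a" "d n \<noteq> b" for n using cd[of n] by auto
    then show "filterlim c (at a) sequentially" "filterlim d (at b) sequentially"
      using cl dl by (simp_all add: filterlim_at)
  qed
  have "((\<lambda>t. (u t)\<^sup>2 * v t) \<longlongrightarrow> 0) (at a)" "((\<lambda>t. (u t)\<^sup>2 * v t) \<longlongrightarrow> 0) (at b)"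
    unfolding v_def
    by (rule picone_boundary_term[OF u(1,2) w wz(3,1) DERIV_isCont[OF w']],
        rule picone_boundary_term[OF u(1,3) w wz(4,2) DERIV_isCont[OF w']])
  from filterlim_compose[OF this(1) ca] filterlim_compose[OF this(2) da]
  have "(\<lambda>n. (u (d n))\<^sup>2 * v (d n) - (u (c n))\<^sup>2 * v (c n)) \<longlonglongrightarrow> 0 - 0"
    by (rule tendsto_diff[rotated])
  moreover have "(\<lambda>n. F (d n) - F (c n)) \<longlonglongrightarrow> F b - F a"
  proof -
    have cF: "continuous_on {a..b} F" unfolding F_def by (rule indefinite_integral_continuous_1[OF hint])
    have "c n \<in> {a..b}" "d n \<in> {a..b}" for n using cd[of n] by auto
    then show ?thesis
      using ab by (intro tendsto_diff continuous_on_tendsto_compose[OF cF] cl dl always_eventually allI) simp_all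
  qed
  ultimately have "0 - 0 \<le> F b - F a"
    by (rule LIMSEQ_le) (intro exI[of _ 0] allI impI key cd)
  then show ?thesis by (simp add: F_def h_def[abs_def])
qed

text \<open>One arc of \<open>w\<close>, extended by zero and then periodically. The fundamental
  domain starts at \<open>z\<close> and not at 0, because the zeros of \<open>w\<close> are in
  general not integers and an arc may run past 1.\<close>

lemma ex_bump_loop:
  fixes w w' :: "real \<Rightarrow> real"
  assumes ab: "z \<le> \<alpha>" "\<alpha> < \<beta>" "\<beta> \<le> z + 1"
    and w: "\<And>t. (w has_real_derivative w' t) (at t)" and w': "continuous_on UNIV w'" and wz: "w \<alpha> = 0" "w \<beta> = 0"
  obtains u :: "real h1_loop" and g where "has_L2_deriv (loop_at u) g" "\<And>t. g (t + 1) = g t"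
    "\<And>t. z \<le> t \<Longrightarrow> t < z + 1 \<Longrightarrow> loop_at u t = (if t \<in> {\<alpha>..\<beta>} then w t else 0)"
    "\<And>t. z \<le> t \<Longrightarrow> t < z + 1 \<Longrightarrow> g t = (if t \<in> {\<alpha>..\<beta>} then w' t else 0)"
proof -
  \<comment> \<open>Clamping the argument to \<open>[\<alpha>, \<beta>]\<close> is the extension by
    zero, because \<open>w\<close> vanishes at both ends, and makes its continuity evident.\<close>
  define b where "b t = w (max \<alpha> (min \<beta> t))" for t
  define b' where "b' t = (if t \<in> {\<alpha>..\<beta>} then w' t else 0)" for t
  define u where "u t = b (z + frac (t - z))" for t
  define g where "g t = b' (z + frac (t - z))" for t
  have cw: "continuous_on S w" for S using w by (auto intro!: continuous_at_imp_continuous_on DERIV_isCont)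
  have cb: "continuous_on S b" for S unfolding b_def
    by (rule continuous_on_compose2[OF cw[of UNIV]]) (auto intro!: continuous_intros)
  have b_eq: "b t = (if t \<in> {\<alpha>..\<beta>} then w t else 0)" for t
    using ab wz by (auto simp: b_def max_def min_def)
  have u_eq: "u s = b (s - of_int n)" if "z + of_int n \<le> s" "s \<le> z + of_int n + 1" for s n
  proof (cases "s = z + of_int n + 1")
    case True
    then have "frac (s - z) = 0" by (simp add: frac_eq_0_iff)
    then show ?thesis using True ab wz by (auto simp: u_def b_eq)
  next
    case False
    then have "\<lfloor>s - z\<rfloor> = n" using that by (intro floor_unique) auto
    then show ?thesis by (simp add: u_def frac_def)
  qed
  have cu: "isCont u t" for t
  proof -
    define n where "n = \<lfloor>t - z\<rfloor>"
    have n: "z + of_int n \<le> t" "t < z + of_int n + 1" unfolding n_def by linarith+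
    have "continuous_on {z + of_int n..z + of_int n + 1} u"
      by (rule continuous_on_eq[of _ "\<lambda>s. b (s - of_int n)"])
         (use u_eq in \<open>auto intro!: continuous_intros continuous_on_compose2[OF cb[of UNIV]]\<close>)
    moreover have "continuous_on {z + of_int n - 1..z + of_int n} u"
      by (rule continuous_on_eq[of _ "\<lambda>s. b (s - of_int (n - 1))"])
         (use u_eq[of "n - 1"] in \<open>auto intro!: continuous_intros continuous_on_compose2[OF cb[of UNIV]]\<close>)
    ultimately have "continuous_on ({z + of_int n - 1..z + of_int n} \<union> {z + of_int n..z + of_int n + 1}) u"
      by (intro continuous_on_closed_Un) auto
    moreover have "{z + of_int n - 1..z + of_int n} \<union> {z + of_int n..z + of_int n + 1} = {z + of_int n - 1..z + of_int n + 1}"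
      by auto
    ultimately show ?thesis using n by (auto intro!: continuous_on_interior[of "{z + of_int n - 1..z + of_int n + 1}"])
  qed
  \<comment> \<open>The seam and the two corners with their translates; only finitely many lie in a
    bounded interval, which the fundamental theorem of calculus tolerates.\<close>
  define S where "S = {t. z + frac (t - z) \<in> {z, \<alpha>, \<beta>}}"
  have Du: "(u has_real_derivative g t) (at t)" if "t \<notin> S" for t
  proof -
    define n where "n = \<lfloor>t - z\<rfloor>"
    have fr: "z + frac (t - z) = t - of_int n" by (simp add: frac_def n_def)
    have t: "t - of_int n \<notin> {z, \<alpha>, \<beta>}" using that unfolding S_def mem_Collect_eq fr .
    have n: "z + of_int n < t" "t < z + of_int n + 1"
    proof -
      have "z \<le> t - of_int n" "t - of_int n < z + 1"
        using frac_lt_1[of "t - z"] frac_ge_0[of "t - z"] fr by linarith+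
      moreover have "t - of_int n \<noteq> z" using t by simp
      ultimately show "z + of_int n < t" "t < z + of_int n + 1" by linarith+
    qed
    have Dw: "((\<lambda>s. w (s - of_int n)) has_real_derivative w' (t - of_int n)) (at t)"
      using DERIV_shift[of w "w' (t - of_int n)" t "- of_int n"] w[of "t - of_int n"] by simp
    show ?thesis
    proof (cases "t - of_int n \<in> {\<alpha>..\<beta>}")
      case True
      have gt: "g t = w' (t - of_int n)" unfolding g_def fr b'_def using True by (rule if_P)
      show ?thesis unfolding gt
      proof (rule has_field_derivative_transform_within_open[OF Dw, of "{\<alpha> + of_int n<..<\<beta> + of_int n}"])
        show "t \<in> {\<alpha> + of_int n<..<\<beta> + of_int n}" using True t by auto
        show "w (x - of_int n) = u x" if "x \<in> {\<alpha> + of_int n<..<\<beta> + of_int n}" for x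
          using u_eq[of n x] that ab by (auto simp: b_eq)
      qed simp
    next
      case False
      have gt: "g t = 0" unfolding g_def fr b'_def using False by (rule if_not_P)
      show ?thesis unfolding gt
      proof (rule has_field_derivative_transform_within_open[of "\<lambda>_. 0" 0 t "{z + of_int n<..<z + of_int n + 1} - {\<alpha> + of_int n..\<beta> + of_int n}"])
        show "open ({z + of_int n<..<z + of_int n + 1} - {\<alpha> + of_int n..\<beta> + of_int n})"
          by (intro open_Diff) auto
        show "t \<in> {z + of_int n<..<z + of_int n + 1} - {\<alpha> + of_int n..\<beta> + of_int n}" using False n by auto
        show "0 = u x" if "x \<in> {z + of_int n<..<z + of_int n + 1} - {\<alpha> + of_int n..\<beta> + of_int n}" for x
          using u_eq[of n x] that by (auto simp: b_eq)
      qed simp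
    qed
  qed
  have finS: "finite (S \<inter> {x..y})" for x y
  proof -
    have "S \<inter> {x..y} \<subseteq> (\<lambda>(n, e). e + of_int n) ` ({\<lfloor>x - z\<rfloor>..\<lfloor>y - z\<rfloor>} \<times> {z, \<alpha>, \<beta>})"
    proof
      fix t assume t: "t \<in> S \<inter> {x..y}"
      have "t = (z + frac (t - z)) + of_int \<lfloor>t - z\<rfloor>" by (simp add: frac_def)
      moreover have "\<lfloor>t - z\<rfloor> \<in> {\<lfloor>x - z\<rfloor>..\<lfloor>y - z\<rfloor>}" using t by (auto intro!: floor_mono)
      ultimately show "t \<in> (\<lambda>(n, e). e + of_int n) ` ({\<lfloor>x - z\<rfloor>..\<lfloor>y - z\<rfloor>} \<times> {z, \<alpha>, \<beta>})"
        using t by (intro image_eqI[of _ _ "(\<lfloor>t - z\<rfloor>, z + frac (t - z))"]) (auto simp: S_def)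
    qed
    then show ?thesis by (rule finite_subset) auto
  qed
  have "bounded (w' ` {\<alpha>..\<beta>})"
    using continuous_on_subset[OF w'] by (intro compact_imp_bounded compact_continuous_image) auto
  then obtain K where K: "K > 0" "\<And>t. t \<in> {\<alpha>..\<beta>} \<Longrightarrow> norm (w' t) \<le> K" unfolding bounded_pos by blast
  have L2: "has_L2_deriv u g"
  proof (rule has_L2_derivI_bounded[of _ _ "\<lambda>_. K"])
    show "norm (g t) \<le> K" for t using K by (auto simp: g_def b'_def)
    fix x y :: real assume "x \<le> y"
    then show "(g has_integral u y - u x) {x..y}"
    proof (rule fundamental_theorem_of_calculus_interior_strong[OF finS[of x y]])
      fix t assume "t \<in> {x<..<y} - S \<inter> {x..y}"
      then have "t \<notin> S" by auto
      from Du[OF this] show "(u has_vector_derivative g t) (at t)"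
        by (simp add: has_real_derivative_iff_has_vector_derivative)
    qed (use cu in \<open>auto intro!: continuous_at_imp_continuous_on\<close>)
  qed auto
  have per: "frac (t + 1 - z) = frac (t - z)" for t
    by (metis add_diff_eq add.commute diff_add_eq frac_1_eq)
  have inv: "loop_at (Abs_h1_loop u) = u"
    by (rule Abs_h1_loop_inverse) (use L2 per in \<open>auto simp: u_def\<close>)
  have fr: "z + frac (t - z) = t" if "z \<le> t" "t < z + 1" for t
    using that frac_eq[of "t - z"] by simp
  show thesis
    by (rule that[of "Abs_h1_loop u" g]) (use L2 inv per fr in \<open>auto simp: g_def u_def b_eq b'_def\<close>)
qed

text \<open>
  The numbers \<open>z 0 < \<dots> < z n = z 0 + T\<close> are the consecutive zeros of a solution of \<open>w'' = - p w\<close>, which need not be periodic.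
\<close>

definition oscillates :: "(real \<Rightarrow> real) \<Rightarrow> real \<Rightarrow> nat \<Rightarrow> (nat \<Rightarrow> real) \<Rightarrow> bool" where
  "oscillates p T n z \<longleftrightarrow> continuous_on UNIV p \<and> 0 \<le> z 0 \<and> z 0 \<le> T \<and> z n = z 0 + T \<and> (\<forall>r<n. z r < z (Suc r)) \<and>
     (\<exists>w w'. (\<forall>t. (w has_real_derivative w' t) (at t) \<and> (w' has_real_derivative - p t * w t) (at t)) \<and>
        (\<forall>r\<le>n. w (z r) = 0 \<and> w' (z r) \<noteq> 0) \<and> (\<forall>r<n. \<forall>t. z r < t \<longrightarrow> t < z (Suc r) \<longrightarrow> w t \<noteq> 0))"

lemma oscillatesE:
  assumes "oscillates p T n z"
  obtains w w' where "\<And>t. (w has_real_derivative w' t) (at t)" "\<And>t. (w' has_real_derivative - p t * w t) (at t)"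
    "\<And>r. r \<le> n \<Longrightarrow> w (z r) = 0" "\<And>r. r \<le> n \<Longrightarrow> w' (z r) \<noteq> 0"
    "\<And>r t. r < n \<Longrightarrow> z r < t \<Longrightarrow> t < z (Suc r) \<Longrightarrow> w t \<noteq> 0"
proof -
  from assms obtain w w' where "\<forall>t. (w has_real_derivative w' t) (at t) \<and> (w' has_real_derivative - p t * w t) (at t)"
    "\<forall>r\<le>n. w (z r) = 0 \<and> w' (z r) \<noteq> 0" "\<forall>r<n. \<forall>t. z r < t \<longrightarrow> t < z (Suc r) \<longrightarrow> w t \<noteq> 0"
    unfolding oscillates_def by (elim exE conjE) (rule that)
  then show thesis by (intro that[of w w']) simp_all
qed

lemma oscillates_mono:
  assumes "oscillates p T n z" "r \<le> s" "s \<le> n"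
  shows "z r \<le> z s"
  using assms(2,3)
proof (induction s rule: dec_induct)
  case (step s)
  then have "z s < z (Suc s)" using assms(1) by (simp add: oscillates_def)
  then show ?case using step by simp
qed simp

text \<open>An \<open>m\<close>-fold iterate runs through \<open>m\<close> periods in unit time, so
  its Hill coefficient is \<open>m^2 p (m t)\<close>; this carries comparison solutions over to that
  scale.\<close>

lemma oscillates_scale:
  assumes osc: "oscillates p (real m) n z" and m: "m > 0"
  shows "oscillates (\<lambda>t. (real m)\<^sup>2 * p (real m * t)) 1 n (\<lambda>r. z r / real m)"
proof -
  obtain w w' where w: "\<And>t. (w has_real_derivative w' t) (at t)" "\<And>t. (w' has_real_derivative - p t * w t) (at t)"
    and wz: "\<And>r. r \<le> n \<Longrightarrow> w (z r) = 0" "\<And>r. r \<le> n \<Longrightarrow> w' (z r) \<noteq> 0"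
    and nz: "\<And>r t. r < n \<Longrightarrow> z r < t \<Longrightarrow> t < z (Suc r) \<Longrightarrow> w t \<noteq> 0"
    by (rule oscillatesE[OF osc]) (rule that)
  have p: "continuous_on UNIV p" using osc by (simp add: oscillates_def)
  have lin: "((\<lambda>t. real m * t) has_real_derivative real m) (at t)" for t
    by (auto intro!: derivative_eq_intros)
  have D1: "((\<lambda>t. w (real m * t)) has_real_derivative real m * w' (real m * t)) (at t)" for t
    using DERIV_chain2[OF w(1)[of "real m * t"] lin] by (simp add: mult.commute)
  have D2: "((\<lambda>t. real m * w' (real m * t)) has_real_derivative - ((real m)\<^sup>2 * p (real m * t)) * w (real m * t)) (at t)" for t
    using DERIV_cmult[OF DERIV_chain2[OF w(2)[of "real m * t"] lin], of "real m"]
    by (simp add: power2_eq_square algebra_simps)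
  have "continuous_on UNIV (\<lambda>t. (real m)\<^sup>2 * p (real m * t))"
    by (intro continuous_intros continuous_on_compose2[OF p]) auto
  moreover have "\<exists>w w1. (\<forall>t. (w has_real_derivative w1 t) (at t) \<and> (w1 has_real_derivative - ((real m)\<^sup>2 * p (real m * t)) * w t) (at t)) \<and>
        (\<forall>r\<le>n. w (z r / real m) = 0 \<and> w1 (z r / real m) \<noteq> 0) \<and>
        (\<forall>r<n. \<forall>t. z r / real m < t \<longrightarrow> t < z (Suc r) / real m \<longrightarrow> w t \<noteq> 0)"
  proof (rule exI[of _ "\<lambda>t. w (real m * t)"], rule exI[of _ "\<lambda>t. real m * w' (real m * t)"], intro conjI allI impI D1 D2)
    show "w (real m * (z r / real m)) = 0" "real m * w' (real m * (z r / real m)) \<noteq> 0" if "r \<le> n" for r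
      using wz[OF that] m by simp_all
    show "w (real m * t) \<noteq> 0" if "r < n" "z r / real m < t" "t < z (Suc r) / real m" for r t
      using nz[OF that(1), of "real m * t"] that(2,3) m by (simp add: field_simps)
  qed
  ultimately show ?thesis using osc m unfolding oscillates_def
    by (simp add: divide_strict_right_mono add_divide_distrib)
qed

section \<open>Hill forms over one period\<close>

lemma integral_sum_intervals:
  fixes f :: "real \<Rightarrow> real"
  assumes "\<And>r. r < n \<Longrightarrow> z r \<le> z (Suc r)" and "\<And>x y. f integrable_on {x..y}"
  shows "integral {z 0..z n} f = (\<Sum>r<n. integral {z r..z (Suc r)} f)"
  using assms(1)
proof (induction n)
  case (Suc n)
  have "z 0 \<le> z k" if "k \<le> n" for k
    using that
  proof (induction k)
    case (Suc k)
    then show ?case using Suc.prems \<open>\<And>r. r < Suc n \<Longrightarrow> z r \<le> z (Suc r)\<close>[of k] by simp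
  qed simp
  then have "integral {z 0..z (Suc n)} f = integral {z 0..z n} f + integral {z n..z (Suc n)} f"
    using Henstock_Kurzweil_Integration.integral_combine[of "z 0" "z n" "z (Suc n)" f] Suc.prems assms(2) by simp
  then show ?case using Suc by simp
qed simp

lemma hill_integrable:
  fixes u g :: "real \<Rightarrow> real"
  assumes u: "has_L2_deriv u g" and q: "continuous_on UNIV q"
  shows "(\<lambda>t. (g t)\<^sup>2 - q t * (u t)\<^sup>2) integrable_on {x..y}"
proof (rule integrable_diff)
  show "(\<lambda>t. (g t)\<^sup>2) integrable_on {x..y}"
    using has_L2_deriv_inner_integrable[OF u u, of x y] by (simp add: power2_eq_square)
  show "(\<lambda>t. q t * (u t)\<^sup>2) integrable_on {x..y}"
    by (intro integrable_continuous_interval continuous_intros continuous_on_subset[OF q] has_L2_deriv_continuous_on[OF u]) simp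
qed

text \<open>The shifted derivative is again an L^2 derivative of \<open>u\<close>, so uniqueness
  applies.\<close>

lemma has_L2_deriv_periodic_AE:
  fixes u g :: "real \<Rightarrow> real"
  assumes u: "has_L2_deriv u g" and per: "\<And>t. u (t + 1) = u t"
  obtains N where "negligible N" "\<And>t. t \<notin> N \<Longrightarrow> g (t + 1) = g t"
proof -
  have "has_L2_deriv u (\<lambda>t. g (t + 1))"
    unfolding has_L2_deriv_def
  proof (intro allI impI conjI)
    fix a b :: real assume ab: "a \<le> b"
    have "(g has_integral (u (b + 1) - u (a + 1))) {a + 1..b + 1}"
      using has_L2_derivD(1)[OF u, of "a + 1" "b + 1"] ab by simp
    then show "((\<lambda>t. g (t + 1)) has_integral u b - u a) {a..b}"
      using has_integral_shift_real_ivl[of g "u b - u a" "a + 1" "b + 1" 1] by (simp add: per)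
    have "((\<lambda>t. (norm (g t))\<^sup>2) has_integral (integral {a + 1..b + 1} (\<lambda>t. (norm (g t))\<^sup>2))) {a + 1..b + 1}"
      using has_L2_derivD(2)[OF u, of "a + 1" "b + 1"] ab by (simp add: has_integral_integral)
    then show "(\<lambda>t. (norm (g (t + 1)))\<^sup>2) integrable_on {a..b}"
      using has_integral_shift_real_ivl[of "\<lambda>t. (norm (g t))\<^sup>2" _ "a + 1" "b + 1" 1] by auto
  qed
  then show thesis using that by (rule has_L2_deriv_unique[OF _ u])
qed

lemma hill_integral_shift:
  fixes u g q :: "real \<Rightarrow> real"
  assumes u: "has_L2_deriv u g" "\<And>t. u (t + 1) = u t" and q: "continuous_on UNIV q" "\<And>t. q (t + 1) = q t"
    and c: "0 \<le> c" "c \<le> 1"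
  shows "integral {0..1} (\<lambda>t. (g t)\<^sup>2 - q t * (u t)\<^sup>2) = integral {c..c + 1} (\<lambda>t. (g t)\<^sup>2 - q t * (u t)\<^sup>2)"
proof -
  obtain N where N: "negligible N" "\<And>t. t \<notin> N \<Longrightarrow> g (t + 1) = g t"
    by (rule has_L2_deriv_periodic_AE[OF u]) blast
  show ?thesis
    by (rule integral_periodic_shift[OF N(1), symmetric])
       (use N(2) u(2) q(2) hill_integrable[OF u(1) q(1)] c in auto)
qed

text \<open>Picone's inequality on each arc. Imposing \<open>n\<close> of the \<open>n + 1\<close>
  zeros on \<open>u\<close> is enough: the last one is the first shifted by a period, and
  \<open>u\<close> is periodic even if \<open>w\<close> is not.\<close>

lemma hill_form_nonneg:
  fixes u g q :: "real \<Rightarrow> real"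
  assumes osc: "oscillates p 1 n z" and q: "continuous_on UNIV q" "\<And>t. q (t + 1) = q t" and le: "\<And>t. q t \<le> p t"
    and u: "has_L2_deriv u g" "\<And>t. u (t + 1) = u t" and uz: "\<And>r. r < n \<Longrightarrow> u (z r) = 0"
  shows "0 \<le> integral {0..1} (\<lambda>t. (g t)\<^sup>2 - q t * (u t)\<^sup>2)"
proof -
  obtain w w' where w: "\<And>t. (w has_real_derivative w' t) (at t)" "\<And>t. (w' has_real_derivative - p t * w t) (at t)"
    and wz: "\<And>r. r \<le> n \<Longrightarrow> w (z r) = 0" "\<And>r. r \<le> n \<Longrightarrow> w' (z r) \<noteq> 0"
    and nz: "\<And>r t. r < n \<Longrightarrow> z r < t \<Longrightarrow> t < z (Suc r) \<Longrightarrow> w t \<noteq> 0"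
    by (rule oscillatesE[OF osc]) (rule that)
  have p: "continuous_on UNIV p" and z: "0 \<le> z 0" "z 0 \<le> 1" "z n = z 0 + 1"
    and inc: "\<And>r. r < n \<Longrightarrow> z r < z (Suc r)"
    using osc by (auto simp: oscillates_def)
  have n0: "n > 0" using z(3) by (cases n) auto
  have uz': "u (z r) = 0" if "r \<le> n" for r
  proof (cases "r = n")
    case True
    then show ?thesis using z(3) u(2)[of "z 0"] uz[OF n0] by simp
  qed (use that uz in simp)
  have "integral {0..1} (\<lambda>t. (g t)\<^sup>2 - q t * (u t)\<^sup>2) = integral {z 0..z n} (\<lambda>t. (g t)\<^sup>2 - q t * (u t)\<^sup>2)"
    unfolding z(3) by (rule hill_integral_shift[OF u q z(1,2)])
  also have "\<dots> = (\<Sum>r<n. integral {z r..z (Suc r)} (\<lambda>t. (g t)\<^sup>2 - q t * (u t)\<^sup>2))"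
    by (rule integral_sum_intervals) (use inc hill_integrable[OF u(1) q(1)] in \<open>auto simp: less_imp_le\<close>)
  also have "\<dots> \<ge> 0"
  proof (rule sum_nonneg)
    fix r assume "r \<in> {..<n}"
    then have r: "r < n" by simp
    have "0 \<le> integral {z r..z (Suc r)} (\<lambda>t. (g t)\<^sup>2 - p t * (u t)\<^sup>2)"
      by (rule picone_nonneg[OF inc[OF r] w p _ _ _ _ nz[OF r] u(1)]) (use r wz uz' in auto)
    also have "\<dots> \<le> integral {z r..z (Suc r)} (\<lambda>t. (g t)\<^sup>2 - q t * (u t)\<^sup>2)"
      by (rule integral_le[OF hill_integrable[OF u(1) p] hill_integrable[OF u(1) q(1)]])
         (use le in \<open>auto intro: mult_right_mono\<close>)
    finally show "0 \<le> integral {z r..z (Suc r)} (\<lambda>t. (g t)\<^sup>2 - q t * (u t)\<^sup>2)" .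
  qed
  finally show ?thesis .
qed

text \<open>Integrating \<open>(w w')' = w'\<^sup>2 - p w\<^sup>2\<close> between consecutive zeros shows that the form is negative on the bumps.\<close>

lemma ex_negative_bumps:
  fixes q :: "real \<Rightarrow> real"
  assumes osc: "oscillates p 1 n z" and q: "continuous_on UNIV q" "\<And>t. q (t + 1) = q t" and less: "\<And>t. p t < q t"
  obtains u :: "nat \<Rightarrow> real h1_loop" and g where "\<And>r. r < n \<Longrightarrow> has_L2_deriv (loop_at (u r)) (g r)"
    "\<And>r. r < n \<Longrightarrow> integral {0..1} (\<lambda>t. (g r t)\<^sup>2 - q t * (loop_at (u r) t)\<^sup>2) < 0"
    "\<And>r s. r < n \<Longrightarrow> s < n \<Longrightarrow> r \<noteq> s \<Longrightarrow> integral {0..1} (\<lambda>t. g r t * g s t) = 0"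
    "\<And>r s. r < n \<Longrightarrow> s < n \<Longrightarrow> r \<noteq> s \<Longrightarrow> integral {0..1} (\<lambda>t. q t * (loop_at (u r) t * loop_at (u s) t)) = 0"
proof -
  obtain w w' where w: "\<And>t. (w has_real_derivative w' t) (at t)" "\<And>t. (w' has_real_derivative - p t * w t) (at t)"
    and wz: "\<And>r. r \<le> n \<Longrightarrow> w (z r) = 0" "\<And>r. r \<le> n \<Longrightarrow> w' (z r) \<noteq> 0"
    and nz: "\<And>r t. r < n \<Longrightarrow> z r < t \<Longrightarrow> t < z (Suc r) \<Longrightarrow> w t \<noteq> 0"
    by (rule oscillatesE[OF osc]) (rule that)
  have p: "continuous_on UNIV p" and z: "0 \<le> z 0" "z 0 \<le> 1" "z n = z 0 + 1"
    and inc: "\<And>r. r < n \<Longrightarrow> z r < z (Suc r)"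
    using osc by (auto simp: oscillates_def)
  note mono = oscillates_mono[OF osc]
  have cw: "continuous_on S w" "continuous_on S w'" for S
    using w by (auto intro!: continuous_at_imp_continuous_on DERIV_isCont)
  have cq: "continuous_on S q" "continuous_on S p" for S using q p continuous_on_subset by blast+
  define P where "P r u g \<longleftrightarrow> has_L2_deriv (loop_at u) g \<and> (\<forall>t. g (t + 1) = g t) \<and>
      (\<forall>t. z 0 \<le> t \<longrightarrow> t < z 0 + 1 \<longrightarrow> loop_at u t = (if t \<in> {z r..z (Suc r)} then w t else 0)) \<and>
      (\<forall>t. z 0 \<le> t \<longrightarrow> t < z 0 + 1 \<longrightarrow> g t = (if t \<in> {z r..z (Suc r)} then w' t else 0))" for r u g
  have "\<exists>u g. P r u g" if r: "r < n" for r
  proof -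
    have "z 0 \<le> z r" "z r < z (Suc r)" "z (Suc r) \<le> z 0 + 1" using mono[of 0 r] inc[OF r] mono[of "Suc r" n] r z by auto
    moreover have "w (z r) = 0" "w (z (Suc r)) = 0" using wz(1) r by auto
    ultimately show ?thesis
    proof (rule ex_bump_loop[OF _ _ _ w(1) cw(2)])
      fix u :: "real h1_loop" and g
      assume "has_L2_deriv (loop_at u) g" "\<And>t. g (t + 1) = g t"
      "\<And>t. z 0 \<le> t \<Longrightarrow> t < z 0 + 1 \<Longrightarrow> loop_at u t = (if t \<in> {z r..z (Suc r)} then w t else 0)"
      "\<And>t. z 0 \<le> t \<Longrightarrow> t < z 0 + 1 \<Longrightarrow> g t = (if t \<in> {z r..z (Suc r)} then w' t else 0)"
      then have "P r u g" unfolding P_def by (intro conjI allI impI)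
      then show ?thesis by blast
    qed
  qed
  then obtain u g where "\<And>r. r < n \<Longrightarrow> P r (u r) (g r)" by metis
  then have ug: "\<And>r. r < n \<Longrightarrow> has_L2_deriv (loop_at (u r)) (g r)"
    and gper: "\<And>r t. r < n \<Longrightarrow> g r (t + 1) = g r t"
    and u: "\<And>r t. r < n \<Longrightarrow> z 0 \<le> t \<Longrightarrow> t < z 0 + 1 \<Longrightarrow> loop_at (u r) t = (if t \<in> {z r..z (Suc r)} then w t else 0)"
    and g: "\<And>r t. r < n \<Longrightarrow> z 0 \<le> t \<Longrightarrow> t < z 0 + 1 \<Longrightarrow> g r t = (if t \<in> {z r..z (Suc r)} then w' t else 0)"
    unfolding P_def by blast+
  have neg: "integral {0..1} (\<lambda>t. (g r t)\<^sup>2 - q t * (loop_at (u r) t)\<^sup>2) < 0" if r: "r < n" for r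
  proof -
    let ?I = "{z r..z (Suc r)}"
    have sub: "?I \<subseteq> {z 0..z 0 + 1}" using mono[of 0 r] mono[of "Suc r" n] r z(3) by auto
    have "integral {0..1} (\<lambda>t. (g r t)\<^sup>2 - q t * (loop_at (u r) t)\<^sup>2) = integral {z 0..z 0 + 1} (\<lambda>t. (g r t)\<^sup>2 - q t * (loop_at (u r) t)\<^sup>2)"
      by (rule hill_integral_shift[OF ug[OF r] loop_at_periodic q z(1,2)])
    \<comment> \<open>The formula for the bump holds on the half-open period only, so the right end
      is removed as a null set.\<close>
    also have "\<dots> = integral {z 0..z 0 + 1} (\<lambda>t. if t \<in> ?I then (w' t)\<^sup>2 - q t * (w t)\<^sup>2 else 0)"
      by (rule integral_spike[of "{z 0 + 1}"]) (use u[OF r] g[OF r] in auto)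
    also have "\<dots> = integral ?I (\<lambda>t. (w' t)\<^sup>2 - q t * (w t)\<^sup>2)"
      by (simp only: integral_restrict_Int Int_absorb2[OF sub])
    also have "\<dots> = integral ?I (\<lambda>t. ((w' t)\<^sup>2 - p t * (w t)\<^sup>2) - (q t - p t) * (w t)\<^sup>2)"
      by (simp add: algebra_simps)
    also have "\<dots> = integral ?I (\<lambda>t. (w' t)\<^sup>2 - p t * (w t)\<^sup>2) - integral ?I (\<lambda>t. (q t - p t) * (w t)\<^sup>2)"
      by (intro integral_diff integrable_continuous_interval continuous_intros cq cw)
    also have "integral ?I (\<lambda>t. (w' t)\<^sup>2 - p t * (w t)\<^sup>2) = w (z (Suc r)) * w' (z (Suc r)) - w (z r) * w' (z r)"
    proof (rule integral_unique, rule fundamental_theorem_of_calculus)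
      fix t
      have "((\<lambda>t. w t * w' t) has_real_derivative ((w' t)\<^sup>2 - p t * (w t)\<^sup>2)) (at t)"
        by (auto intro!: derivative_eq_intros w simp: power2_eq_square)
      then show "((\<lambda>t. w t * w' t) has_vector_derivative ((w' t)\<^sup>2 - p t * (w t)\<^sup>2)) (at t within ?I)"
        by (simp add: has_real_derivative_iff_has_vector_derivative has_vector_derivative_at_within)
    qed (use inc[OF r] in simp)
    also have "\<dots> = 0" using wz r by simp
    finally have eq: "integral {0..1} (\<lambda>t. (g r t)\<^sup>2 - q t * (loop_at (u r) t)\<^sup>2) = - integral ?I (\<lambda>t. (q t - p t) * (w t)\<^sup>2)"
      by simp
    define f where "f t = (q t - p t) * (w t)\<^sup>2" for t
    have cf: "continuous_on ?I f" unfolding f_def by (intro continuous_intros cq cw)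
    have f0: "f t \<ge> 0" for t using less[of t] by (simp add: f_def)
    \<comment> \<open>Strictness comes from the midpoint of the arc, where \<open>w\<close> does not
      vanish and \<open>p < q\<close>.\<close>
    have "integral ?I f \<noteq> 0"
    proof
      assume "integral ?I f = 0"
      then have "f ((z r + z (Suc r)) / 2) = 0"
        using integral_eq_0_iff[OF cf inc[OF r]] f0 inc[OF r] by auto
      moreover have "w ((z r + z (Suc r)) / 2) \<noteq> 0" using nz[OF r] inc[OF r] by simp
      ultimately show False using less[of "(z r + z (Suc r)) / 2"] by (simp add: f_def)
    qed
    moreover have "integral ?I f \<ge> 0" using f0 cf by (intro integral_nonneg integrable_continuous_interval) auto
    ultimately have "integral ?I f > 0" by simp
    then show ?thesis unfolding eq f_def by simp
  qed
  \<comment> \<open>Different arcs meet only in zeros of \<open>w\<close>, finitely many, so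
    products of different bumps integrate to 0.\<close>
  have sep: "t \<in> z ` {..n}" if "r < n" "s < n" "r \<noteq> s" "t \<in> {z r..z (Suc r)}" "t \<in> {z s..z (Suc s)}" for r s t
    using that
  proof (induction r s rule: linorder_wlog)
    case (le r s)
    then have "z (Suc r) \<le> z s" by (intro mono) auto
    then have "t = z s" using le by auto
    then show ?case using le by auto
  next
    case (sym r s)
    then show ?case by auto
  qed
  have orth_g: "integral {0..1} (\<lambda>t. g r t * g s t) = 0" if rs: "r < n" "s < n" "r \<noteq> s" for r s
  proof -
    have "integral {0..1} (\<lambda>t. g r t * g s t) = integral {z 0..z 0 + 1} (\<lambda>t. g r t * g s t)"
      using has_L2_deriv_inner_integrable[OF ug[OF rs(1)] ug[OF rs(2)]] z gper rs
      by (intro integral_periodic_shift[of "{}", symmetric]) auto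
    also have "\<dots> = integral {z 0..z 0 + 1} (\<lambda>t. 0)"
      by (rule integral_spike[of "insert (z 0 + 1) (z ` {..n})"]) (use g rs sep[OF rs] in \<open>auto intro: negligible_finite\<close>)
    finally show ?thesis by simp
  qed
  have orth_u: "integral {0..1} (\<lambda>t. q t * (loop_at (u r) t * loop_at (u s) t)) = 0" if rs: "r < n" "s < n" "r \<noteq> s" for r s
  proof -
    have "integral {0..1} (\<lambda>t. q t * (loop_at (u r) t * loop_at (u s) t)) = integral {z 0..z 0 + 1} (\<lambda>t. q t * (loop_at (u r) t * loop_at (u s) t))"
      using z q by (intro integral_periodic_shift[of "{}", symmetric] integrable_continuous_interval continuous_intros cq)
        (auto simp: loop_at_periodic)
    also have "\<dots> = integral {z 0..z 0 + 1} (\<lambda>t. 0)"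
      by (rule integral_spike[of "insert (z 0 + 1) (z ` {..n})"]) (use u rs sep[OF rs] in \<open>auto intro: negligible_finite\<close>)
    finally show ?thesis by simp
  qed
  show thesis by (rule that[OF ug neg orth_g orth_u])
qed

section \<open>The index of a planar geodesic\<close>

lemma inner_two_components:
  fixes x y :: "real ^ 'n"
  assumes "i \<noteq> j" "\<And>k. k \<noteq> i \<Longrightarrow> k \<noteq> j \<Longrightarrow> x $ k * y $ k = 0"
  shows "x \<bullet> y = x $ i * y $ i + x $ j * y $ j"
proof -
  have "x \<bullet> y = (\<Sum>k\<in>UNIV. x $ k * y $ k)" by (simp add: inner_vec_def)
  also have "\<dots> = (\<Sum>k\<in>{i, j}. x $ k * y $ k)" by (rule sum.mono_neutral_right) (use assms(2) in auto)
  finally show ?thesis using assms(1) by simp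
qed

lemma bounded_linear_axis: "bounded_linear (axis k :: real \<Rightarrow> real ^ 'n)"
  by (intro linear_conv_bounded_linear[THEN iffD1] linearI) (auto simp: axis_def vec_eq_iff)

lift_definition axis_loop :: "'n \<Rightarrow> real h1_loop \<Rightarrow> (real ^ 'n) h1_loop" is "\<lambda>k u t. axis k (u t)"
  using has_L2_deriv_linear[OF bounded_linear_axis] by fastforce

lemma loop_at_axis_loop: "loop_at (axis_loop k u) t = axis k (loop_at u t)"
  by (simp add: axis_loop.rep_eq)

locale planar_geodesic = ellipsoid_geodesic a \<Gamma> \<Gamma>' lam
  for a :: "real ^ 'n" and \<Gamma> \<Gamma>' lam +
  fixes i j :: 'n
  assumes ij: "i \<noteq> j" and planar: "\<And>k t. k \<noteq> i \<Longrightarrow> k \<noteq> j \<Longrightarrow> G t $ k = 0"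
begin

lemma G_comp_deriv: "((\<lambda>t. G t $ k) has_real_derivative \<Gamma>' t $ k) (at t)"
  using bounded_linear.has_vector_derivative[OF bounded_linear_vec_nth deriv]
  by (simp add: has_real_derivative_iff_has_vector_derivative)

lemma G'_comp_deriv: "((\<lambda>t. \<Gamma>' t $ k) has_real_derivative - (lam t / (a $ k)\<^sup>2) * G t $ k) (at t)"
  using bounded_linear.has_vector_derivative[OF bounded_linear_vec_nth[of k] deriv']
  by (simp add: has_real_derivative_iff_has_vector_derivative normal_at_def)

lemma planar': "\<Gamma>' t $ k = 0" if "k \<noteq> i" "k \<noteq> j"
proof -
  have "((\<lambda>t. G t $ k) has_real_derivative 0) (at t)" unfolding planar[OF that] by simp
  from DERIV_unique[OF G_comp_deriv this] show ?thesis .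
qed

lemma planar_inner: "x \<bullet> N (G t) = x $ i * (G t $ i / (a $ i)\<^sup>2) + x $ j * (G t $ j / (a $ j)\<^sup>2)"
  using inner_two_components[OF ij, of x "N (G t)"] planar by (simp add: normal_at_def)

text \<open>The potential in \<open>u'' = - hill k u\<close>, the Jacobi equation along the
  \<open>k\<close>-th axis for \<open>k\<close> outside the plane; for \<open>k = i\<close> and
  \<open>k = j\<close> the coordinates of \<open>G\<close> are nontrivial solutions.\<close>

definition "hill k t = lam t / (a $ k)\<^sup>2"

lemma cont_hill: "continuous_on S (hill k)"
  unfolding hill_def using a_pos[of k] by (intro continuous_intros cont_lam) simp

lemma hill_periodic: "hill k (t + 1) = hill k t"
  by (simp add: hill_def lam_periodic)

lemma component_L2: "has_L2_deriv (\<lambda>t. loop_at V t $ k) (\<lambda>t. loop_deriv V t $ k)"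
  using has_L2_deriv_linear[OF bounded_linear_vec_nth has_L2_deriv_loop_deriv] .

text \<open>The form splits into scalar Hill forms because \<open>N\<close> is diagonal.\<close>

lemma jacobi_form_components:
  "jacobi_form V V = (\<Sum>k\<in>UNIV. integral {0..1} (\<lambda>t. (loop_deriv V t $ k)\<^sup>2 - hill k t * (loop_at V t $ k)\<^sup>2))"
proof -
  have "jacobi_form V V = integral {0..1} (\<lambda>t. loop_deriv V t \<bullet> loop_deriv V t - lam t * (loop_at V t \<bullet> N (loop_at V t)))"
    unfolding jacobi_form_def energy_form_def curv_def
    by (rule integral_diff[symmetric, OF loop_deriv_inner_integrable curv_integrable])
  also have "\<dots> = integral {0..1} (\<lambda>t. \<Sum>k\<in>UNIV. (loop_deriv V t $ k)\<^sup>2 - hill k t * (loop_at V t $ k)\<^sup>2)"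
    by (simp add: inner_vec_def normal_at_def hill_def sum_subtractf sum_distrib_left power2_eq_square mult_ac)
  also have "\<dots> = (\<Sum>k\<in>UNIV. integral {0..1} (\<lambda>t. (loop_deriv V t $ k)\<^sup>2 - hill k t * (loop_at V t $ k)\<^sup>2))"
    by (rule integral_sum) (use hill_integrable[OF component_L2 cont_hill] in auto)
  finally show ?thesis .
qed

text \<open>
  A tangent field in the plane of \<open>\<Gamma>\<close> is \<open>u \<Gamma>' / \<parallel>\<Gamma>'\<parallel>\<^sup>2\<close> with \<open>u = \<langle>V, \<Gamma>'\<rangle>\<close>, and the integrand is \<open>u'\<^sup>2 / \<parallel>\<Gamma>'\<parallel>\<^sup>2\<close>:
  the ellipse itself is flat.
\<close>

lemma planar_part_nonneg:
  assumes V: "V \<in> loop_space_tangent a \<Gamma>"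
  shows "0 \<le> integral {0..1} (\<lambda>t. (loop_deriv V t $ i)\<^sup>2 - hill i t * (loop_at V t $ i)\<^sup>2)
           + integral {0..1} (\<lambda>t. (loop_deriv V t $ j)\<^sup>2 - hill j t * (loop_at V t $ j)\<^sup>2)"
proof -
  let ?V = "loop_at V" and ?h = "loop_deriv V"
  define u where "u t = ?V t \<bullet> \<Gamma>' t" for t
  define u' where "u' t = ?h t \<bullet> \<Gamma>' t + ?V t \<bullet> ((- lam t) *\<^sub>R N (G t))" for t
  have tang: "?V t \<bullet> N (G t) = 0" for t
    using V by (simp add: loop_space_tangent_def ellipsoid_tangent_iff)
  have u_L2: "has_L2_deriv u u'"
    unfolding u_def[abs_def] u'_def[abs_def]
    by (rule has_L2_deriv_bilinear[OF bounded_bilinear_inner has_L2_deriv_loop_deriv G'_L2])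
  have s2: "speed\<^sup>2 = (\<Gamma>' t $ i)\<^sup>2 + (\<Gamma>' t $ j)\<^sup>2" for t
    using inner_two_components[OF ij, of "\<Gamma>' t" "\<Gamma>' t"] planar' by (simp add: G'G' power2_eq_square)
  have s0: "speed\<^sup>2 > 0" using speed_pos by simp
  have comp: "?V t $ k = u t * \<Gamma>' t $ k / speed\<^sup>2" if k: "k \<in> {i, j}" for k t
  proof -
    define n1 n2 where "n1 = G t $ i / (a $ i)\<^sup>2" and "n2 = G t $ j / (a $ j)\<^sup>2"
    define v1 v2 where "v1 = ?V t $ i" and "v2 = ?V t $ j"
    define t1 t2 where "t1 = \<Gamma>' t $ i" and "t2 = \<Gamma>' t $ j"
    have v: "v1 * n1 + v2 * n2 = 0" using tang[of t] by (simp add: planar_inner n1_def n2_def v1_def v2_def)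
    have t: "t1 * n1 + t2 * n2 = 0" using G'_NG[of t] by (simp add: planar_inner n1_def n2_def t1_def t2_def)
    have n: "n1 \<noteq> 0 \<or> n2 \<noteq> 0"
      using GG[of t] by (auto simp: planar_inner n1_def n2_def)
    \<comment> \<open>In the plane both \<open>V\<close> and \<open>\<Gamma>'\<close> are orthogonal
      to the nonzero normal, hence parallel.\<close>
    have "(v1 * t2 - v2 * t1) * n1 = t2 * (v1 * n1 + v2 * n2) - v2 * (t1 * n1 + t2 * n2)"
      "(v1 * t2 - v2 * t1) * n2 = v1 * (t1 * n1 + t2 * n2) - t1 * (v1 * n1 + v2 * n2)" by (simp_all add: algebra_simps)
    then have "v1 * t2 = v2 * t1" using v t n by auto
    then have "v1 * (t1\<^sup>2 + t2\<^sup>2) = (v1 * t1 + v2 * t2) * t1" "v2 * (t1\<^sup>2 + t2\<^sup>2) = (v1 * t1 + v2 * t2) * t2"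
      by (simp_all add: power2_eq_square algebra_simps)
    moreover have "u t = v1 * t1 + v2 * t2"
      unfolding u_def v1_def v2_def t1_def t2_def using inner_two_components[OF ij, of "?V t" "\<Gamma>' t"] planar' by simp
    ultimately have "v1 * speed\<^sup>2 = u t * t1" "v2 * speed\<^sup>2 = u t * t2"
      using s2[of t] by (simp_all add: t1_def t2_def)
    then have "v1 = u t * t1 / speed\<^sup>2" "v2 = u t * t2 / speed\<^sup>2" using s0 by (simp_all add: field_simps)
    then show ?thesis using k by (auto simp: v1_def v2_def t1_def t2_def)
  qed
  \<comment> \<open>A derivative of the components of \<open>V\<close>, computed from
    \<open>u \<Gamma>' / speed^2\<close> and the geodesic equation; it agrees with
    \<open>loop_deriv\<close> almost everywhere.\<close>
  define d where "d k t = (u' t * \<Gamma>' t $ k + u t * (- hill k t * G t $ k)) / speed\<^sup>2" for k t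
  have d_L2: "has_L2_deriv (\<lambda>t. ?V t $ k) (d k)" if k: "k \<in> {i, j}" for k
  proof -
    have "has_L2_deriv (\<lambda>t. \<Gamma>' t $ k) (\<lambda>t. - hill k t * G t $ k)"
      using has_L2_deriv_linear[OF bounded_linear_vec_nth[of k] G'_L2] by (simp add: hill_def normal_at_def)
    from has_L2_deriv_linear[OF bounded_linear_divide has_L2_deriv_bilinear[OF bounded_bilinear_mult u_L2 this], of "speed\<^sup>2"]
    show ?thesis unfolding d_def[abs_def] using comp[OF k] by simp
  qed
  have di: "has_L2_deriv (\<lambda>t. ?V t $ i) (d i)" and dj: "has_L2_deriv (\<lambda>t. ?V t $ j) (d j)"
    by (rule d_L2, simp)+
  obtain M where M: "negligible M" "\<And>t. t \<notin> M \<Longrightarrow> ?h t $ i = d i t"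
    by (rule has_L2_deriv_unique[OF component_L2 di]) (rule that)
  obtain M' where M': "negligible M'" "\<And>t. t \<notin> M' \<Longrightarrow> ?h t $ j = d j t"
    by (rule has_L2_deriv_unique[OF component_L2 dj]) (rule that)
  have pos: "(d i t)\<^sup>2 - hill i t * (?V t $ i)\<^sup>2 + ((d j t)\<^sup>2 - hill j t * (?V t $ j)\<^sup>2) \<ge> 0" for t
  proof -
    define n1 n2 where "n1 = G t $ i / (a $ i)\<^sup>2" and "n2 = G t $ j / (a $ j)\<^sup>2"
    define t1 t2 where "t1 = \<Gamma>' t $ i" and "t2 = \<Gamma>' t $ j"
    define s where "s = speed\<^sup>2"
    have tn: "t1 * n1 + t2 * n2 = 0" using G'_NG[of t] by (simp add: planar_inner n1_def n2_def t1_def t2_def)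
    have tt: "t1\<^sup>2 + t2\<^sup>2 = s" using s2[of t] by (simp add: t1_def t2_def s_def)
    have NN: "N (G t) \<bullet> N (G t) = n1\<^sup>2 + n2\<^sup>2"
      by (subst planar_inner) (simp add: normal_at_def n1_def n2_def power2_eq_square)
    have tNt: "\<Gamma>' t \<bullet> N (\<Gamma>' t) = t1\<^sup>2 / (a $ i)\<^sup>2 + t2\<^sup>2 / (a $ j)\<^sup>2"
      using inner_two_components[OF ij, of "\<Gamma>' t" "N (\<Gamma>' t)"] planar'
      by (simp add: normal_at_def t1_def t2_def power2_eq_square)
    have le: "lam t * (n1\<^sup>2 + n2\<^sup>2) = t1\<^sup>2 / (a $ i)\<^sup>2 + t2\<^sup>2 / (a $ j)\<^sup>2"
      using lam_eq[of t] by (simp add: NN tNt)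
    have di: "d i t = (u' t * t1 - u t * lam t * n1) / s" "d j t = (u' t * t2 - u t * lam t * n2) / s"
      by (simp_all add: d_def hill_def n1_def n2_def t1_def t2_def s_def)
    have vi: "?V t $ i = u t * t1 / s" "?V t $ j = u t * t2 / s"
      using comp[of i t] comp[of j t] by (simp_all add: t1_def t2_def s_def)
    have "(d i t)\<^sup>2 - hill i t * (?V t $ i)\<^sup>2 + ((d j t)\<^sup>2 - hill j t * (?V t $ j)\<^sup>2)
      = ((u' t * t1 - u t * lam t * n1)\<^sup>2 + (u' t * t2 - u t * lam t * n2)\<^sup>2
          - lam t * (u t)\<^sup>2 * (t1\<^sup>2 / (a $ i)\<^sup>2 + t2\<^sup>2 / (a $ j)\<^sup>2)) / s\<^sup>2"
    proof -
      have "(A / s)\<^sup>2 - L / p * (u t * x / s)\<^sup>2 + ((B / s)\<^sup>2 - L / q * (u t * y / s)\<^sup>2)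
          = (A\<^sup>2 + B\<^sup>2 - L * (u t)\<^sup>2 * (x\<^sup>2 / p + y\<^sup>2 / q)) / s\<^sup>2" for A B x y L p q
        by (simp add: power_divide power_mult_distrib add_divide_distrib diff_divide_distrib distrib_left)
      then show ?thesis unfolding di vi hill_def .
    qed
    \<comment> \<open>By \<open>lam_eq\<close> the terms with the square of \<open>u\<close> cancel.
      The mixed term vanishes because \<open>\<Gamma>'\<close> is orthogonal to the normal.\<close>
    also have "\<dots> = ((u' t)\<^sup>2 * (t1\<^sup>2 + t2\<^sup>2) - 2 * u' t * u t * lam t * (t1 * n1 + t2 * n2)) / s\<^sup>2"
      unfolding le[symmetric] by (simp add: power2_eq_square algebra_simps)
    also have "\<dots> \<ge> 0" unfolding tn tt s_def by simp
    finally show ?thesis .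
  qed
  have I: "(\<lambda>t. (?h t $ k)\<^sup>2 - hill k t * (?V t $ k)\<^sup>2) integrable_on {0..1}" for k
    by (rule hill_integrable[OF component_L2 cont_hill])
  have I': "(\<lambda>t. (d k t)\<^sup>2 - hill k t * (?V t $ k)\<^sup>2) integrable_on {0..1}" if "k \<in> {i, j}" for k
    by (rule hill_integrable[OF d_L2[OF that] cont_hill])
  have "integral {0..1} (\<lambda>t. (?h t $ i)\<^sup>2 - hill i t * (?V t $ i)\<^sup>2) = integral {0..1} (\<lambda>t. (d i t)\<^sup>2 - hill i t * (?V t $ i)\<^sup>2)"
    by (rule integral_spike[OF M(1)]) (simp add: M(2))
  moreover have "integral {0..1} (\<lambda>t. (?h t $ j)\<^sup>2 - hill j t * (?V t $ j)\<^sup>2) = integral {0..1} (\<lambda>t. (d j t)\<^sup>2 - hill j t * (?V t $ j)\<^sup>2)"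
    by (rule integral_spike[OF M'(1)]) (simp add: M'(2))
  ultimately have "integral {0..1} (\<lambda>t. (?h t $ i)\<^sup>2 - hill i t * (?V t $ i)\<^sup>2) + integral {0..1} (\<lambda>t. (?h t $ j)\<^sup>2 - hill j t * (?V t $ j)\<^sup>2)
    = integral {0..1} (\<lambda>t. (d i t)\<^sup>2 - hill i t * (?V t $ i)\<^sup>2 + ((d j t)\<^sup>2 - hill j t * (?V t $ j)\<^sup>2))"
    using I' by (simp add: integral_add)
  also have "\<dots> \<ge> 0" using I' pos by (intro integral_nonneg integrable_add) auto
  finally show ?thesis .
qed

text \<open>The functionals are evaluations of the components \<open>k\<close> outside the plane at
  the zeros of the comparison solutions. On their common kernel each of these Hill forms is
  nonnegative, and for tangent fields the part in the plane always is.\<close>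

lemma index_le:
  assumes osc: "\<And>k. k \<notin> {i, j} \<Longrightarrow> oscillates (p k) 1 (n k) (z k)" and le: "\<And>k t. k \<notin> {i, j} \<Longrightarrow> hill k t \<le> p k t"
  shows "geodesic_index a \<Gamma> \<le> enat (\<Sum>k\<in>-{i, j}. n k)"
proof -
  define \<Phi> where "\<Phi> = (\<Union>k\<in>-{i, j}. (\<lambda>r (V :: (real^'n) h1_loop). loop_at V (z k r) $ k) ` {..<n k})"
  have "geodesic_index a \<Gamma> \<le> enat (card \<Phi>)"
    unfolding geodesic_index_eq
  proof (rule form_index_le)
    show "finite \<Phi>" by (auto simp: \<Phi>_def)
    show "linear \<phi>" if "\<phi> \<in> \<Phi>" for \<phi> :: "(real ^ 'n) h1_loop \<Rightarrow> real"
      using that by (auto simp: \<Phi>_def intro!: linearI)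
    fix V assume V: "V \<in> loop_space_tangent a \<Gamma>" and z: "\<And>\<phi>. \<phi> \<in> \<Phi> \<Longrightarrow> \<phi> V = 0"
    define I where "I k = integral {0..1} (\<lambda>t. (loop_deriv V t $ k)\<^sup>2 - hill k t * (loop_at V t $ k)\<^sup>2)" for k
    have nn: "I k \<ge> 0" if k: "k \<in> - {i, j}" for k
    proof -
      have k': "k \<notin> {i, j}" using k by simp
      have "loop_at V (z k r) $ k = 0" if "r < n k" for r
      proof -
        have "(\<lambda>V :: (real^'n) h1_loop. loop_at V (z k r) $ k) \<in> \<Phi>" unfolding \<Phi>_def using k that by blast
        then show ?thesis by (rule z)
      qed
      then show ?thesis unfolding I_def
        by (intro hill_form_nonneg[OF osc[OF k'] cont_hill hill_periodic le[OF k'] component_L2]) (simp_all add: loop_at_periodic)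
    qed
    have "jacobi_form V V = (\<Sum>k\<in>{i, j} \<union> - {i, j}. I k)"
      by (simp add: jacobi_form_components I_def)
    also have "\<dots> = I i + I j + (\<Sum>k\<in>- {i, j}. I k)"
      using ij by (subst sum.union_disjoint) auto
    also have "\<dots> \<ge> 0"
    proof -
      have "0 \<le> I i + I j" using planar_part_nonneg[OF V] by (simp only: I_def)
      moreover have "0 \<le> (\<Sum>k\<in>- {i, j}. I k)" by (rule sum_nonneg[OF nn])
      ultimately show ?thesis by simp
    qed
    finally show "0 \<le> jacobi_form V V" .
  qed
  also have "card \<Phi> \<le> (\<Sum>k\<in>-{i, j}. card ((\<lambda>r V. loop_at (V :: (real^'n) h1_loop) (z k r) $ k) ` {..<n k}))"
    unfolding \<Phi>_def by (rule card_UN_le) simp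
  also have "\<dots> \<le> (\<Sum>k\<in>-{i, j}. n k)"
  proof (rule sum_mono)
    fix k
    show "card ((\<lambda>r V. loop_at (V :: (real^'n) h1_loop) (z k r) $ k) ` {..<n k}) \<le> n k"
      using card_image_le[OF finite_lessThan, of "\<lambda>r V. loop_at (V :: (real^'n) h1_loop) (z k r) $ k" "n k"] by simp
  qed
  finally show ?thesis by simp
qed

lemma jacobi_form_axis_loop:
  assumes u: "has_L2_deriv (loop_at u) g" and v: "has_L2_deriv (loop_at v) h"
  shows "jacobi_form (axis_loop k u) (axis_loop l v) = (if k = l then
    integral {0..1} (\<lambda>t. g t * h t) - integral {0..1} (\<lambda>t. hill k t * (loop_at u t * loop_at v t)) else 0)"
proof -
  have 1: "has_L2_deriv (loop_at (axis_loop k u)) (\<lambda>t. axis k (g t))" for k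
    unfolding loop_at_axis_loop[abs_def] by (rule has_L2_deriv_linear[OF bounded_linear_axis u])
  have 2: "has_L2_deriv (loop_at (axis_loop k v)) (\<lambda>t. axis k (h t))" for k
    unfolding loop_at_axis_loop[abs_def] by (rule has_L2_deriv_linear[OF bounded_linear_axis v])
  have N_axis: "N (axis l x) = axis l (x / (a $ l)\<^sup>2)" for l x
    by (simp add: normal_at_def axis_def vec_eq_iff)
  show ?thesis
    unfolding jacobi_form_def energy_form_eq[OF 1 2] curv_def loop_at_axis_loop N_axis inner_axis_axis hill_def
    by (simp add: mult_ac)
qed

text \<open>The bumps are put on the coordinate axes outside the plane. Such fields are tangent
  since the normal along \<open>\<Gamma>\<close> lies in the plane. Fields on different axes are
  orthogonal because \<open>N\<close> is diagonal, those on one axis because their arcs share at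
  most endpoints.\<close>

lemma index_ge:
  assumes osc: "\<And>k. k \<notin> {i, j} \<Longrightarrow> oscillates (p k) 1 (n k) (z k)" and less: "\<And>k t. k \<notin> {i, j} \<Longrightarrow> p k t < hill k t"
  shows "enat (\<Sum>k\<in>-{i, j}. n k) \<le> geodesic_index a \<Gamma>"
proof -
  define P where "P k u g \<longleftrightarrow> (\<forall>r<n k. has_L2_deriv (loop_at (u r)) (g r)) \<and>
    (\<forall>r<n k. integral {0..1} (\<lambda>t. (g r t)\<^sup>2 - hill k t * (loop_at (u r) t)\<^sup>2) < 0) \<and>
    (\<forall>r<n k. \<forall>s<n k. r \<noteq> s \<longrightarrow> integral {0..1} (\<lambda>t. g r t * g s t) = 0) \<and>
    (\<forall>r<n k. \<forall>s<n k. r \<noteq> s \<longrightarrow> integral {0..1} (\<lambda>t. hill k t * (loop_at (u r) t * loop_at (u s) t)) = 0)" for k u g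
  have "\<exists>u g. P k u g" if k: "k \<in> - {i, j}" for k
  proof -
    have k': "k \<notin> {i, j}" using k by simp
    show ?thesis
    proof (rule ex_negative_bumps[OF osc[OF k'] cont_hill hill_periodic less[OF k']])
      fix u :: "nat \<Rightarrow> real h1_loop" and g
      assume "\<And>r. r < n k \<Longrightarrow> has_L2_deriv (loop_at (u r)) (g r)"
        "\<And>r. r < n k \<Longrightarrow> integral {0..1} (\<lambda>t. (g r t)\<^sup>2 - hill k t * (loop_at (u r) t)\<^sup>2) < 0"
        "\<And>r s. r < n k \<Longrightarrow> s < n k \<Longrightarrow> r \<noteq> s \<Longrightarrow> integral {0..1} (\<lambda>t. g r t * g s t) = 0"
        "\<And>r s. r < n k \<Longrightarrow> s < n k \<Longrightarrow> r \<noteq> s \<Longrightarrow> integral {0..1} (\<lambda>t. hill k t * (loop_at (u r) t * loop_at (u s) t)) = 0"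
      then have "P k u g" unfolding P_def by (intro conjI allI impI)
      then show ?thesis by blast
    qed
  qed
  then obtain u g where P: "\<And>k. k \<in> - {i, j} \<Longrightarrow> P k (u k) (g k)" by metis
  have L2: "has_L2_deriv (loop_at (u k r)) (g k r)" if "k \<in> - {i, j}" "r < n k" for k r
    using P[OF that(1)] that(2) unfolding P_def by simp
  define X where "X = (SIGMA k:-{i, j}. {..<n k})"
  define V where "V = (\<lambda>(k, r). axis_loop k (u k r))"
  have "enat (card X) \<le> geodesic_index a \<Gamma>"
    unfolding geodesic_index_eq
  proof (rule form_index_ge[where B = jacobi_form and V = V])
    show "finite X" by (simp add: X_def)
    show "bilinear jacobi_form" unfolding bilinear_def
      by (auto intro!: linearI simp: bilinear_jacobi_form)
    show "subspace (loop_space_tangent a \<Gamma>)"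
      unfolding loop_space_tangent_def subspace_def ellipsoid_tangent_iff by (simp add: inner_add_left)
    show "V x \<in> loop_space_tangent a \<Gamma>" if "x \<in> X" for x
      using that planar unfolding loop_space_tangent_def ellipsoid_tangent_iff planar_inner X_def V_def
      by (auto simp: loop_at_axis_loop axis_def)
    show "jacobi_form (V x) (V y) = 0" if xy: "x \<in> X" "y \<in> X" "x \<noteq> y" for x y
    proof -
      obtain k r l s where x: "x = (k, r)" and y: "y = (l, s)" by (metis surj_pair)
      have kr: "k \<in> - {i, j}" "r < n k" "l \<in> - {i, j}" "s < n l" using xy by (auto simp: X_def x y)
      show ?thesis
      proof (cases "k = l")
        case True
        have rs: "r \<noteq> s" "s < n k" using xy(3) kr(4) True by (auto simp: x y)
        have "integral {0..1} (\<lambda>t. g k r t * g k s t) = 0"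
          "integral {0..1} (\<lambda>t. hill k t * (loop_at (u k r) t * loop_at (u k s) t)) = 0"
          using P[OF kr(1), unfolded P_def] kr(2) rs by simp_all
        then show ?thesis
          unfolding V_def x y prod.case True[symmetric]
          by (subst jacobi_form_axis_loop[OF L2[OF kr(1,2)] L2[OF kr(1) rs(2)]]) simp
      next
        case False
        then show ?thesis
          unfolding V_def x y prod.case
          by (subst jacobi_form_axis_loop[OF L2[OF kr(1,2)] L2[OF kr(3,4)]]) simp
      qed
    qed
    show "jacobi_form (V x) (V x) < 0" if xX: "x \<in> X" for x
    proof -
      obtain k r where x: "x = (k, r)" by (metis surj_pair)
      have kr: "k \<in> - {i, j}" "r < n k" using xX by (auto simp: X_def x)
      note D = L2[OF kr]
      have "jacobi_form (V x) (V x) = integral {0..1} (\<lambda>t. g k r t * g k r t) - integral {0..1} (\<lambda>t. hill k t * (loop_at (u k r) t * loop_at (u k r) t))"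
        unfolding V_def x prod.case jacobi_form_axis_loop[OF D D] by simp
      also have "\<dots> = integral {0..1} (\<lambda>t. g k r t * g k r t - hill k t * (loop_at (u k r) t * loop_at (u k r) t))"
      proof (rule integral_diff[symmetric])
        show "(\<lambda>t. g k r t * g k r t) integrable_on {0..1}"
          using has_L2_deriv_inner_integrable[OF D D] by simp
        show "(\<lambda>t. hill k t * (loop_at (u k r) t * loop_at (u k r) t)) integrable_on {0..1}"
          by (intro integrable_continuous_interval continuous_intros cont_hill)
      qed
      also have "\<dots> < 0" using P[OF kr(1)] kr(2) by (simp add: P_def power2_eq_square)
      finally show ?thesis .
    qed
  qed
  then show ?thesis by (simp add: X_def)
qed

end

section \<open>Simple zeros and iterates\<close>

context planar_geodesic begin

text \<open>If \<open>G t $ c\<close> and its derivative vanished together, tangency would force the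
  other component of \<open>\<Gamma>'\<close> to be 0 as well, against the positive speed.\<close>

lemma comp_deriv_nonzero:
  assumes c: "{c, d} = {i, j}" and z: "G t $ c = 0"
  shows "\<Gamma>' t $ c \<noteq> 0"
proof
  assume z': "\<Gamma>' t $ c = 0"
  have cd: "(c = i \<and> d = j) \<or> (c = j \<and> d = i)" using c ij by (auto simp: doubleton_eq_iff)
  have Gd: "G t $ d \<noteq> 0" using GG[of t] z cd by (auto simp: planar_inner)
  have "\<Gamma>' t $ d * (G t $ d / (a $ d)\<^sup>2) = 0" using G'_NG[of t] z' cd by (auto simp: planar_inner)
  then have "\<Gamma>' t $ d = 0" using Gd a_pos[of d] by simp
  moreover have "\<Gamma>' t \<bullet> \<Gamma>' t = \<Gamma>' t $ i * \<Gamma>' t $ i + \<Gamma>' t $ j * \<Gamma>' t $ j"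
    by (rule inner_two_components[OF ij]) (simp add: planar')
  ultimately have "\<Gamma>' t \<bullet> \<Gamma>' t = 0" using z' cd by auto
  then show False using speed_pos by (simp add: G'G')
qed

lemma iterate_geodesic:
  assumes "m > 0"
  shows "planar_geodesic a (loop_iterate m \<Gamma>) (\<lambda>t. real m *\<^sub>R \<Gamma>' (real m * t)) (\<lambda>t. (real m)\<^sup>2 * lam (real m * t)) i j"
proof
  show "0 < a $ k" for k by (rule a_pos)
  show "loop_iterate m \<Gamma> \<in> loop_space a"
    using in_space by (simp add: loop_space_def loop_iterate.rep_eq)
  have lin: "((\<lambda>t. real m * t) has_vector_derivative real m) (at t)" for t
    unfolding has_real_derivative_iff_has_vector_derivative[symmetric] by (auto intro!: derivative_eq_intros)
  show "(loop_at (loop_iterate m \<Gamma>) has_vector_derivative real m *\<^sub>R \<Gamma>' (real m * t)) (at t)" for t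
    using vector_diff_chain_at[OF lin deriv[of "real m * t"]] by (simp add: o_def loop_iterate.rep_eq)
  show "((\<lambda>t. real m *\<^sub>R \<Gamma>' (real m * t)) has_vector_derivative
       - ((real m)\<^sup>2 * lam (real m * t)) *\<^sub>R normal_at a (loop_at (loop_iterate m \<Gamma>) t)) (at t)" for t
    using bounded_linear.has_vector_derivative[OF bounded_linear_scaleR_right[of "real m"]
        vector_diff_chain_at[OF lin deriv'[of "real m * t"]]]
    by (simp add: o_def loop_iterate.rep_eq power2_eq_square mult.assoc)
  show "\<exists>t. loop_at (loop_iterate m \<Gamma>) t \<noteq> loop_at (loop_iterate m \<Gamma>) 0"
  proof -
    obtain t where "G t \<noteq> G 0" using nonconst by blast
    then show ?thesis using assms by (intro exI[of _ "t / real m"]) (simp add: loop_iterate.rep_eq)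
  qed
  show "i \<noteq> j" by (rule ij)
  show "loop_at (loop_iterate m \<Gamma>) t $ k = 0" if "k \<noteq> i" "k \<noteq> j" for k t
    using planar[OF that] by (simp add: loop_iterate.rep_eq)
qed

end

section \<open>Average index and rotation numbers\<close>

text \<open>The number of zeros per period of solutions of \<open>u'' = - q u\<close>, so half turns
  are counted. The encoding keeps what the index bounds consume: comparison solutions over
  \<open>m\<close> periods on both sides, strict below for negativity and weak above for
  nonnegativity, with counts that miss \<open>m * \<nu>\<close> by at most 1 in the direction that
  matters.\<close>

definition has_rotation_number :: "(real \<Rightarrow> real) \<Rightarrow> real \<Rightarrow> bool" where
  "has_rotation_number q \<nu> \<longleftrightarrow> (\<forall>\<^sub>F m in sequentially.
     (\<exists>p n z. oscillates p (real m) n z \<and> (\<forall>t. p t < q t) \<and> real m * \<nu> - 1 \<le> real n) \<and>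
     (\<exists>p n z. oscillates p (real m) n z \<and> (\<forall>t. q t \<le> p t) \<and> real n \<le> real m * \<nu> + 1))"

text \<open>Each coordinate outside the plane costs an error of at most 1, so the index of the
  \<open>m\<close>-th iterate lies within \<open>card K\<close> of \<open>m * R\<close>; division by
  \<open>m\<close> gives the limit.\<close>

lemma (in planar_geodesic) average_index_eq:
  assumes rot: "\<And>k. k \<notin> {i, j} \<Longrightarrow> has_rotation_number (hill k) (\<nu> k)"
  shows "average_index a \<Gamma> = ereal (\<Sum>k\<in>-{i, j}. \<nu> k)"
proof -
  define K where "K = - {i, j}"
  define R where "R = (\<Sum>k\<in>K. \<nu> k)"
  define C where "C = real (card K)"
  have finK: "finite K" by simp
  have ev: "\<forall>\<^sub>F m in sequentially. \<forall>k\<in>K.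
     (\<exists>p n z. oscillates p (real m) n z \<and> (\<forall>t. p t < hill k t) \<and> real m * \<nu> k - 1 \<le> real n) \<and>
     (\<exists>p n z. oscillates p (real m) n z \<and> (\<forall>t. hill k t \<le> p t) \<and> real n \<le> real m * \<nu> k + 1)"
    unfolding eventually_ball_finite_distrib[OF finK]
    using rot unfolding has_rotation_number_def K_def by blast
  have bounds: "\<forall>\<^sub>F m in sequentially. \<exists>x. geodesic_index a (loop_iterate m \<Gamma>) = enat x \<and>
      real m * R - C \<le> real x \<and> real x \<le> real m * R + C"
    using ev eventually_gt_at_top[of 0]
  proof eventually_elim
    case (elim m)
    then have m: "m > 0" and lo: "\<And>k. k \<in> K \<Longrightarrow> \<exists>p n z. oscillates p (real m) n z \<and> (\<forall>t. p t < hill k t) \<and> real m * \<nu> k - 1 \<le> real n"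
      and hi: "\<And>k. k \<in> K \<Longrightarrow> \<exists>p n z. oscillates p (real m) n z \<and> (\<forall>t. hill k t \<le> p t) \<and> real n \<le> real m * \<nu> k + 1"
      by auto
    interpret it: planar_geodesic a "loop_iterate m \<Gamma>" "\<lambda>t. real m *\<^sub>R \<Gamma>' (real m * t)" "\<lambda>t. (real m)\<^sup>2 * lam (real m * t)" i j
      by (rule iterate_geodesic[OF m])
    have hill_it: "it.hill k t = (real m)\<^sup>2 * hill k (real m * t)" for k t
      by (simp add: it.hill_def hill_def)
    have m2: "(real m)\<^sup>2 > 0" using m by simp
    obtain p1 n1 z1 where lo: "\<And>k. k \<in> K \<Longrightarrow> oscillates (p1 k) (real m) (n1 k) (z1 k)"
      "\<And>k t. k \<in> K \<Longrightarrow> p1 k t < hill k t" "\<And>k. k \<in> K \<Longrightarrow> real m * \<nu> k - 1 \<le> real (n1 k)"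
      using lo by metis
    obtain p2 n2 z2 where hi: "\<And>k. k \<in> K \<Longrightarrow> oscillates (p2 k) (real m) (n2 k) (z2 k)"
      "\<And>k t. k \<in> K \<Longrightarrow> hill k t \<le> p2 k t" "\<And>k. k \<in> K \<Longrightarrow> real (n2 k) \<le> real m * \<nu> k + 1"
      using hi by metis
    have L: "enat (\<Sum>k\<in>K. n1 k) \<le> geodesic_index a (loop_iterate m \<Gamma>)"
      unfolding K_def
      by (rule it.index_ge[OF oscillates_scale[OF lo(1) m]])
        (use lo(2) m2 in \<open>simp_all add: hill_it K_def\<close>)
    have U: "geodesic_index a (loop_iterate m \<Gamma>) \<le> enat (\<Sum>k\<in>K. n2 k)"
      unfolding K_def
      by (rule it.index_le[OF oscillates_scale[OF hi(1) m]])
        (use hi(2) m2 in \<open>simp_all add: hill_it K_def mult_left_mono\<close>)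
    obtain x where x: "geodesic_index a (loop_iterate m \<Gamma>) = enat x" using U enat_ile by blast
    have "real m * R - C = (\<Sum>k\<in>K. real m * \<nu> k - 1)"
      by (simp add: R_def C_def sum_subtractf sum_distrib_left)
    also have "\<dots> \<le> real (\<Sum>k\<in>K. n1 k)" unfolding of_nat_sum by (rule sum_mono) (rule lo(3))
    also have "\<dots> \<le> real x"
    proof -
      have "sum n1 K \<le> x" using L x by simp
      then show ?thesis by (simp only: of_nat_le_iff)
    qed
    finally have 1: "real m * R - C \<le> real x" .
    have "x \<le> sum n2 K" using U x by simp
    then have "real x \<le> real (\<Sum>k\<in>K. n2 k)" by (simp only: of_nat_le_iff)
    also have "\<dots> \<le> (\<Sum>k\<in>K. real m * \<nu> k + 1)" unfolding of_nat_sum by (rule sum_mono) (rule hi(3))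
    also have "\<dots> = real m * R + C" by (simp add: R_def C_def sum.distrib sum_distrib_left)
    finally show ?case using 1 x by blast
  qed
  define y where "y m = real (the_enat (geodesic_index a (loop_iterate m \<Gamma>))) / real m" for m
  have to0: "(\<lambda>m. C / real m) \<longlonglongrightarrow> 0" by (rule lim_const_over_n)
  have y: "y \<longlonglongrightarrow> R"
  proof (rule tendsto_sandwich)
    show "(\<lambda>m. R - C / real m) \<longlonglongrightarrow> R" using tendsto_diff[OF tendsto_const to0, of R] by simp
    show "(\<lambda>m. R + C / real m) \<longlonglongrightarrow> R" using tendsto_add[OF tendsto_const to0, of R] by simp
    show "\<forall>\<^sub>F m in sequentially. R - C / real m \<le> y m" "\<forall>\<^sub>F m in sequentially. y m \<le> R + C / real m"
    proof -
      have "\<forall>\<^sub>F m in sequentially. R - C / real m \<le> y m \<and> y m \<le> R + C / real m"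
        using bounds eventually_gt_at_top[of 0]
      proof eventually_elim
        case (elim m)
        then obtain x where x: "geodesic_index a (loop_iterate m \<Gamma>) = enat x" "real m * R - C \<le> real x" "real x \<le> real m * R + C"
          by blast
        have "(real m * R - C) / real m \<le> real x / real m" "real x / real m \<le> (real m * R + C) / real m"
          by (intro divide_right_mono x; simp)+
        then show ?case using elim(2) by (simp add: y_def x(1) diff_divide_distrib add_divide_distrib)
      qed
      then show "\<forall>\<^sub>F m in sequentially. R - C / real m \<le> y m" "\<forall>\<^sub>F m in sequentially. y m \<le> R + C / real m"
        by (auto elim: eventually_mono)
    qed
  qed
  have "(\<lambda>m. ereal_of_enat (geodesic_index a (loop_iterate m \<Gamma>)) / ereal (real m)) \<longlonglongrightarrow> ereal R"
  proof (rule Lim_transform_eventually)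
    show "(\<lambda>m. ereal (y m)) \<longlonglongrightarrow> ereal R" using y by simp
    show "\<forall>\<^sub>F m in sequentially. ereal (y m) = ereal_of_enat (geodesic_index a (loop_iterate m \<Gamma>)) / ereal (real m)"
      using bounds eventually_gt_at_top[of 0] by eventually_elim (auto simp: y_def)
  qed
  then show ?thesis unfolding average_index_def by (simp add: limI R_def K_def)
qed

section \<open>Zeros and length of a once-traversed ellipse\<close>

locale ellipse_geodesic = planar_geodesic +
  assumes inj: "inj_on G {0..<1}"
    and range: "range G = {x \<in> ellipsoid a. \<forall>k. k \<noteq> i \<and> k \<noteq> j \<longrightarrow> x $ k = 0}"
begin

lemma G_add_nat: "G (t + real n) = G t"
proof (induction n)
  case (Suc n)
  then show ?case using G_periodic[of "t + real n"] by (simp add: add_ac)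
qed simp

lemma ex_param: 
  assumes "x \<in> ellipsoid a" "\<And>k. k \<noteq> i \<Longrightarrow> k \<noteq> j \<Longrightarrow> x $ k = 0"
  obtains t where "0 \<le> t" "t < 1" "G t = x"
proof -
  have "x \<in> range G" using range assms by auto
  then obtain s where "x = G s" by blast
  then show thesis using that[of "frac s"] by (simp add: loop_at_frac frac_lt_1)
qed

text \<open>On the ellipse the coordinate \<open>c\<close> vanishes exactly at the two vertices on
  the \<open>d\<close>-axis, and by injectivity each is visited once per period.\<close>

lemma ex_coordinate_zeros:
  assumes c: "{c, d} = {i, j}"
  obtains t1 t2 where "0 \<le> t1" "t1 < t2" "t2 < 1" "\<And>t. 0 \<le> t \<Longrightarrow> t < 1 \<Longrightarrow> G t $ c = 0 \<longleftrightarrow> t = t1 \<or> t = t2"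
    "dist (G t1) (G t2) = 2 * a $ d"
proof -
  have cd: "c \<noteq> d" using c ij by (auto simp: doubleton_eq_iff)
  have pt: "axis d (s * a $ d) \<in> ellipsoid a" if "s\<^sup>2 = 1" for s
  proof -
    have "(\<Sum>k\<in>UNIV. (axis d (s * a $ d) $ k)\<^sup>2 / (a $ k)\<^sup>2) = (\<Sum>k\<in>UNIV. if k = d then 1 else 0)"
      using that a_pos[of d] by (intro sum.cong) (auto simp: axis_def power_mult_distrib)
    then show ?thesis by (simp add: ellipsoid_def)
  qed
  have off: "axis d x $ k = 0" if "k \<noteq> i" "k \<noteq> j" for k and x :: real
    using that c by (auto simp: axis_def doubleton_eq_iff)
  obtain p where p: "0 \<le> p" "p < 1" "G p = axis d (1 * a $ d)"
    by (rule ex_param[OF pt[of 1] off]) auto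
  obtain q where q: "0 \<le> q" "q < 1" "G q = axis d ((-1) * a $ d)"
    by (rule ex_param[OF pt[of "-1"] off]) auto
  have iff: "G t $ c = 0 \<longleftrightarrow> t = p \<or> t = q" if t: "0 \<le> t" "t < 1" for t
  proof
    assume z: "G t $ c = 0"
    have "G t $ d * (G t $ d / (a $ d)\<^sup>2) = 1"
      using GG[of t] z c ij unfolding planar_inner by (auto simp: doubleton_eq_iff)
    then have "(G t $ d)\<^sup>2 = (a $ d)\<^sup>2" using a_pos[of d] by (simp add: power2_eq_square field_simps)
    then have "G t $ d = a $ d \<or> G t $ d = - a $ d" by (simp add: power2_eq_iff)
    moreover have "G t = axis d (G t $ d)"
    proof -
      have "G t $ k = 0" if "k \<noteq> d" for k
        using z planar[of k t] that c by (cases "k = c") (auto simp: doubleton_eq_iff)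
      then show ?thesis by (simp add: vec_eq_iff axis_def)
    qed
    ultimately have "G t = G p \<or> G t = G q" using p(3) q(3) by (metis mult_1 mult_minus1)
    then show "t = p \<or> t = q" using inj t p q by (auto simp: inj_on_def)
  next
    assume "t = p \<or> t = q"
    then show "G t $ c = 0" using p(3) q(3) cd by (auto simp: axis_def)
  qed
  have "G p - G q = axis d (2 * a $ d)" unfolding p(3) q(3) by (simp add: vec_eq_iff axis_def)
  then have dst: "dist (G p) (G q) = 2 * a $ d" using a_pos[of d] by (simp add: dist_norm norm_eq_sqrt_inner inner_axis_axis real_sqrt_mult)
  then have "p \<noteq> q" using a_pos[of d] by auto
  then consider "p < q" | "q < p" by linarith
  then show thesis
  proof cases
    case 1
    then show thesis using that[of p q] p q iff dst by simp
  next
    case 2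
    then show thesis using that[of q p] p q iff dst by (auto simp: dist_commute)
  qed
qed

lemma G_Lipschitz: "dist (G s) (G t) \<le> speed * \<bar>s - t\<bar>"
proof -
  have "norm (G s - G t) \<le> speed * norm (s - t)"
    by (rule differentiable_bound[of UNIV G "\<lambda>t h. h *\<^sub>R \<Gamma>' t"])
      (use deriv speed_pos in \<open>auto simp: has_vector_derivative_def norm_G' onorm_scaleR_left onorm_id intro!: onorm_bound\<close>)
  then show ?thesis by (simp add: dist_norm)
qed

text \<open>Two arcs join the opposite vertices on the \<open>d\<close>-axis, and each is at least
  as long as the chord \<open>2 * a $ d\<close>.\<close>

lemma speed_ge:
  assumes "d \<in> {i, j}"
  shows "4 * a $ d \<le> speed"
proof -
  obtain c where c: "{c, d} = {i, j}" using assms by blast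
  obtain t1 t2 where t: "0 \<le> t1" "t1 < t2" "t2 < 1" "dist (G t1) (G t2) = 2 * a $ d"
    by (rule ex_coordinate_zeros[OF c]) blast
  have "2 * a $ d \<le> speed * (t2 - t1)" using G_Lipschitz[of t2 t1] t by (simp add: dist_commute)
  moreover have "2 * a $ d \<le> speed * (t1 + 1 - t2)"
    using G_Lipschitz[of "t1 + 1" t2] t by (simp add: G_periodic)
  ultimately have "4 * a $ d \<le> speed * (t2 - t1) + speed * (t1 + 1 - t2)" by linarith
  also have "\<dots> = speed" by (simp add: algebra_simps)
  finally show ?thesis .
qed

lemma comp_bounded: "\<bar>G t $ d\<bar> \<le> a $ d"
proof -
  have "G t $ d * (G t $ d / (a $ d)\<^sup>2) \<le> G t \<bullet> N (G t)"
    unfolding normal_at_inner by (rule order_trans[OF _ member_le_sum[of d]]) auto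
  then have "(G t $ d)\<^sup>2 \<le> (a $ d)\<^sup>2" using a_pos[of d] by (simp add: GG power2_eq_square divide_le_eq)
  then show ?thesis using a_pos[of d] by (metis abs_le_square_iff abs_of_pos)
qed

text \<open>Between zeros of \<open>G t $ c\<close> tangency keeps \<open>\<Gamma>' t $ d\<close>
  nonzero, so \<open>G t $ d\<close> is monotone there and its variation is at most the width
  \<open>2 * a $ d\<close>.\<close>

lemma abs_integral_le:
  assumes c: "{c, d} = {i, j}" and xy: "x < y" and nz: "\<And>t. x < t \<Longrightarrow> t < y \<Longrightarrow> G t $ c \<noteq> 0"
  shows "integral {x..y} (\<lambda>t. \<bar>\<Gamma>' t $ d\<bar>) \<le> 2 * a $ d"
proof -
  let ?f = "\<lambda>t. \<Gamma>' t $ d"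
  have cd: "(c = i \<and> d = j) \<or> (c = j \<and> d = i)" using c ij by (auto simp: doubleton_eq_iff)
  have cf: "continuous_on S ?f" for S by (intro continuous_intros cont_G')
  have f_nz: "?f t \<noteq> 0" if "x < t" "t < y" for t
  proof
    assume f0: "?f t = 0"
    have "\<Gamma>' t $ c * (G t $ c / (a $ c)\<^sup>2) = 0" using G'_NG[of t] f0 cd by (auto simp: planar_inner)
    then have "\<Gamma>' t $ c = 0" using nz[OF that] a_pos[of c] by simp
    moreover have "\<Gamma>' t \<bullet> \<Gamma>' t = \<Gamma>' t $ i * \<Gamma>' t $ i + \<Gamma>' t $ j * \<Gamma>' t $ j"
      by (rule inner_two_components[OF ij]) (simp add: planar')
    ultimately have "\<Gamma>' t \<bullet> \<Gamma>' t = 0" using f0 cd by auto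
    then show False using speed_pos by (simp add: G'G')
  qed
  have F: "(?f has_integral (G y $ d - G x $ d)) {x..y}"
    using xy G_comp_deriv
    by (intro fundamental_theorem_of_calculus)
       (auto simp: has_real_derivative_iff_has_vector_derivative[symmetric] intro: has_field_derivative_at_within)
  have "(\<forall>t. x < t \<and> t < y \<longrightarrow> ?f t > 0) \<or> (\<forall>t. x < t \<and> t < y \<longrightarrow> ?f t < 0)"
  proof (rule ccontr)
    assume "\<not> ?thesis"
    then obtain s t where st: "x < s" "s < y" "?f s \<le> 0" "x < t" "t < y" "?f t \<ge> 0" by force
    have "connected (?f ` {x<..<y})" using cf by (intro connected_continuous_image) auto
    then have "0 \<in> ?f ` {x<..<y}" using st unfolding connected_iff_interval by fastforce
    then show False using f_nz by auto
  qed
  then have "integral {x..y} (\<lambda>t. \<bar>?f t\<bar>) = \<bar>G y $ d - G x $ d\<bar>"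
  proof
    assume pos: "\<forall>t. x < t \<and> t < y \<longrightarrow> ?f t > 0"
    have "integral {x..y} (\<lambda>t. \<bar>?f t\<bar>) = integral {x..y} ?f"
    proof (rule integral_spike[of "{x, y}"])
      fix t assume "t \<in> {x..y} - {x, y}"
      then have "?f t > 0" using pos by auto
      then show "?f t = \<bar>?f t\<bar>" by simp
    qed simp
    moreover have "0 \<le> integral {x..y} (\<lambda>t. \<bar>?f t\<bar>)"
      by (intro integral_nonneg integrable_continuous_interval continuous_on_rabs cf) simp
    ultimately show ?thesis using integral_unique[OF F] by simp
  next
    assume neg: "\<forall>t. x < t \<and> t < y \<longrightarrow> ?f t < 0"
    have "integral {x..y} (\<lambda>t. \<bar>?f t\<bar>) = integral {x..y} (\<lambda>t. - ?f t)"
    proof (rule integral_spike[of "{x, y}"])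
      fix t assume "t \<in> {x..y} - {x, y}"
      then have "?f t < 0" using neg by auto
      then show "- ?f t = \<bar>?f t\<bar>" by simp
    qed simp
    moreover have "0 \<le> integral {x..y} (\<lambda>t. \<bar>?f t\<bar>)"
      by (intro integral_nonneg integrable_continuous_interval continuous_on_rabs cf) simp
    ultimately show ?thesis using integral_unique[OF F] by simp
  qed
  also have "\<dots> \<le> 2 * a $ d" using comp_bounded[of y d] comp_bounded[of x d] by linarith
  finally show ?thesis .
qed

lemma zeros_between:
  assumes z: "\<And>t. 0 \<le> t \<Longrightarrow> t < 1 \<Longrightarrow> G t $ c = 0 \<longleftrightarrow> t = t1 \<or> t = t2" and t12: "0 \<le> t1" "t1 < t2" "t2 < 1"
  shows "\<And>t. t1 < t \<Longrightarrow> t < t2 \<Longrightarrow> G t $ c \<noteq> 0" "\<And>t. t2 < t \<Longrightarrow> t < t1 + 1 \<Longrightarrow> G t $ c \<noteq> 0"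
proof -
  show "G t $ c \<noteq> 0" if "t1 < t" "t < t2" for t using z[of t] that t12 by simp
  show "G t $ c \<noteq> 0" if "t2 < t" "t < t1 + 1" for t
  proof (cases "t < 1")
    case True
    then show ?thesis using z[of t] that t12 by simp
  next
    case False
    then have "G (t - 1) $ c \<noteq> 0" using z[of "t - 1"] that t12 by simp
    then show ?thesis using G_periodic[of "t - 1"] by simp
  qed
qed

lemma abs_integral_period_le:
  assumes c: "{c, d} = {i, j}"
  shows "integral {0..1} (\<lambda>t. \<bar>\<Gamma>' t $ d\<bar>) \<le> 4 * a $ d"
proof -
  obtain t1 t2 where t: "0 \<le> t1" "t1 < t2" "t2 < 1" and z: "\<And>t. 0 \<le> t \<Longrightarrow> t < 1 \<Longrightarrow> G t $ c = 0 \<longleftrightarrow> t = t1 \<or> t = t2"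
    by (rule ex_coordinate_zeros[OF c]) blast
  have I: "(\<lambda>t. \<bar>\<Gamma>' t $ d\<bar>) integrable_on {x..y}" for x y
    by (intro integrable_continuous_interval continuous_intros cont_G')
  have "integral {0..1} (\<lambda>t. \<bar>\<Gamma>' t $ d\<bar>) = integral {t1..t1 + 1} (\<lambda>t. \<bar>\<Gamma>' t $ d\<bar>)"
    using t by (intro integral_periodic_shift[of "{}", symmetric] I) (simp_all add: G'_periodic)
  also have "\<dots> = integral {t1..t2} (\<lambda>t. \<bar>\<Gamma>' t $ d\<bar>) + integral {t2..t1 + 1} (\<lambda>t. \<bar>\<Gamma>' t $ d\<bar>)"
    using t by (intro Henstock_Kurzweil_Integration.integral_combine[symmetric] I) auto
  also have "\<dots> \<le> 2 * a $ d + 2 * a $ d"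
    using t zeros_between[OF z t] by (intro add_mono abs_integral_le[OF c]) auto
  finally show ?thesis by simp
qed

text \<open>The speed is at most the sum of the absolute values of the two velocity components, and
  their integrals are the total variations of the coordinates.\<close>

lemma speed_le: "speed \<le> 4 * (a $ i + a $ j)"
proof -
  have le: "speed \<le> \<bar>\<Gamma>' t $ i\<bar> + \<bar>\<Gamma>' t $ j\<bar>" for t
  proof -
    have "\<Gamma>' t \<bullet> \<Gamma>' t = \<Gamma>' t $ i * \<Gamma>' t $ i + \<Gamma>' t $ j * \<Gamma>' t $ j"
      by (rule inner_two_components[OF ij]) (simp add: planar')
    then have "speed\<^sup>2 = \<bar>\<Gamma>' t $ i\<bar>\<^sup>2 + \<bar>\<Gamma>' t $ j\<bar>\<^sup>2" by (simp add: G'G' power2_eq_square)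
    also have "\<dots> \<le> (\<bar>\<Gamma>' t $ i\<bar> + \<bar>\<Gamma>' t $ j\<bar>)\<^sup>2" by (simp add: power2_sum)
    finally show ?thesis by (rule power2_le_imp_le) simp
  qed
  have I: "(\<lambda>t. \<bar>\<Gamma>' t $ d\<bar>) integrable_on {0..1}" for d
    by (intro integrable_continuous_interval continuous_intros cont_G')
  have "integral {0..1} (\<lambda>t::real. speed) \<le> integral {0..1} (\<lambda>t. \<bar>\<Gamma>' t $ i\<bar> + \<bar>\<Gamma>' t $ j\<bar>)"
    using le by (intro integral_le integrable_add I) auto
  also have "\<dots> = integral {0..1} (\<lambda>t. \<bar>\<Gamma>' t $ i\<bar>) + integral {0..1} (\<lambda>t. \<bar>\<Gamma>' t $ j\<bar>)"
    by (rule integral_add[OF I I])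
  also have "\<dots> \<le> 4 * a $ i + 4 * a $ j"
    by (intro add_mono abs_integral_period_le[of j i] abs_integral_period_le[of i j]) auto
  finally show ?thesis by simp
qed

lemma coordinate_oscillates:
  assumes "c \<in> {i, j}" "m > 0"
  shows "\<exists>z. oscillates (hill c) (real m) (2 * m) z"
proof -
  obtain d where c: "{c, d} = {i, j}" using assms(1) by blast
  obtain t1 t2 where t: "0 \<le> t1" "t1 < t2" "t2 < 1" and zz: "\<And>t. 0 \<le> t \<Longrightarrow> t < 1 \<Longrightarrow> G t $ c = 0 \<longleftrightarrow> t = t1 \<or> t = t2"
    by (rule ex_coordinate_zeros[OF c]) blast
  \<comment> \<open>The zeros of one period repeated: \<open>t1, t2, t1 + 1, t2 + 1, ...\<close>, so
    that \<open>z (2 * m) = t1 + m\<close>.\<close>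
  define z where "z r = (if even r then t1 else t2) + real (r div 2)" for r :: nat
  have nz: "G s $ c \<noteq> 0" if "z r < s" "s < z (Suc r)" for r s
  proof -
    define s' where "s' = s - real (r div 2)"
    have "G s' $ c \<noteq> 0"
    proof (cases "even r")
      case True
      then show ?thesis using that zeros_between(1)[OF zz t, of s'] by (simp add: z_def s'_def)
    next
      case False
      then have "Suc r div 2 = r div 2 + 1" by (auto elim!: oddE)
      then show ?thesis using that False zeros_between(2)[OF zz t, of s'] by (simp add: z_def s'_def)
    qed
    then show ?thesis using G_add_nat[of s' "r div 2"] by (simp add: s'_def)
  qed
  have z0: "G (z r) $ c = 0" for r
    using G_add_nat[of "if even r then t1 else t2" "r div 2"] zz[of "if even r then t1 else t2"] t by (auto simp: z_def)
  have step: "z r < z (Suc r)" for r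
  proof (cases "even r")
    case True
    then show ?thesis using t by (simp add: z_def)
  next
    case False
    then have "Suc r div 2 = r div 2 + 1" by (auto elim!: oddE)
    then show ?thesis using t False by (simp add: z_def)
  qed
  have D': "((\<lambda>t. \<Gamma>' t $ c) has_real_derivative - hill c t * G t $ c) (at t)" for t
    using G'_comp_deriv[of c t] by (simp add: hill_def)
  have "t1 \<le> real m" using t assms(2) by simp
  moreover have "\<exists>w w'. (\<forall>t. (w has_real_derivative w' t) (at t) \<and> (w' has_real_derivative - hill c t * w t) (at t)) \<and>
     (\<forall>r\<le>2 * m. w (z r) = 0 \<and> w' (z r) \<noteq> 0) \<and> (\<forall>r<2 * m. \<forall>t. z r < t \<longrightarrow> t < z (Suc r) \<longrightarrow> w t \<noteq> 0)"
    by (rule exI[of _ "\<lambda>t. G t $ c"], rule exI[of _ "\<lambda>t. \<Gamma>' t $ c"], intro conjI allI impI)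
       (rule G_comp_deriv D' z0 comp_deriv_nonzero[OF c z0] | erule (1) nz)+
  ultimately have "oscillates (hill c) (real m) (2 * m) z"
    unfolding oscillates_def using step t cont_hill by (simp add: z_def)
  then show ?thesis by blast
qed

end

text \<open>
  Liouville's substitution: if \<open>P\<close> satisfies the Ermakov-type equation below and \<open>\<phi>' = 1 / P\<close>, then
  \<open>w = sqrt P * sin (\<omega> \<phi>)\<close> satisfies \<open>w'' + (q + (\<omega>\<^sup>2 - K\<^sup>2) / P\<^sup>2) w = 0\<close>.
\<close>

section \<open>Rotation numbers along an ellipse\<close>

lemma sqrt_mult_divide:
  assumes "y > (0::real)"
  shows "sqrt (x * y) / y = sqrt (x / y)"
proof -
  have "x / y = x * y / (y * y)" using assms by simp
  then have "sqrt (x / y) = sqrt (x * y) / sqrt (y * y)" by (simp only: real_sqrt_divide)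
  then show ?thesis using assms by simp
qed

lemma liouville_oscillates:
  fixes P P' P'' q F H :: "real \<Rightarrow> real"
  assumes P: "\<And>t. (P has_real_derivative P' t) (at t)" "\<And>t. (P' has_real_derivative P'' t) (at t)"
    and pos: "\<And>t. P t > 0" and q: "continuous_on UNIV q"
    and K: "\<And>t. P t * P'' t / 2 - (P' t)\<^sup>2 / 4 + q t * (P t)\<^sup>2 = K\<^sup>2"
    and F: "\<And>t. (F has_real_derivative 1 / P t) (at t)" "F 0 = 0" "F (real m) = real m * \<Theta>" "\<Theta> > 0"
    and H: "\<And>t. H (F t) = t" "\<And>s. F (H s) = s" "strict_mono F" "strict_mono H" and mn: "m > 0" "n > 0"
  shows "oscillates (\<lambda>t. q t + ((pi * real n / (real m * \<Theta>))\<^sup>2 - K\<^sup>2) / (P t)\<^sup>2) (real m) n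
           (\<lambda>r. H (real r * (real m * \<Theta>) / real n))"
proof -
  \<comment> \<open>Chosen so that the phase \<open>\<omega> * F\<close> grows by exactly
    \<open>pi * n\<close> over \<open>m\<close> periods, which puts \<open>z 0\<close> and
    \<open>z n\<close> exactly \<open>m\<close> apart.\<close>
  define \<omega> where "\<omega> = pi * real n / (real m * \<Theta>)"
  define z where "z r = H (real r * (real m * \<Theta>) / real n)" for r :: nat
  define p where "p t = q t + (\<omega>\<^sup>2 - K\<^sup>2) / (P t)\<^sup>2" for t
  have \<omega>: "\<omega> > 0" using mn F(4) by (simp add: \<omega>_def)
  have cP: "continuous_on UNIV P"
    using P(1) by (auto intro!: continuous_at_imp_continuous_on DERIV_isCont)
  have cp: "continuous_on UNIV p" unfolding p_def
    using pos by (intro continuous_intros q cP) (simp add: less_imp_neq[symmetric])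
  have \<omega>z: "\<omega> * F (z r) = pi * real r" for r
    using mn F(4) by (simp add: z_def H(2) \<omega>_def field_simps)
  define S where "S t = sqrt (P t)" for t
  have S: "S t > 0" "S t * S t = P t" for t using pos[of t] by (auto simp: S_def)
  have DS: "(S has_real_derivative P' t / (2 * S t)) (at t)" for t
    unfolding S_def[abs_def] using pos[of t]
    by (auto intro!: derivative_eq_intros P simp: field_simps)
  define w where "w t = S t * sin (\<omega> * F t)" for t
  define w' where "w' t = P' t / (2 * S t) * sin (\<omega> * F t) + \<omega> / S t * cos (\<omega> * F t)" for t
  have Dw: "(w has_real_derivative w' t) (at t)" for t
  proof -
    have "(w has_real_derivative (P' t / (2 * S t) * sin (\<omega> * F t) + S t * (cos (\<omega> * F t) * (\<omega> * (1 / P t))))) (at t)"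
      unfolding w_def by (auto intro!: derivative_eq_intros DS F(1))
    moreover have "S t * (cos (\<omega> * F t) * (\<omega> * (1 / P t))) = \<omega> / S t * cos (\<omega> * F t)"
      using S(1)[of t] by (simp add: S(2)[of t, symmetric] field_simps)
    ultimately show ?thesis by (simp add: w'_def)
  qed
  have Dw': "(w' has_real_derivative - p t * w t) (at t)" for t
  proof -
    define s c where "s = sin (\<omega> * F t)" and "c = cos (\<omega> * F t)"
    have s: "S t \<noteq> 0" using S(1)[of t] by simp
    have "((\<lambda>t. 2 * S t) has_real_derivative 2 * (P' t / (2 * S t))) (at t)"
      by (rule DERIV_cmult[OF DS])
    from DERIV_divide[OF P(2) this]
    have D1: "((\<lambda>t. P' t / (2 * S t)) has_real_derivative
        (P'' t * (2 * S t) - P' t * (2 * (P' t / (2 * S t)))) / ((2 * S t) * (2 * S t))) (at t)" using s by simp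
    have D2: "((\<lambda>t. \<omega> / S t) has_real_derivative - (\<omega> * (P' t / (2 * S t))) / (S t * S t)) (at t)"
      using DERIV_divide[OF DERIV_const[of \<omega>] DS[of t]] s by simp
    have D3: "((\<lambda>t. sin (\<omega> * F t)) has_real_derivative c * (\<omega> * (1 / P t))) (at t)"
      "((\<lambda>t. cos (\<omega> * F t)) has_real_derivative - s * (\<omega> * (1 / P t))) (at t)"
      unfolding s_def c_def by (auto intro!: derivative_eq_intros F(1))
    have "(w' has_real_derivative
       ((P'' t * (2 * S t) - P' t * (2 * (P' t / (2 * S t)))) / ((2 * S t) * (2 * S t)) * s
         + P' t / (2 * S t) * (c * (\<omega> * (1 / P t)))
         + (- (\<omega> * (P' t / (2 * S t))) / (S t * S t) * c + \<omega> / S t * (- s * (\<omega> * (1 / P t)))))) (at t)"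
      unfolding w'_def
      by (rule DERIV_cong[OF DERIV_add[OF DERIV_mult[OF D1 D3(1)] DERIV_mult[OF D2 D3(2)]]])
         (simp add: s_def c_def mult_ac)
    \<comment> \<open>The cosine terms cancel: this is why the amplitude is the square root of
      \<open>P\<close> when the phase has derivative \<open>\<omega> / P\<close>.\<close>
    also have "(P'' t * (2 * S t) - P' t * (2 * (P' t / (2 * S t)))) / ((2 * S t) * (2 * S t)) * s
         + P' t / (2 * S t) * (c * (\<omega> * (1 / P t)))
         + (- (\<omega> * (P' t / (2 * S t))) / (S t * S t) * c + \<omega> / S t * (- s * (\<omega> * (1 / P t))))
       = (P t * P'' t / 2 - (P' t)\<^sup>2 / 4 - \<omega>\<^sup>2) / (S t * S t * S t) * s"
      using s by (simp add: S(2)[of t, symmetric] field_simps power2_eq_square)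
    also have "P t * P'' t / 2 - (P' t)\<^sup>2 / 4 - \<omega>\<^sup>2 = - (q t * (P t)\<^sup>2 + \<omega>\<^sup>2 - K\<^sup>2)"
      using K[of t] by simp
    also have "- (q t * (P t)\<^sup>2 + \<omega>\<^sup>2 - K\<^sup>2) / (S t * S t * S t) * s = - p t * w t"
      using s unfolding p_def w_def s_def[symmetric] by (simp add: S(2)[of t, symmetric] field_simps power2_eq_square)
    finally show ?thesis .
  qed
  have wz: "w (z r) = 0" "w' (z r) \<noteq> 0" for r
  proof -
    have "sin (pi * real r) = 0" by (simp add: mult.commute)
    moreover have "cos (pi * real r) \<noteq> 0" by (simp add: mult.commute cos_npi)
    ultimately show "w (z r) = 0" "w' (z r) \<noteq> 0" using \<omega> S(1)[of "z r"] by (simp_all add: w_def w'_def \<omega>z)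
  qed
  have nz: "w t \<noteq> 0" if "z r < t" "t < z (Suc r)" for r t
  proof
    assume "w t = 0"
    then have "sin (\<omega> * F t) = 0" using S(1)[of t] by (simp add: w_def)
    then obtain k :: int where k: "\<omega> * F t = of_int k * pi" by (auto simp: sin_zero_iff_int2)
    have "F (z r) < F t" "F t < F (z (Suc r))" using that H(3) by (simp_all add: strict_mono_less)
    then have "\<omega> * F (z r) < \<omega> * F t" "\<omega> * F t < \<omega> * F (z (Suc r))" using \<omega> by simp_all
    then have "pi * real r < pi * of_int k" "pi * of_int k < pi * real (Suc r)" unfolding \<omega>z k by (simp_all add: mult.commute)
    then have "real r < of_int k" "of_int k < real (Suc r)" using pi_gt_zero by (simp_all only: mult_less_cancel_left_pos)
    then have "(of_int (int r) :: real) < of_int k" "(of_int k :: real) < of_int (int (Suc r))" by simp_all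
    then have "int r < k" "k < int (Suc r)" by (simp_all only: of_int_less_iff)
    then show False by simp
  qed
  have z0: "z 0 = 0" using H(1)[of 0] F(2) by (simp add: z_def)
  have zn: "z n = real m" using H(1)[of "real m"] F(3) mn by (simp add: z_def)
  have inc: "z r < z (Suc r)" for r
    unfolding z_def strict_mono_less[OF H(4)] using mn F(4) by (intro divide_strict_right_mono mult_strict_right_mono) auto
  have "oscillates p (real m) n z"
    unfolding oscillates_def
  proof (intro conjI)
    show "\<exists>w w'. (\<forall>t. (w has_real_derivative w' t) (at t) \<and> (w' has_real_derivative - p t * w t) (at t)) \<and>
        (\<forall>r\<le>n. w (z r) = 0 \<and> w' (z r) \<noteq> 0) \<and> (\<forall>r<n. \<forall>t. z r < t \<longrightarrow> t < z (Suc r) \<longrightarrow> w t \<noteq> 0)"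
      by (rule exI[of _ w], rule exI[of _ w'], intro conjI allI impI) (rule Dw Dw' wz | erule (1) nz)+
  qed (use cp z0 zn inc in auto)
  then show ?thesis by (simp add: p_def[abs_def] z_def[abs_def] \<omega>_def)
qed

text \<open>The potential of the comparison solution exceeds \<open>q\<close> by
  \<open>(\<omega>^2 - K^2) / P^2\<close>, so it lies strictly below \<open>q\<close> for
  \<open>\<omega> < K\<close> and weakly above for \<open>\<omega> \<ge> K\<close>; and
  \<open>\<omega> < K\<close> means that the number of arcs is less than
  \<open>m * K * \<Theta> / pi\<close>.\<close>

lemma liouville_rotation_number:
  fixes P P' P'' q :: "real \<Rightarrow> real"
  assumes P: "\<And>t. (P has_real_derivative P' t) (at t)" "\<And>t. (P' has_real_derivative P'' t) (at t)"
    and pos: "\<And>t. P t > 0" and per: "\<And>t. P (t + 1) = P t" and q: "continuous_on UNIV q"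
    and K: "\<And>t. P t * P'' t / 2 - (P' t)\<^sup>2 / 4 + q t * (P t)\<^sup>2 = K\<^sup>2" "K > 0"
  obtains x where "has_rotation_number q (K / (pi * P x))"
proof -
  have "continuous_on UNIV P"
    using P(1) by (auto intro!: continuous_at_imp_continuous_on DERIV_isCont)
  then have cP: "continuous_on UNIV (\<lambda>t. 1 / P t)"
    using pos by (intro continuous_intros) (auto simp: less_imp_neq[symmetric])
  obtain F H \<Theta> where F: "\<And>t. (F has_real_derivative 1 / P t) (at t)" "\<And>t. F (t + 1) = F t + \<Theta>" "\<Theta> > 0" "F 0 = 0"
    and H: "\<And>t. H (F t) = t" "\<And>s. F (H s) = s" "strict_mono F" "strict_mono H"
    by (rule ex_periodic_antiderivative[OF cP, of 1]) (use pos per in auto)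
  have Fm: "F (real m) = real m * \<Theta>" for m
  proof (induction m)
    case (Suc m)
    then show ?case using F(2)[of "real m"] by (simp add: algebra_simps)
  qed (simp add: F(4))
  \<comment> \<open>The integral of \<open>1 / P\<close> over a period is replaced by a single
    value, so that bounds on \<open>P\<close> become bounds on the rotation number.\<close>
  obtain x where "F 1 - F 0 = (1 - 0) * (1 / P x)"
    using MVT2[of 0 1 F "\<lambda>t. 1 / P t"] F(1) by auto
  then have \<Theta>: "\<Theta> = 1 / P x" using F(2)[of 0] F(4) by simp
  define \<nu> where "\<nu> = K * \<Theta> / pi"
  have \<nu>: "\<nu> > 0" using K(2) F(3) by (simp add: \<nu>_def)
  note osc = liouville_oscillates[OF P pos q K(1) F(1,4) Fm F(3) H]
  have "has_rotation_number q \<nu>"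
    unfolding has_rotation_number_def
  proof (rule eventually_mono[OF eventually_gt_at_top])
    fix m :: nat
    \<comment> \<open>For \<open>m > 1 / \<nu>\<close> the rounded-up count \<open>n\<close> is at
      least 2, so \<open>n - 1\<close> arcs are still available for the solution below
      \<open>q\<close>.\<close>
    assume m: "m > nat \<lceil>1 / \<nu>\<rceil>"
    then have m0: "m > 0" by simp
    have "1 / \<nu> < real m" using m \<nu> by linarith
    then have m\<nu>: "real m * \<nu> > 1" using \<nu> by (simp add: field_simps)
    have m\<Theta>: "real m * \<Theta> > 0" using m0 F(3) by simp
    define n where "n = nat \<lceil>real m * \<nu>\<rceil>"
    have n: "real m * \<nu> \<le> real n" "real n < real m * \<nu> + 1" "n \<ge> 2" using m\<nu> unfolding n_def by linarith+
    have lt: "pi * real k / (real m * \<Theta>) < K \<longleftrightarrow> real k < real m * \<nu>" for k :: nat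
      using m\<Theta> by (simp add: \<nu>_def field_simps)
    have cmp: "q t + ((pi * real (n - 1) / (real m * \<Theta>))\<^sup>2 - K\<^sup>2) / (P t)\<^sup>2 < q t" for t
    proof -
      have "pi * real (n - 1) / (real m * \<Theta>) < K" unfolding lt using n by simp
      then have "(pi * real (n - 1) / (real m * \<Theta>))\<^sup>2 < K\<^sup>2" using m\<Theta> by (intro power_strict_mono) auto
      then show ?thesis using pos[of t] by (simp add: divide_less_0_iff)
    qed
    have cmp': "q t \<le> q t + ((pi * real n / (real m * \<Theta>))\<^sup>2 - K\<^sup>2) / (P t)\<^sup>2" for t
    proof -
      have "K \<le> pi * real n / (real m * \<Theta>)" using lt[of n] n by linarith
      then have "K\<^sup>2 \<le> (pi * real n / (real m * \<Theta>))\<^sup>2" using K(2) by (intro power_mono) auto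
      then show ?thesis by simp
    qed
    have "n - 1 > 0" "n > 0" using n(3) by auto
    from osc[OF m0 this(1)] osc[OF m0 this(2)] cmp cmp' n
    show "(\<exists>p n z. oscillates p (real m) n z \<and> (\<forall>t. p t < q t) \<and> real m * \<nu> - 1 \<le> real n) \<and>
     (\<exists>p n z. oscillates p (real m) n z \<and> (\<forall>t. q t \<le> p t) \<and> real n \<le> real m * \<nu> + 1)"
      by (intro conjI exI allI) (assumption | rule cmp cmp' | simp)+
  qed
  moreover have "\<nu> = K / (pi * P x)" by (simp add: \<nu>_def \<Theta> mult.commute)
  ultimately show thesis using that[of x] by simp
qed

section \<open>Explicit rotation numbers\<close>

context ellipse_geodesic begin

lemma middle_rotation_number:
  assumes "a $ i < a $ k" "a $ k < a $ j"
  shows "has_rotation_number (hill k) 2"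
  unfolding has_rotation_number_def
proof (rule eventually_mono[OF eventually_gt_at_top[of 0]])
  fix m :: nat assume m: "m > 0"
  obtain z1 where z1: "oscillates (hill j) (real m) (2 * m) z1" using coordinate_oscillates[of j m] m by blast
  obtain z2 where z2: "oscillates (hill i) (real m) (2 * m) z2" using coordinate_oscillates[of i m] m by blast
  have less: "hill d t < hill c t" if "a $ c < a $ d" for c d t
    unfolding hill_def using that lam_pos[of t] a_pos[of c] a_pos[of d]
    by (intro divide_strict_left_mono power_strict_mono) auto
  show "(\<exists>p n z. oscillates p (real m) n z \<and> (\<forall>t. p t < hill k t) \<and> real m * 2 - 1 \<le> real n) \<and>
     (\<exists>p n z. oscillates p (real m) n z \<and> (\<forall>t. hill k t \<le> p t) \<and> real n \<le> real m * 2 + 1)"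
    using z1 z2 less[OF assms(1)] less[OF assms(2)] by (fastforce intro: less_imp_le)
qed

text \<open>
  The function \<open>P\<close> is the coefficient of \<open>u'\<^sup>2\<close> in the second variation of Joachimsthal's integral
  \<open>\<langle>\<gamma>', A\<^sup>-\<^sup>2 \<gamma>'\<rangle> \<parallel>A\<^sup>-\<^sup>2 \<gamma>\<parallel>\<^sup>2\<close>, up to a constant factor.
\<close>

lemma conserved_quantity:
  fixes c \<sigma> :: real
  assumes c: "c > 0" and \<sigma>: "\<sigma>\<^sup>2 = 1"
  defines "P \<equiv> \<lambda>t. \<sigma> * (G t \<bullet> G t + c\<^sup>2 - (a $ i)\<^sup>2 - (a $ j)\<^sup>2)"
  shows "(P has_real_derivative 2 * \<sigma> * (G t \<bullet> \<Gamma>' t)) (at t)"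
    "((\<lambda>t. 2 * \<sigma> * (G t \<bullet> \<Gamma>' t)) has_real_derivative 2 * \<sigma> * (speed\<^sup>2 - lam t)) (at t)"
    "P t * (2 * \<sigma> * (speed\<^sup>2 - lam t)) / 2 - (2 * \<sigma> * (G t \<bullet> \<Gamma>' t))\<^sup>2 / 4 + (lam t / c\<^sup>2) * (P t)\<^sup>2
       = speed\<^sup>2 * ((c\<^sup>2 - (a $ i)\<^sup>2) * (c\<^sup>2 - (a $ j)\<^sup>2)) / c\<^sup>2"
proof -
  have "((\<lambda>t. G t \<bullet> G t) has_real_derivative 2 * (G t \<bullet> \<Gamma>' t)) (at t)"
    using bounded_bilinear.has_vector_derivative[OF bounded_bilinear_inner deriv[of t] deriv[of t]]
    by (simp add: has_real_derivative_iff_has_vector_derivative inner_commute)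
  then show "(P has_real_derivative 2 * \<sigma> * (G t \<bullet> \<Gamma>' t)) (at t)"
    unfolding P_def by (auto intro!: derivative_eq_intros)
  have "((\<lambda>t. G t \<bullet> \<Gamma>' t) has_real_derivative speed\<^sup>2 - lam t) (at t)"
    using bounded_bilinear.has_vector_derivative[OF bounded_bilinear_inner deriv[of t] deriv'[of t]]
    by (simp add: has_real_derivative_iff_has_vector_derivative G'G' GG)
  then show "((\<lambda>t. 2 * \<sigma> * (G t \<bullet> \<Gamma>' t)) has_real_derivative 2 * \<sigma> * (speed\<^sup>2 - lam t)) (at t)"
    by (rule DERIV_cmult)
  define A B C where "A = (a $ i)\<^sup>2" and "B = (a $ j)\<^sup>2" and "C = c\<^sup>2"
  have ABC: "A > 0" "B > 0" "C > 0" using a_pos[of i] a_pos[of j] c by (auto simp: A_def B_def C_def)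
  \<comment> \<open>Coordinates in which the ellipse is the unit circle; \<open>\<mu>\<close> below
    is the angular velocity there.\<close>
  define \<xi> \<eta> p q where "\<xi> = G t $ i / a $ i" and "\<eta> = G t $ j / a $ j" and "p = \<Gamma>' t $ i / a $ i" and "q = \<Gamma>' t $ j / a $ j"
  have comps: "G t $ i = a $ i * \<xi>" "G t $ j = a $ j * \<eta>" "\<Gamma>' t $ i = a $ i * p" "\<Gamma>' t $ j = a $ j * q"
    using a_pos[of i] a_pos[of j] by (simp_all add: \<xi>_def \<eta>_def p_def q_def)
  have one: "\<xi>\<^sup>2 + \<eta>\<^sup>2 = 1"
    using GG[of t] by (simp add: planar_inner \<xi>_def \<eta>_def power2_eq_square)
  have orth: "\<xi> * p + \<eta> * q = 0"
    using G'_NG[of t] by (simp add: planar_inner \<xi>_def \<eta>_def p_def q_def power2_eq_square mult.commute)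
  define \<mu> where "\<mu> = q * \<xi> - p * \<eta>"
  have pq: "p = - \<mu> * \<eta>" "q = \<mu> * \<xi>"
  proof -
    have "- \<mu> * \<eta> = p * (\<xi>\<^sup>2 + \<eta>\<^sup>2) - \<xi> * (\<xi> * p + \<eta> * q)" by (simp add: \<mu>_def power2_eq_square algebra_simps)
    then show "p = - \<mu> * \<eta>" using one orth by simp
    have "\<mu> * \<xi> = q * (\<xi>\<^sup>2 + \<eta>\<^sup>2) - \<eta> * (\<xi> * p + \<eta> * q)" by (simp add: \<mu>_def power2_eq_square algebra_simps)
    then show "q = \<mu> * \<xi>" using one orth by simp
  qed
  have \<xi>2: "\<xi>\<^sup>2 = 1 - \<eta>\<^sup>2" using one by simp
  \<comment> \<open>The squared speed at unit angular velocity. Since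
    \<open>G t \<bullet> G t = A + B - D\<close>, it follows that
    \<open>P t = \<sigma> * (C - D)\<close>; \<open>lam\<close> is expressed through
    \<open>D\<close> as well.\<close>
  define D where "D = A * \<eta>\<^sup>2 + B * \<xi>\<^sup>2"
  have D: "D > 0"
  proof -
    have "\<xi> \<noteq> 0 \<or> \<eta> \<noteq> 0" using one by auto
    then show ?thesis unfolding D_def using ABC by (auto intro: add_pos_nonneg add_nonneg_pos)
  qed
  have s: "speed\<^sup>2 = \<mu>\<^sup>2 * D"
  proof -
    have "speed\<^sup>2 = \<Gamma>' t $ i * \<Gamma>' t $ i + \<Gamma>' t $ j * \<Gamma>' t $ j"
      unfolding G'G'[of t, symmetric] by (rule inner_two_components[OF ij]) (simp add: planar')
    then show ?thesis by (simp add: comps pq D_def A_def B_def power2_eq_square algebra_simps)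
  qed
  have GG2: "G t \<bullet> G t = A * \<xi>\<^sup>2 + B * \<eta>\<^sup>2"
    using inner_two_components[OF ij, of "G t" "G t"] planar by (simp add: comps A_def B_def power2_eq_square algebra_simps)
  have GG': "G t \<bullet> \<Gamma>' t = \<mu> * \<xi> * \<eta> * (B - A)"
    using inner_two_components[OF ij, of "G t" "\<Gamma>' t"] planar by (simp add: comps pq A_def B_def power2_eq_square algebra_simps)
  have lamD: "lam t * D = \<mu>\<^sup>2 * (A * B)"
  proof -
    have NN: "N (G t) \<bullet> N (G t) = \<xi>\<^sup>2 / A + \<eta>\<^sup>2 / B"
      using a_pos[of i] a_pos[of j]
      by (subst planar_inner) (simp add: normal_at_def comps A_def B_def power2_eq_square)
    have tNt: "\<Gamma>' t \<bullet> N (\<Gamma>' t) = p\<^sup>2 + q\<^sup>2"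
      using inner_two_components[OF ij, of "\<Gamma>' t" "N (\<Gamma>' t)"] planar'
      by (simp add: normal_at_def p_def q_def power2_eq_square)
    have "lam t * (\<xi>\<^sup>2 / A + \<eta>\<^sup>2 / B) = p\<^sup>2 + q\<^sup>2"
      using lam_eq[of t] by (simp add: NN tNt)
    also have "p\<^sup>2 + q\<^sup>2 = \<mu>\<^sup>2 * (\<xi>\<^sup>2 + \<eta>\<^sup>2)" by (simp add: pq power_mult_distrib algebra_simps)
    also have "\<dots> = \<mu>\<^sup>2" by (simp add: one)
    finally have "lam t * (\<xi>\<^sup>2 / A + \<eta>\<^sup>2 / B) = \<mu>\<^sup>2" .
    moreover have "\<xi>\<^sup>2 / A + \<eta>\<^sup>2 / B = D / (A * B)" using ABC by (simp add: D_def field_simps)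
    ultimately have "lam t * (D / (A * B)) = \<mu>\<^sup>2" by simp
    then show ?thesis using ABC by (simp add: field_simps)
  qed
  have Pt: "P t = \<sigma> * (C - D)"
    unfolding P_def GG2 A_def[symmetric] B_def[symmetric] C_def[symmetric] D_def \<xi>2 by (simp add: algebra_simps)
  \<comment> \<open>The left side is quadratic in \<open>P\<close> and its derivatives, so the sign
    \<open>\<sigma>\<close> drops out; it serves to make \<open>P\<close> positive for
    \<open>c\<close> above as well as below both half-axes.\<close>
  have \<sigma>\<sigma>: "\<sigma> * (\<sigma> * x) = x" for x using \<sigma> by (simp add: power2_eq_square flip: mult.assoc)
  have DA: "D - A = \<xi>\<^sup>2 * (B - A)" and BD: "B - D = \<eta>\<^sup>2 * (B - A)"
    unfolding D_def \<xi>2 by (simp_all add: algebra_simps)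
  have "P t * (2 * \<sigma> * (speed\<^sup>2 - lam t)) / 2 - (2 * \<sigma> * (G t \<bullet> \<Gamma>' t))\<^sup>2 / 4 + (lam t / c\<^sup>2) * (P t)\<^sup>2
     = (C - D) * (speed\<^sup>2 - lam t) - (G t \<bullet> \<Gamma>' t)\<^sup>2 + lam t / C * (C - D)\<^sup>2"
    unfolding Pt C_def[symmetric] by (simp add: power_mult_distrib \<sigma> \<sigma>\<sigma> mult_ac)
  also have "\<dots> = speed\<^sup>2 * ((C - A) * (C - B)) / C"
  proof -
    have GG'2: "(G t \<bullet> \<Gamma>' t)\<^sup>2 = \<mu>\<^sup>2 * ((B - D) * (D - A))"
      unfolding GG' DA BD by (simp add: power_mult_distrib power2_eq_square algebra_simps)
    have "((C - D) * (speed\<^sup>2 - lam t) - (G t \<bullet> \<Gamma>' t)\<^sup>2 + lam t / C * (C - D)\<^sup>2) * (C * D)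
       = C * (C - D) * (\<mu>\<^sup>2 * D * D - lam t * D) - \<mu>\<^sup>2 * ((B - D) * (D - A)) * (C * D) + lam t * D * (C - D)\<^sup>2"
      using ABC(3) unfolding GG'2 s by (simp add: algebra_simps)
    also have "\<dots> = \<mu>\<^sup>2 * D * ((C - A) * (C - B)) * D"
      unfolding lamD by (simp add: power2_eq_square algebra_simps)
    also have "\<dots> = speed\<^sup>2 * ((C - A) * (C - B)) / C * (C * D)"
      unfolding s using ABC(3) by simp
    finally have eq: "((C - D) * (speed\<^sup>2 - lam t) - (G t \<bullet> \<Gamma>' t)\<^sup>2 + lam t / C * (C - D)\<^sup>2) * (C * D)
       = speed\<^sup>2 * ((C - A) * (C - B)) / C * (C * D)" .
    have "C * D \<noteq> 0" using ABC(3) D by simp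
    from mult_right_cancel[OF this] eq show ?thesis by blast
  qed
  finally show "P t * (2 * \<sigma> * (speed\<^sup>2 - lam t)) / 2 - (2 * \<sigma> * (G t \<bullet> \<Gamma>' t))\<^sup>2 / 4 + (lam t / c\<^sup>2) * (P t)\<^sup>2
       = speed\<^sup>2 * ((c\<^sup>2 - (a $ i)\<^sup>2) * (c\<^sup>2 - (a $ j)\<^sup>2)) / c\<^sup>2"
    by (simp add: A_def B_def C_def)
qed

lemma GG_bounds:
  assumes "a $ i < a $ j"
  shows "(a $ i)\<^sup>2 \<le> G t \<bullet> G t" "G t \<bullet> G t \<le> (a $ j)\<^sup>2"
proof -
  define x y where "x = (G t $ i / a $ i)\<^sup>2" and "y = (G t $ j / a $ j)\<^sup>2"
  have pos: "a $ i > 0" "a $ j > 0" by (rule a_pos)+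
  have one: "x + y = 1" using GG[of t] by (simp add: planar_inner x_def y_def power2_eq_square)
  have GGe: "G t \<bullet> G t = (a $ i)\<^sup>2 * x + (a $ j)\<^sup>2 * y"
    using inner_two_components[OF ij, of "G t" "G t"] planar pos by (simp add: x_def y_def power2_eq_square)
  have xy: "0 \<le> x" "0 \<le> y" by (auto simp: x_def y_def)
  have le: "(a $ i)\<^sup>2 \<le> (a $ j)\<^sup>2" using assms pos by (intro power_mono) auto
  have "(a $ i)\<^sup>2 * x + (a $ i)\<^sup>2 * y \<le> (a $ i)\<^sup>2 * x + (a $ j)\<^sup>2 * y"
    "(a $ i)\<^sup>2 * x + (a $ j)\<^sup>2 * y \<le> (a $ j)\<^sup>2 * x + (a $ j)\<^sup>2 * y"
    using le xy by (auto intro: mult_right_mono)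
  then show "(a $ i)\<^sup>2 \<le> G t \<bullet> G t" "G t \<bullet> G t \<le> (a $ j)\<^sup>2"
    unfolding GGe using one by (simp_all add: distrib_left[symmetric])
qed

text \<open>For \<open>c\<close> above both half-axes \<open>P\<close> lies between
  \<open>c^2 - B\<close> and \<open>c^2 - A\<close>. The lower end gives the bound
  \<open>K / (pi * (c^2 - B))\<close>, and dropping \<open>A\<close> under the root leaves the
  stated form. Divided by the speed, it is close to \<open>1 / (pi * c)\<close> when
  \<open>a $ k\<close> is much larger than \<open>a $ j\<close>.\<close>

lemma upper_rotation_number:
  assumes "a $ i < a $ j" "a $ j < a $ k"
  obtains \<nu> where "has_rotation_number (hill k) \<nu>" "0 \<le> \<nu>"
    "\<nu> \<le> speed * sqrt ((a $ k)\<^sup>2 / ((a $ k)\<^sup>2 - (a $ j)\<^sup>2)) / (pi * a $ k)"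
proof -
  define A B c where "A = (a $ i)\<^sup>2" and "B = (a $ j)\<^sup>2" and "c = a $ k"
  have c: "c > 0" by (simp add: c_def a_pos)
  have AB: "0 < A" "A < B" "B < c\<^sup>2" unfolding A_def B_def c_def
    using assms a_pos[of i] a_pos[of j] a_pos[of k] by (auto intro!: power_strict_mono)
  define K where "K = speed * sqrt ((c\<^sup>2 - A) * (c\<^sup>2 - B)) / c"
  have K: "K > 0" using AB c speed_pos by (simp add: K_def)
  have K2: "K\<^sup>2 = speed\<^sup>2 * ((c\<^sup>2 - A) * (c\<^sup>2 - B)) / c\<^sup>2"
    using AB by (simp add: K_def power_divide power_mult_distrib)
  define P where "P t = G t \<bullet> G t + c\<^sup>2 - A - B" for t
  have P: "c\<^sup>2 - B \<le> P t" for t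
    using GG_bounds[OF assms(1), of t] by (simp_all add: P_def A_def B_def)
  note cons = conserved_quantity[OF c, of 1, simplified, folded A_def B_def]
  have hk: "hill k t = lam t / c\<^sup>2" for t by (simp add: hill_def c_def)
  obtain x where rot: "has_rotation_number (hill k) (K / (pi * P x))"
  proof (rule liouville_rotation_number[of P "\<lambda>t. 2 * (G t \<bullet> \<Gamma>' t)" "\<lambda>t. 2 * (speed\<^sup>2 - lam t)" "hill k" K])
    show "(P has_real_derivative 2 * (G t \<bullet> \<Gamma>' t)) (at t)" for t
      unfolding P_def[abs_def] using cons(1) by simp
    show "((\<lambda>t. 2 * (G t \<bullet> \<Gamma>' t)) has_real_derivative 2 * (speed\<^sup>2 - lam t)) (at t)" for t
      using cons(2) by simp
    show "P t * (2 * (speed\<^sup>2 - lam t)) / 2 - (2 * (G t \<bullet> \<Gamma>' t))\<^sup>2 / 4 + hill k t * (P t)\<^sup>2 = K\<^sup>2" for t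
      unfolding hk K2 P_def using cons(3)[of t] by simp
    show "0 < P t" for t using P[of t] AB by linarith
    show "P (t + 1) = P t" for t by (simp add: P_def G_periodic)
  qed (use K cont_hill in auto)
  have "K / (pi * P x) \<le> K / (pi * (c\<^sup>2 - B))"
    using P[of x] AB K by (intro divide_left_mono mult_left_mono mult_pos_pos) auto
  also have "\<dots> = speed * (sqrt ((c\<^sup>2 - A) * (c\<^sup>2 - B)) / (c\<^sup>2 - B)) / (pi * c)"
    by (simp add: K_def)
  also have "sqrt ((c\<^sup>2 - A) * (c\<^sup>2 - B)) / (c\<^sup>2 - B) = sqrt ((c\<^sup>2 - A) / (c\<^sup>2 - B))"
    by (rule sqrt_mult_divide) (use AB in simp)
  also have "speed * sqrt ((c\<^sup>2 - A) / (c\<^sup>2 - B)) / (pi * c) \<le> speed * sqrt (c\<^sup>2 / (c\<^sup>2 - B)) / (pi * c)"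
    using AB c speed_pos by (intro divide_right_mono mult_left_mono real_sqrt_le_mono) auto
  finally have "K / (pi * P x) \<le> speed * sqrt (c\<^sup>2 / (c\<^sup>2 - B)) / (pi * c)" .
  moreover have "0 \<le> K / (pi * P x)" using K P[of x] AB by simp
  ultimately show thesis using that[OF rot] by (simp add: B_def c_def)
qed

text \<open>For \<open>c\<close> below both half-axes positivity of \<open>P\<close> requires
  \<open>\<sigma> = -1\<close>. The upper end \<open>B - c^2\<close> of \<open>P\<close> bounds the
  rotation number from below, and replacing \<open>B - c^2\<close> by \<open>B\<close> under the
  root gives the stated form.\<close>

lemma lower_rotation_number:
  assumes "a $ i < a $ j" "a $ k < a $ i"
  obtains \<nu> where "has_rotation_number (hill k) \<nu>"
    "speed * sqrt (((a $ i)\<^sup>2 - (a $ k)\<^sup>2) / (a $ j)\<^sup>2) / (pi * a $ k) \<le> \<nu>"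
proof -
  define A B c where "A = (a $ i)\<^sup>2" and "B = (a $ j)\<^sup>2" and "c = a $ k"
  have c: "c > 0" by (simp add: c_def a_pos)
  have AB: "0 < B" "A < B" "c\<^sup>2 < A" "0 < c\<^sup>2" unfolding A_def B_def c_def
    using assms a_pos[of i] a_pos[of j] a_pos[of k] by (auto intro!: power_strict_mono)
  define K where "K = speed * sqrt ((A - c\<^sup>2) * (B - c\<^sup>2)) / c"
  have K: "K > 0" using AB c speed_pos by (simp add: K_def)
  have K2: "K\<^sup>2 = speed\<^sup>2 * ((c\<^sup>2 - A) * (c\<^sup>2 - B)) / c\<^sup>2"
  proof -
    have "(A - c\<^sup>2) * (B - c\<^sup>2) = (c\<^sup>2 - A) * (c\<^sup>2 - B)" by (simp add: algebra_simps)
    moreover have "K\<^sup>2 = speed\<^sup>2 * ((A - c\<^sup>2) * (B - c\<^sup>2)) / c\<^sup>2"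
      using AB by (simp add: K_def power_divide power_mult_distrib)
    ultimately show ?thesis by simp
  qed
  define P where "P t = - (G t \<bullet> G t + c\<^sup>2 - A - B)" for t
  have P: "A - c\<^sup>2 \<le> P t" "P t \<le> B - c\<^sup>2" for t
    using GG_bounds[OF assms(1), of t] by (simp_all add: P_def A_def B_def)
  have hk: "hill k t = lam t / c\<^sup>2" for t by (simp add: hill_def c_def)
  obtain x where rot: "has_rotation_number (hill k) (K / (pi * P x))"
  proof (rule liouville_rotation_number[of P "\<lambda>t. - (2 * (G t \<bullet> \<Gamma>' t))" "\<lambda>t. - (2 * (speed\<^sup>2 - lam t))" "hill k" K])
    show "(P has_real_derivative - (2 * (G t \<bullet> \<Gamma>' t))) (at t)" for t
      unfolding P_def[abs_def] using conserved_quantity(1)[OF c, of "-1" t] by (simp add: A_def B_def)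
    show "((\<lambda>t. - (2 * (G t \<bullet> \<Gamma>' t))) has_real_derivative - (2 * (speed\<^sup>2 - lam t))) (at t)" for t
      using conserved_quantity(2)[OF c, of "-1" t] by simp
    show "P t * - (2 * (speed\<^sup>2 - lam t)) / 2 - (- (2 * (G t \<bullet> \<Gamma>' t)))\<^sup>2 / 4 + hill k t * (P t)\<^sup>2 = K\<^sup>2" for t
      unfolding hk K2 P_def using conserved_quantity(3)[OF c, of "-1" t] by (simp add: A_def B_def)
    show "0 < P t" for t using P(1)[of t] AB by linarith
    show "P (t + 1) = P t" for t by (simp add: P_def G_periodic)
  qed (use K cont_hill in auto)
  have "speed * sqrt ((A - c\<^sup>2) / B) / (pi * c) \<le> speed * sqrt ((A - c\<^sup>2) / (B - c\<^sup>2)) / (pi * c)"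
    using AB(2-) c speed_pos by (intro divide_right_mono mult_left_mono real_sqrt_le_mono divide_left_mono mult_pos_pos AB(1)) auto
  also have "sqrt ((A - c\<^sup>2) / (B - c\<^sup>2)) = sqrt ((A - c\<^sup>2) * (B - c\<^sup>2)) / (B - c\<^sup>2)"
    by (rule sqrt_mult_divide[symmetric]) (use AB in simp)
  also have "speed * (sqrt ((A - c\<^sup>2) * (B - c\<^sup>2)) / (B - c\<^sup>2)) / (pi * c) = K / (pi * (B - c\<^sup>2))"
    by (simp add: K_def)
  also have "\<dots> \<le> K / (pi * P x)"
    using P[of x] AB K by (intro divide_left_mono mult_left_mono mult_pos_pos) auto
  finally have "speed * sqrt ((A - c\<^sup>2) / B) / (pi * c) \<le> K / (pi * P x)" .
  then show thesis using that[OF rot] by (simp add: A_def B_def c_def)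
qed

lemma mean_frequency_eq:
  assumes "\<And>k. k \<notin> {i, j} \<Longrightarrow> has_rotation_number (hill k) (\<nu> k)"
  shows "mean_frequency a \<Gamma> = ereal ((\<Sum>k\<in>-{i, j}. \<nu> k) / speed)"
proof -
  have "average_index a \<Gamma> = ereal (\<Sum>k\<in>-{i, j}. \<nu> k)" by (rule average_index_eq[OF assms])
  then show ?thesis using speed_pos by (simp add: mean_frequency_def loop_length_eq)
qed

end

section \<open>Short closed geodesics\<close>

text \<open>Needed because \<open>short_geodesic\<close> is a choice. The ellipse is parametrized by
  arc length, rescaled to period 1. Constant speed makes the acceleration orthogonal to the
  velocity; as it lies in the plane, it is then orthogonal to every tangent vector of the
  ellipsoid.\<close>

lemma ex_short_geodesic:
  fixes a :: "real ^ 'n" and i j :: 'n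
  assumes a: "\<And>k. 0 < a $ k" and ij: "i \<noteq> j"
  shows "\<exists>\<gamma>. is_short_geodesic a i j \<gamma>"
proof -
  define \<alpha> \<beta> where "\<alpha> = a $ i" and "\<beta> = a $ j"
  have pos: "\<alpha> > 0" "\<beta> > 0" using a by (auto simp: \<alpha>_def \<beta>_def)
  define E where "E \<theta> = (\<alpha> * cos \<theta>) *\<^sub>R axis i 1 + (\<beta> * sin \<theta>) *\<^sub>R (axis j 1 :: real ^ 'n)" for \<theta>
  define E' where "E' \<theta> = (- \<alpha> * sin \<theta>) *\<^sub>R axis i 1 + (\<beta> * cos \<theta>) *\<^sub>R (axis j 1 :: real ^ 'n)" for \<theta>
  define E'' where "E'' \<theta> = (- \<alpha> * cos \<theta>) *\<^sub>R axis i 1 + (- \<beta> * sin \<theta>) *\<^sub>R (axis j 1 :: real ^ 'n)" for \<theta>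
  have E_comp: "E \<theta> $ i = \<alpha> * cos \<theta>" "E \<theta> $ j = \<beta> * sin \<theta>" "\<And>k. k \<noteq> i \<Longrightarrow> k \<noteq> j \<Longrightarrow> E \<theta> $ k = 0" for \<theta>
    using ij by (auto simp: E_def axis_def)
  have E'_comp: "E' \<theta> $ i = - \<alpha> * sin \<theta>" "E' \<theta> $ j = \<beta> * cos \<theta>" "\<And>k. k \<noteq> i \<Longrightarrow> k \<noteq> j \<Longrightarrow> E' \<theta> $ k = 0" for \<theta>
    using ij by (auto simp: E'_def axis_def)
  have E''_comp: "E'' \<theta> $ i = - \<alpha> * cos \<theta>" "E'' \<theta> $ j = - \<beta> * sin \<theta>" "\<And>k. k \<noteq> i \<Longrightarrow> k \<noteq> j \<Longrightarrow> E'' \<theta> $ k = 0" for \<theta>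
    using ij by (auto simp: E''_def axis_def)
  have DE: "(E has_vector_derivative E' \<theta>) (at \<theta>)" "(E' has_vector_derivative E'' \<theta>) (at \<theta>)" for \<theta>
    unfolding E_def[abs_def] E'_def[abs_def] E''_def
    by (auto intro!: derivative_eq_intros simp: mult.commute)
  define W where "W \<theta> = \<alpha>\<^sup>2 * (sin \<theta>)\<^sup>2 + \<beta>\<^sup>2 * (cos \<theta>)\<^sup>2" for \<theta>
  have E'E': "E' \<theta> \<bullet> E' \<theta> = W \<theta>" for \<theta>
    using inner_two_components[OF ij, of "E' \<theta>" "E' \<theta>"] E'_comp by (simp add: W_def power2_eq_square)
  have W: "W \<theta> > 0" for \<theta>
  proof -
    have "sin \<theta> \<noteq> 0 \<or> cos \<theta> \<noteq> 0" using sin_zero_abs_cos_one[of \<theta>] by auto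
    then show ?thesis unfolding W_def using pos by (auto intro: add_pos_nonneg add_nonneg_pos)
  qed
  define f where "f \<theta> = sqrt (W \<theta>)" for \<theta>
  have f: "f \<theta> > 0" "f \<theta> * f \<theta> = W \<theta>" for \<theta> using W[of \<theta>] by (auto simp: f_def)
  have Df: "(f has_real_derivative (\<alpha>\<^sup>2 - \<beta>\<^sup>2) * sin \<theta> * cos \<theta> / f \<theta>) (at \<theta>)" for \<theta>
  proof -
    have "(W has_real_derivative 2 * ((\<alpha>\<^sup>2 - \<beta>\<^sup>2) * sin \<theta> * cos \<theta>)) (at \<theta>)"
    proof -
      have "((\<lambda>x. (sin x)\<^sup>2) has_real_derivative 2 * sin \<theta> * cos \<theta>) (at \<theta>)"
        "((\<lambda>x. (cos x)\<^sup>2) has_real_derivative - (2 * sin \<theta> * cos \<theta>)) (at \<theta>)"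
        by (auto intro!: derivative_eq_intros)
      from DERIV_add[OF DERIV_cmult[OF this(1), of "\<alpha>\<^sup>2"] DERIV_cmult[OF this(2), of "\<beta>\<^sup>2"]]
      have "(W has_real_derivative \<alpha>\<^sup>2 * (2 * sin \<theta> * cos \<theta>) + \<beta>\<^sup>2 * - (2 * sin \<theta> * cos \<theta>)) (at \<theta>)"
        by (simp only: W_def[abs_def])
      moreover have "\<alpha>\<^sup>2 * (2 * sin \<theta> * cos \<theta>) + \<beta>\<^sup>2 * - (2 * sin \<theta> * cos \<theta>) = 2 * ((\<alpha>\<^sup>2 - \<beta>\<^sup>2) * sin \<theta> * cos \<theta>)"
        by (simp add: left_diff_distrib)
      ultimately show ?thesis by simp
    qed
    from DERIV_chain2[where f = sqrt and g = W, OF DERIV_real_sqrt[OF W] this]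
    have "(f has_real_derivative inverse (f \<theta>) / 2 * (2 * ((\<alpha>\<^sup>2 - \<beta>\<^sup>2) * sin \<theta> * cos \<theta>))) (at \<theta>)"
      by (simp only: f_def[abs_def])
    moreover have "inverse (f \<theta>) / 2 * (2 * x) = x / f \<theta>" for x by (simp add: field_simps)
    ultimately show ?thesis by metis
  qed
  have cf: "continuous_on UNIV f" unfolding f_def W_def by (intro continuous_intros)
  have per_f: "f (\<theta> + 2 * pi) = f \<theta>" for \<theta> by (simp add: f_def W_def)
  obtain F H C where F: "\<And>t. (F has_real_derivative f t) (at t)" "\<And>t. F (t + 2 * pi) = F t + C" "C > 0" "F 0 = 0"
    and H: "\<And>t. H (F t) = t" "\<And>s. F (H s) = s" "\<And>s. (H has_real_derivative 1 / f (H s)) (at s)" "strict_mono F" "strict_mono H"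
    by (rule ex_periodic_antiderivative[OF cf f(1) _ per_f]) (simp, rule that)
  define \<theta> where "\<theta> t = H (C * t)" for t
  have D\<theta>: "(\<theta> has_real_derivative C / f (\<theta> t)) (at t)" for t
  proof -
    have "((\<lambda>t. C * t) has_real_derivative C) (at t)" by (auto intro!: derivative_eq_intros)
    from DERIV_chain2[where f = H and g = "\<lambda>t. C * t", OF H(3) this] show ?thesis by (simp add: \<theta>_def[abs_def])
  qed
  have per_\<theta>: "\<theta> (t + 1) = \<theta> t + 2 * pi" for t
  proof -
    have "F (\<theta> t + 2 * pi) = C * t + C" unfolding F(2) by (simp add: \<theta>_def H(2))
    then have "C * (t + 1) = F (\<theta> t + 2 * pi)" by (simp add: distrib_left)
    then show ?thesis by (simp only: \<theta>_def[of "t + 1"] H(1))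
  qed
  define g where "g t = E (\<theta> t)" for t
  define h where "h t = C / f (\<theta> t)" for t
  define g' where "g' t = h t *\<^sub>R E' (\<theta> t)" for t
  define h' where "h' t = - (C * ((\<alpha>\<^sup>2 - \<beta>\<^sup>2) * sin (\<theta> t) * cos (\<theta> t) / f (\<theta> t) * (C / f (\<theta> t)))) / (f (\<theta> t) * f (\<theta> t))" for t
  define g'' where "g'' t = h t *\<^sub>R (h t *\<^sub>R E'' (\<theta> t)) + h' t *\<^sub>R E' (\<theta> t)" for t
  have Dh: "(h has_real_derivative h' t) (at t)" for t
    unfolding h_def[abs_def] h'_def
    using DERIV_divide[OF DERIV_const[of C] DERIV_chain2[where f = f and g = \<theta>, OF Df D\<theta>[of t]]] f(1)[of "\<theta> t"] by simp
  have D\<theta>v: "(\<theta> has_vector_derivative h t) (at t)" for t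
    using D\<theta>[of t] by (simp add: has_real_derivative_iff_has_vector_derivative h_def)
  have Dg: "(g has_vector_derivative g' t) (at t)" for t
    using vector_diff_chain_at[OF D\<theta>v DE(1)] by (simp add: o_def g_def[abs_def] g'_def)
  have Dg': "(g' has_vector_derivative g'' t) (at t)" for t
    unfolding g'_def[abs_def] g''_def
    using has_vector_derivative_scaleR[OF Dh vector_diff_chain_at[OF D\<theta>v DE(2)]] by (simp add: o_def)
  have cg': "continuous_on UNIV g'"
    using Dg' by (auto intro!: continuous_at_imp_continuous_on has_vector_derivative_continuous)
  have per_g: "g (t + 1) = g t" for t by (simp add: g_def per_\<theta> E_def)
  have L2: "has_L2_deriv g g'" by (rule has_L2_deriv_C1[OF Dg cg'])
  define \<gamma> where "\<gamma> = Abs_h1_loop g"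
  have \<gamma>: "loop_at \<gamma> = g" unfolding \<gamma>_def by (rule Abs_h1_loop_inverse) (use L2 per_g in auto)
  have E_ell: "E x \<in> ellipsoid a" for x
  proof -
    have "E x \<bullet> normal_at a (E x) = (\<alpha> * cos x) * (\<alpha> * cos x / \<alpha>\<^sup>2) + (\<beta> * sin x) * (\<beta> * sin x / \<beta>\<^sup>2)"
      using inner_two_components[OF ij, of "E x" "normal_at a (E x)"] E_comp
      by (simp add: normal_at_def \<alpha>_def \<beta>_def)
    also have "\<dots> = (cos x)\<^sup>2 + (sin x)\<^sup>2" using pos by (simp add: power2_eq_square)
    finally show ?thesis by (simp add: ellipsoid_iff)
  qed
  have g'g': "g' t \<bullet> g' t = C\<^sup>2" for t
    using f[of "\<theta> t"] by (simp add: g'_def E'E' h_def f(2)[symmetric] power2_eq_square)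
  have g'g'': "g' t \<bullet> g'' t = 0" for t
  proof -
    have "((\<lambda>t. g' t \<bullet> g' t) has_vector_derivative (g' t \<bullet> g'' t + g'' t \<bullet> g' t)) (at t)"
      by (rule bounded_bilinear.has_vector_derivative[OF bounded_bilinear_inner Dg' Dg'])
    moreover have "((\<lambda>t. g' t \<bullet> g' t) has_vector_derivative 0) (at t)" unfolding g'g' by simp
    ultimately have "g' t \<bullet> g'' t + g'' t \<bullet> g' t = 0" by (rule vector_derivative_unique_at)
    then show ?thesis by (simp add: inner_commute)
  qed
  have orth: "g'' t \<bullet> v = 0" if v: "v \<in> ellipsoid_tangent a (g t)" for t v
  proof -
    define s c where "s = sin (\<theta> t)" and "c = cos (\<theta> t)"
    define x y where "x = g'' t $ i" and "y = g'' t $ j"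
    have off: "g'' t $ k = 0" if "k \<noteq> i" "k \<noteq> j" for k
      using E'_comp(3)[OF that] E''_comp(3)[OF that] by (simp add: g''_def)
    have hC: "h t \<noteq> 0" using F(3) f(1)[of "\<theta> t"] by (simp add: h_def)
    have "E' (\<theta> t) \<bullet> g'' t = 0" using g'g''[of t] hC by (simp add: g'_def)
    then have h1: "x * \<alpha> * s = y * \<beta> * c"
      using inner_two_components[OF ij, of "E' (\<theta> t)" "g'' t"] E'_comp off by (simp add: x_def y_def s_def c_def mult_ac)
    have "v $ i * (\<alpha> * c / \<alpha>\<^sup>2) + v $ j * (\<beta> * s / \<beta>\<^sup>2) = 0"
      using v inner_two_components[OF ij, of v "normal_at a (E (\<theta> t))"] E_comp
      by (simp add: ellipsoid_tangent_iff g_def normal_at_def s_def c_def \<alpha>_def \<beta>_def)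
    then have h2: "v $ i * \<beta> * c + v $ j * \<alpha> * s = 0" using pos by (simp add: power2_eq_square field_simps)
    \<comment> \<open>\<open>Z\<close> is the inner product of \<open>g''\<close> and
      \<open>v\<close>. Since \<open>s\<close> and \<open>c\<close> do not both vanish, it suffices
      that its products with \<open>\<beta> * c\<close> and \<open>\<alpha> * s\<close> are
      0.\<close>
    define Z where "Z = x * v $ i + y * v $ j"
    have "Z * (\<beta> * c) = x * (v $ i * \<beta> * c + v $ j * \<alpha> * s) + v $ j * (y * \<beta> * c - x * \<alpha> * s)"
      "Z * (\<alpha> * s) = y * (v $ i * \<beta> * c + v $ j * \<alpha> * s) + v $ i * (x * \<alpha> * s - y * \<beta> * c)"
      by (simp_all add: Z_def algebra_simps)
    then have "Z * (\<beta> * c) = 0" "Z * (\<alpha> * s) = 0" using h1 h2 by simp_all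
    moreover have "s \<noteq> 0 \<or> c \<noteq> 0" using sin_zero_abs_cos_one[of "\<theta> t"] by (auto simp: s_def c_def)
    ultimately have "Z = 0" using pos by auto
    then show ?thesis
      using inner_two_components[OF ij, of "g'' t" v] off by (simp add: Z_def x_def y_def)
  qed
  have \<theta>_range: "0 \<le> \<theta> t" "\<theta> t < 2 * pi" if "0 \<le> t" "t < 1" for t
  proof -
    have "F 0 \<le> F (\<theta> t)" "F (\<theta> t) < F (0 + 2 * pi)" unfolding F(2) F(4) using that F(3) by (simp_all add: \<theta>_def H(2))
    then show "0 \<le> \<theta> t" "\<theta> t < 2 * pi"
      unfolding strict_mono_less_eq[OF H(4)] strict_mono_less[OF H(4)] by simp_all
  qed
  have inj: "inj_on g {0..<1}"
  proof (rule inj_onI)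
    fix s t assume st: "s \<in> {0..<1}" "t \<in> {0..<1}" "g s = g t"
    have "\<alpha> * cos (\<theta> s) = \<alpha> * cos (\<theta> t)" "\<beta> * sin (\<theta> s) = \<beta> * sin (\<theta> t)"
    proof -
      have "E (\<theta> s) $ k = E (\<theta> t) $ k" for k using st(3) by (simp add: g_def)
      from this[of i] this[of j] show "\<alpha> * cos (\<theta> s) = \<alpha> * cos (\<theta> t)" "\<beta> * sin (\<theta> s) = \<beta> * sin (\<theta> t)"
        by (simp_all add: E_comp)
    qed
    then have "sin (\<theta> s) = sin (\<theta> t) \<and> cos (\<theta> s) = cos (\<theta> t)" using pos by simp
    then obtain n :: int where n: "\<theta> s = \<theta> t + 2 * pi * of_int n" unfolding sin_cos_eq_iff by blast
    have rs: "0 \<le> \<theta> s" "\<theta> s < 2 * pi" "0 \<le> \<theta> t" "\<theta> t < 2 * pi"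
      using \<theta>_range[of s] \<theta>_range[of t] st by auto
    have "n = 0"
    proof (rule ccontr)
      assume "n \<noteq> 0"
      then consider "n \<ge> 1" | "n \<le> -1" by linarith
      then show False
      proof cases
        case 1
        then have "2 * pi * 1 \<le> 2 * pi * of_int n" by (intro mult_left_mono) auto
        then show False using n rs by linarith
      next
        case 2
        then have "2 * pi * of_int n \<le> 2 * pi * (-1)" by (intro mult_left_mono) auto
        then show False using n rs by linarith
      qed
    qed
    then have "H (C * s) = H (C * t)" using n by (simp add: \<theta>_def)
    then have "C * s = C * t" using strict_mono_eq[OF H(5)] by simp
    then show "s = t" using F(3) by simp
  qed
  have range: "range g = {x \<in> ellipsoid a. \<forall>k. k \<noteq> i \<and> k \<noteq> j \<longrightarrow> x $ k = 0}"
  proof (intro equalityI subsetI)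
    fix x assume "x \<in> range g"
    then show "x \<in> {x \<in> ellipsoid a. \<forall>k. k \<noteq> i \<and> k \<noteq> j \<longrightarrow> x $ k = 0}"
      using E_ell E_comp(3) by (auto simp: g_def)
  next
    fix x assume "x \<in> {x \<in> ellipsoid a. \<forall>k. k \<noteq> i \<and> k \<noteq> j \<longrightarrow> x $ k = 0}"
    then have x: "x \<in> ellipsoid a" "\<And>k. k \<noteq> i \<Longrightarrow> k \<noteq> j \<Longrightarrow> x $ k = 0" by auto
    have "(x $ i / \<alpha>)\<^sup>2 + (x $ j / \<beta>)\<^sup>2 = 1"
      using x(1) inner_two_components[OF ij, of x "normal_at a x"] x(2)
      by (simp add: ellipsoid_iff normal_at_def \<alpha>_def \<beta>_def power2_eq_square)
    then obtain p where p: "x $ i / \<alpha> = cos p" "x $ j / \<beta> = sin p" using sincos_total_2pi by metis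
    then have "x $ i = \<alpha> * cos p" "x $ j = \<beta> * sin p" using pos by (simp_all add: field_simps)
    then have "x $ k = E p $ k" for k
      using x(2) E_comp by (cases "k = i"; cases "k = j") auto
    then have "x = E p" by (simp add: vec_eq_iff)
    moreover have "\<theta> (F p / C) = p" using F(3) by (simp add: \<theta>_def H(1))
    ultimately have "x = g (F p / C)" by (simp add: g_def)
    then show "x \<in> range g" by blast
  qed
  have "g (1/2) \<noteq> g 0"
  proof
    assume "g (1/2) = g 0"
    from inj_onD[OF inj this] show False by simp
  qed
  then have "\<exists>t. g t \<noteq> g 0" by blast
  moreover have "\<gamma> \<in> loop_space a" using E_ell by (simp add: loop_space_def \<gamma> g_def)
  moreover have "\<exists>\<gamma>' \<gamma>''. \<forall>t. (g has_vector_derivative \<gamma>' t) (at t) \<and> (\<gamma>' has_vector_derivative \<gamma>'' t) (at t) \<and>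
      (\<forall>v\<in>ellipsoid_tangent a (g t). \<gamma>'' t \<bullet> v = 0)"
    by (rule exI[of _ g'], rule exI[of _ g'']) (simp add: Dg Dg' orth)
  ultimately have "closed_geodesic a \<gamma>"
    unfolding closed_geodesic_def \<gamma> by (intro conjI)
  then have "is_short_geodesic a i j \<gamma>"
    unfolding is_short_geodesic_def \<gamma> using inj range by simp
  then show ?thesis by blast
qed

lemma ellipse_geodesic_short_geodesic:
  fixes a :: "real ^ 'n" and i j :: 'n
  assumes a: "\<And>k. 0 < a $ k" and ij: "i \<noteq> j"
  obtains \<gamma>' lam where "ellipse_geodesic a (short_geodesic a i j) \<gamma>' lam i j"
proof -
  have "is_short_geodesic a i j (short_geodesic a i j)"
    unfolding short_geodesic_def by (rule someI_ex[OF ex_short_geodesic[OF a ij]])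
  then have S: "closed_geodesic a (short_geodesic a i j)" "inj_on (loop_at (short_geodesic a i j)) {0..<1}"
    "range (loop_at (short_geodesic a i j)) = {x \<in> ellipsoid a. \<forall>k. k \<noteq> i \<and> k \<noteq> j \<longrightarrow> x $ k = 0}"
    unfolding is_short_geodesic_def by auto
  obtain \<gamma>' lam where "ellipsoid_geodesic a (short_geodesic a i j) \<gamma>' lam"
    by (rule closed_geodesic_imp_ellipsoid_geodesic[OF a S(1)])
  then interpret ellipsoid_geodesic a "short_geodesic a i j" \<gamma>' lam .
  have "ellipse_geodesic a (short_geodesic a i j) \<gamma>' lam i j"
  proof
    show "i \<noteq> j" by (rule ij)
    show "loop_at (short_geodesic a i j) t $ k = 0" if "k \<noteq> i" "k \<noteq> j" for k t
    proof -
      have "loop_at (short_geodesic a i j) t \<in> range (loop_at (short_geodesic a i j))" by blast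
      then show ?thesis unfolding S(3) using that by blast
    qed
  qed (fact S(2,3))+
  then show thesis by (rule that)
qed

section \<open>Parameters with distinct mean frequencies\<close>

definition spread_params :: "(real, 'n::{finite,linorder}) vec set" where
  "spread_params = {a. (\<forall>i. 0 < a $ i) \<and> (\<forall>i j. i < j \<longrightarrow> 4 * real CARD('n) * a $ i < a $ j)}"

lemma open_spread_params: "open (spread_params :: (real, 'n::{finite,linorder}) vec set)"
proof -
  have eq: "spread_params = (\<Inter>i. {a :: (real, 'n) vec. 0 < a $ i}) \<inter>
      (\<Inter>i. \<Inter>j. {a :: (real, 'n) vec. i < j \<longrightarrow> 4 * real CARD('n) * a $ i < a $ j})"
    by (auto simp: spread_params_def)
  have "open {a :: (real, 'n) vec. i < j \<longrightarrow> 4 * real CARD('n) * a $ i < a $ j}" for i j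
    by (cases "i < j") (auto intro!: open_Collect_less continuous_intros)
  then show ?thesis unfolding eq
    by (intro open_Int open_INT ballI) (auto intro!: open_Collect_less continuous_intros)
qed

lemma spread_params_nonempty: "(spread_params :: (real, 'n::{finite,linorder}) vec set) \<noteq> {}"
proof -
  define C where "C = 4 * real CARD('n)"
  have C: "C \<ge> 0" by (simp add: C_def)
  \<comment> \<open>A geometric progression along the order, with ratio
    \<open>C + 1 > C\<close>.\<close>
  define a :: "(real, 'n) vec" where "a = (\<chi> i. (C + 1) ^ card {k. k < i})"
  have "C * a $ i < a $ j" if "i < j" for i j
  proof -
    have "{k. k < i} \<subset> {k. k < j}" using that by auto
    then have "card {k. k < i} < card {k. k < j}" by (intro psubset_card_mono) auto
    then have le: "(C + 1) ^ Suc (card {k. k < i}) \<le> (C + 1) ^ card {k. k < j}"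
      using C by (intro power_increasing) auto
    have "(C + 1) ^ card {k. k < i} > 0" using C by (intro zero_less_power) simp
    then have "C * (C + 1) ^ card {k. k < i} < (C + 1) ^ Suc (card {k. k < i})"
      by (simp add: algebra_simps)
    then show ?thesis using le by (simp add: a_def)
  qed
  moreover have "0 < a $ i" for i using C by (simp add: a_def)
  ultimately have "a \<in> spread_params" by (simp add: spread_params_def C_def)
  then show ?thesis by blast
qed

lemma spread_paramsD:
  fixes a :: "(real, 'n::{finite,linorder}) vec"
  assumes "a \<in> spread_params"
  shows "\<And>i. 0 < a $ i" "\<And>i j. i < j \<Longrightarrow> 4 * real CARD('n) * a $ i < a $ j" "\<And>i j. i < j \<Longrightarrow> 4 * a $ i < a $ j"
    "\<And>i j. i < j \<Longrightarrow> a $ i < a $ j"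
proof -
  show pos: "0 < a $ i" for i using assms by (simp add: spread_params_def)
  show K: "4 * real CARD('n) * a $ i < a $ j" if "i < j" for i j using assms that by (simp add: spread_params_def)
  have one: "1 \<le> real CARD('n)" using zero_less_card_finite[where 'a='n] by linarith
  show four: "4 * a $ i < a $ j" if "i < j" for i j
  proof -
    have "4 * a $ i * 1 \<le> 4 * a $ i * real CARD('n)" using one pos[of i] by (intro mult_left_mono) auto
    then show ?thesis using K[OF that] by (simp add: mult_ac)
  qed
  show "a $ i < a $ j" if "i < j" for i j using four[OF that] pos[of i] by linarith
qed

lemma spread_params_subset: "spread_params \<subseteq> ellipsoid_params"
  using spread_paramsD(1,4) by (auto simp: ellipsoid_params_def)

text \<open>From \<open>4 * b < c\<close> the quotient is below \<open>16 / 15\<close>, which is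
  rounded up to the square \<open>25 / 16\<close>.\<close>

lemma sqrt_ratio_le:
  assumes "0 < b" "4 * b < (c::real)"
  shows "sqrt (c\<^sup>2 / (c\<^sup>2 - b\<^sup>2)) \<le> 5 / 4"
proof -
  have "(4 * b)\<^sup>2 \<le> c\<^sup>2" using assms by (intro power_mono) auto
  then have b: "16 * b\<^sup>2 \<le> c\<^sup>2" by (simp add: power_mult_distrib)
  have b0: "0 < b\<^sup>2" using assms by simp
  have d: "0 < c\<^sup>2 - b\<^sup>2" using b b0 by linarith
  have "25 * b\<^sup>2 \<le> 144 * b\<^sup>2" by (rule mult_right_mono) simp_all
  also have "\<dots> \<le> 9 * c\<^sup>2" using b by simp
  finally have "c\<^sup>2 / (c\<^sup>2 - b\<^sup>2) \<le> 25 / 16" unfolding pos_divide_le_eq[OF d] by simp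
  then have "c\<^sup>2 / (c\<^sup>2 - b\<^sup>2) \<le> (5 / 4)\<^sup>2" by (simp add: power2_eq_square)
  then show ?thesis by (rule real_le_lsqrt[rotated]) simp
qed

text \<open>
  The indices between \<open>o1\<close> and \<open>j\<close> contribute \<open>2 / \<ell>\<close> each with \<open>4 a\<^sub>j \<le> \<ell> < 8 a\<^sub>j\<close>, those above \<open>j\<close> at most \<open>1 / a\<^sub>j\<close> each.
\<close>

lemma mean_frequency_bounds:
  fixes a :: "(real, 'n::{finite,linorder}) vec"
  assumes a: "a \<in> spread_params" and o1: "\<And>k. o1 \<le> k" and oj: "o1 < j"
  obtains x where "mean_frequency a (short_geodesic a o1 j) = ereal x" "x \<le> real CARD('n) / a $ j"
    "(\<exists>k. o1 < k \<and> k < j) \<Longrightarrow> 1 / (4 * a $ j) < x"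
proof -
  note aD = spread_paramsD[OF a]
  obtain \<gamma>' lam where "ellipse_geodesic a (short_geodesic a o1 j) \<gamma>' lam o1 j"
    by (rule ellipse_geodesic_short_geodesic[OF aD(1), of o1 j]) (use oj in auto)
  then interpret ellipse_geodesic a "short_geodesic a o1 j" \<gamma>' lam o1 j .
  have sp: "4 * a $ j \<le> speed" "speed \<le> 4 * (a $ o1 + a $ j)" using speed_ge[of j] speed_le by auto
  have aj: "a $ j > 0" by (rule aD(1))
  define P where "P k \<nu> \<longleftrightarrow> has_rotation_number (hill k) \<nu> \<and> 0 \<le> \<nu> \<and> \<nu> / speed \<le> 1 / a $ j \<and> (k < j \<longrightarrow> \<nu> = 2)" for k \<nu>
  have "\<exists>\<nu>. P k \<nu>" if k: "k \<notin> {o1, j}" for k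
  proof (cases "k < j")
    case True
    have "o1 < k" using k o1[of k] by auto
    then have rot: "has_rotation_number (hill k) 2" by (intro middle_rotation_number aD(4) True)
    have "2 / speed \<le> 2 / (4 * a $ j)" using sp(1) aj by (intro divide_left_mono) auto
    also have "\<dots> \<le> 1 / a $ j" using aj by (simp add: field_simps)
    finally have "P k 2" using rot by (simp add: P_def)
    then show ?thesis by blast
  next
    case False
    then have jk: "j < k" using k by auto
    obtain \<nu> where \<nu>: "has_rotation_number (hill k) \<nu>" "0 \<le> \<nu>"
      "\<nu> \<le> speed * sqrt ((a $ k)\<^sup>2 / ((a $ k)\<^sup>2 - (a $ j)\<^sup>2)) / (pi * a $ k)"
      by (rule upper_rotation_number[OF aD(4)[OF oj] aD(4)[OF jk]])
    have "\<nu> / speed \<le> speed * sqrt ((a $ k)\<^sup>2 / ((a $ k)\<^sup>2 - (a $ j)\<^sup>2)) / (pi * a $ k) / speed"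
      using speed_pos by (intro divide_right_mono \<nu>(3)) simp
    also have "\<dots> = sqrt ((a $ k)\<^sup>2 / ((a $ k)\<^sup>2 - (a $ j)\<^sup>2)) / (pi * a $ k)" using speed_pos by simp
    also have "\<dots> \<le> (5 / 4) / (pi * a $ k)"
      using aD(1)[of k] by (intro divide_right_mono sqrt_ratio_le aD(1) aD(3)[OF jk]) simp
    also have "\<dots> \<le> (5 / 4) / (2 * a $ j)"
      using aD(1)[of k] aj aD(4)[OF jk] pi_ge_two by (intro divide_left_mono mult_mono) auto
    also have "\<dots> \<le> 1 / a $ j" using aj by (simp add: field_simps)
    finally have "P k \<nu>" using \<nu> False by (simp add: P_def)
    then show ?thesis by blast
  qed
  then obtain \<nu> where \<nu>: "\<And>k. k \<notin> {o1, j} \<Longrightarrow> P k (\<nu> k)" by metis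
  define x where "x = (\<Sum>k\<in>-{o1, j}. \<nu> k) / speed"
  have mf: "mean_frequency a (short_geodesic a o1 j) = ereal x"
    unfolding x_def by (rule mean_frequency_eq) (use \<nu> in \<open>simp add: P_def\<close>)
  have "x = (\<Sum>k\<in>-{o1, j}. \<nu> k / speed)" by (simp add: x_def sum_divide_distrib)
  also have "\<dots> \<le> (\<Sum>k\<in>-{o1, j}. 1 / a $ j)"
    by (rule sum_mono) (use \<nu> in \<open>simp add: P_def\<close>)
  also have "\<dots> = real (card (- {o1, j})) / a $ j" by simp
  also have "\<dots> \<le> real CARD('n) / a $ j" using aj by (intro divide_right_mono) (auto intro: card_mono)
  finally have up: "x \<le> real CARD('n) / a $ j" .
  \<comment> \<open>A single index in between already contributes 2, and all other contributions are
    nonnegative.\<close>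
  have lo: "1 / (4 * a $ j) < x" if "\<exists>k. o1 < k \<and> k < j"
  proof -
    obtain k where k: "o1 < k" "k < j" using \<open>\<exists>k. o1 < k \<and> k < j\<close> by blast
    then have kk: "k \<in> - {o1, j}" by auto
    have "2 = \<nu> k" using \<nu>[of k] kk k by (simp add: P_def)
    also have "\<dots> \<le> (\<Sum>k\<in>-{o1, j}. \<nu> k)" by (rule member_le_sum[OF kk]) (use \<nu> in \<open>auto simp: P_def\<close>)
    finally have "2 / speed \<le> x" unfolding x_def using speed_pos by (intro divide_right_mono) auto
    moreover have "speed < 8 * a $ j" using sp(2) aD(4)[OF oj] by simp
    then have "2 / (8 * a $ j) < 2 / speed" using aj speed_pos by (intro divide_strict_left_mono) auto
    ultimately show ?thesis by simp
  qed
  show thesis by (rule that[OF mf up lo])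
qed

lemma many_mean_frequencies:
  fixes a :: "(real, 'n::{finite,linorder}) vec"
  assumes a: "a \<in> spread_params" and n: "CARD('n) = n + 1" "3 \<le> n"
  shows "(real n + 1) / 2 \<le> real (card {mean_frequency a (short_geodesic a i j) | i j. i < j})"
proof -
  define o1 :: 'n where "o1 = Min UNIV"
  have o1: "o1 \<le> k" for k by (simp add: o1_def)
  define o2 :: 'n where "o2 = Min (UNIV - {o1})"
  have "UNIV - {o1} \<noteq> {}"
  proof
    assume "UNIV - {o1} = {}"
    then have "CARD('n) \<le> card {o1}" by (intro card_mono) auto
    then show False using n by simp
  qed
  then have "o2 \<in> UNIV - {o1}" unfolding o2_def by (intro Min_in) auto
  then have o12: "o1 < o2" using o1[of o2] by auto
  have o2: "o2 \<le> k" if "k \<noteq> o1" for k unfolding o2_def by (rule Min_le) (use that in auto)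
  define J where "J = UNIV - {o1, o2}"
  have J: "o1 < j" "o2 < j" if "j \<in> J" for j
    using that o1[of j] o2[of j] by (auto simp: J_def)
  define F where "F j = mean_frequency a (short_geodesic a o1 j)" for j
  have less: "F k < F j" if jk: "j \<in> J" "k \<in> J" "j < k" for j k
  proof -
    have between: "\<exists>k. o1 < k \<and> k < j" using J(2)[OF jk(1)] o12 by blast
    obtain x where x: "F j = ereal x" "1 / (4 * a $ j) < x"
      by (rule mean_frequency_bounds[OF a o1 J(1)[OF jk(1)]]) (rule that, simp_all add: F_def between)
    obtain y where y: "F k = ereal y" "y \<le> real CARD('n) / a $ k"
      by (rule mean_frequency_bounds[OF a o1 J(1)[OF jk(2)]]) (rule that, simp_all add: F_def)
    \<comment> \<open>This is the inequality \<open>4 * CARD('n) * a $ j < a $ k\<close> that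
      defines \<open>spread_params\<close>.\<close>
    have "real CARD('n) / a $ k < 1 / (4 * a $ j)"
      using spread_paramsD(1,2)[OF a] jk(3) by (simp add: field_simps)
    then show ?thesis using x y by simp
  qed
  have "inj_on F J"
  proof (rule inj_onI, rule ccontr)
    fix j k assume jk: "j \<in> J" "k \<in> J" "F j = F k" "j \<noteq> k"
    from jk(4) have "j < k \<or> k < j" by (rule neq_iff[THEN iffD1])
    then show False using less[of j k] less[of k j] jk(1-3) by auto
  qed
  then have "card (F ` J) = card J" by (rule card_image)
  also have "card J = CARD('n) - card {o1, o2}" unfolding J_def by (rule card_Diff_subset) auto
  also have "\<dots> = n - 1" using o12 n(1) by simp
  finally have cF: "card (F ` J) = n - 1" .
  \<comment> \<open>Finiteness matters, since \<open>card\<close> of an infinite set would be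
    0.\<close>
  have "{mean_frequency a (short_geodesic a i j) | i j. i < j} \<subseteq> (\<lambda>(i, j). mean_frequency a (short_geodesic a i j)) ` UNIV"
    by auto
  then have "finite {mean_frequency a (short_geodesic a i j) | i j. i < j}" by (rule finite_subset) simp
  moreover have "F ` J \<subseteq> {mean_frequency a (short_geodesic a i j) | i j. i < j}"
    using J(1) by (auto simp: F_def)
  ultimately have "card (F ` J) \<le> card {mean_frequency a (short_geodesic a i j) | i j. i < j}"
    by (rule card_mono)
  then have "n - 1 \<le> card {mean_frequency a (short_geodesic a i j) | i j. i < j}"
    by (simp only: cF)
  then have "real (n - 1) \<le> real (card {mean_frequency a (short_geodesic a i j) | i j. i < j})"
    by (simp only: of_nat_le_iff)
  moreover have "3 \<le> real n" "real (n - 1) = real n - 1" using n(2) by (simp_all add: of_nat_diff)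
  then have "(real n + 1) / 2 \<le> real (n - 1)" by (simp add: field_simps)
  ultimately show ?thesis by linarith
qed

lemma distinct_mean_frequencies_3:
  fixes a :: "real ^ 3"
  assumes a: "a \<in> spread_params"
  shows "distinct [mean_frequency a (short_geodesic a 0 1), mean_frequency a (short_geodesic a 0 2),
                   mean_frequency a (short_geodesic a 1 2)]"
proof -
  note aD = spread_paramsD[OF a]
  have ord: "(0::3) < 1" "(1::3) < 2" "(0::3) < 2"
    by (simp_all add: less_bit1_def bit1.Rep_0 bit1.Rep_1 bit1.Rep_numeral)
  have neq: "(0::3) \<noteq> 1" "(1::3) \<noteq> 2" "(0::3) \<noteq> 2" using ord by (simp_all only: less_imp_neq not_False_eq_True)
  \<comment> \<open>\<open>exhaust_3\<close> lists 1, 2 and 3, and 3 equals 0 in this type.\<close>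
  have ex: "k = 0 \<or> k = 1 \<or> k = (2::3)" for k using exhaust_3[of k] by auto
  have lt: "12 * a $ 0 < a $ 1" "12 * a $ 1 < a $ 2" using aD(2)[OF ord(1)] aD(2)[OF ord(2)] by simp_all
  have pos: "0 < a $ 0" "0 < a $ 1" "0 < a $ 2" by (rule aD(1))+
  obtain x01 where x01: "mean_frequency a (short_geodesic a 0 1) = ereal x01" "x01 \<le> (5 / 4) / (3 * a $ 2)"
  proof -
    obtain \<gamma>' lam where "ellipse_geodesic a (short_geodesic a 0 1) \<gamma>' lam 0 1"
      by (rule ellipse_geodesic_short_geodesic[OF aD(1), of 0 1]) auto
    then interpret ellipse_geodesic a "short_geodesic a 0 1" \<gamma>' lam 0 1 .
    obtain \<nu> where \<nu>: "has_rotation_number (hill 2) \<nu>"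
      "\<nu> \<le> speed * sqrt ((a $ 2)\<^sup>2 / ((a $ 2)\<^sup>2 - (a $ 1)\<^sup>2)) / (pi * a $ 2)"
      by (rule upper_rotation_number[OF aD(4)[OF ord(1)] aD(4)[OF ord(2)]])
    have K: "- {0, 1} = {2::3}"
    proof (rule set_eqI)
      show "k \<in> - {0, 1} \<longleftrightarrow> k \<in> {2::3}" for k using ex[of k] neq by auto
    qed
    have "has_rotation_number (hill k) \<nu>" if "k \<notin> {0, 1}" for k
      using that ex[of k] \<nu>(1) by auto
    then have mf: "mean_frequency a (short_geodesic a 0 1) = ereal ((\<Sum>k\<in>-{0, 1::3}. \<nu>) / speed)"
      by (rule mean_frequency_eq[of "\<lambda>_. \<nu>"])
    have "\<nu> / speed \<le> speed * sqrt ((a $ 2)\<^sup>2 / ((a $ 2)\<^sup>2 - (a $ 1)\<^sup>2)) / (pi * a $ 2) / speed"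
      using speed_pos by (intro divide_right_mono \<nu>(2)) simp
    also have "\<dots> = sqrt ((a $ 2)\<^sup>2 / ((a $ 2)\<^sup>2 - (a $ 1)\<^sup>2)) / (pi * a $ 2)" using speed_pos by simp
    also have "\<dots> \<le> (5 / 4) / (pi * a $ 2)"
      using pos by (intro divide_right_mono sqrt_ratio_le aD(3)[OF ord(2)]) auto
    also have "\<dots> \<le> (5 / 4) / (3 * a $ 2)"
      using pos pi_gt3 by (intro divide_left_mono mult_right_mono mult_pos_pos) auto
    finally show thesis using that[of "\<nu> / speed"] mf by (simp add: K)
  qed
  obtain x02 where x02: "mean_frequency a (short_geodesic a 0 2) = ereal x02"
    "1 / (2 * (a $ 0 + a $ 2)) \<le> x02" "x02 \<le> 1 / (2 * a $ 2)"
  proof -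
    obtain \<gamma>' lam where "ellipse_geodesic a (short_geodesic a 0 2) \<gamma>' lam 0 2"
      by (rule ellipse_geodesic_short_geodesic[OF aD(1), of 0 2]) (use ord in auto)
    then interpret ellipse_geodesic a "short_geodesic a 0 2" \<gamma>' lam 0 2 .
    have rot: "has_rotation_number (hill 1) 2"
      by (rule middle_rotation_number[OF aD(4)[OF ord(1)] aD(4)[OF ord(2)]])
    have K: "- {0, 2} = {1::3}"
    proof (rule set_eqI)
      show "k \<in> - {0, 2} \<longleftrightarrow> k \<in> {1::3}" for k using ex[of k] neq by auto
    qed
    have "has_rotation_number (hill k) 2" if "k \<notin> {0, 2}" for k
      using that ex[of k] rot by auto
    then have mf: "mean_frequency a (short_geodesic a 0 2) = ereal ((\<Sum>k\<in>-{0, 2::3}. 2) / speed)"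
      by (rule mean_frequency_eq[of "\<lambda>_. 2"])
    have "1 / (2 * (a $ 0 + a $ 2)) = 2 / (4 * (a $ 0 + a $ 2))" using pos by (simp add: field_simps)
    also have "\<dots> \<le> 2 / speed" using speed_le speed_pos pos
      by (intro divide_left_mono) auto
    finally have "1 / (2 * (a $ 0 + a $ 2)) \<le> 2 / speed" .
    moreover have "2 / speed \<le> 2 / (4 * a $ 2)" using speed_ge[of 2] speed_pos pos
      by (intro divide_left_mono) auto
    then have "2 / speed \<le> 1 / (2 * a $ 2)" by simp
    moreover have "mean_frequency a (short_geodesic a 0 2) = ereal (2 / speed)" using mf by (simp add: K)
    ultimately show thesis by (intro that)
  qed
  obtain x12 where x12: "mean_frequency a (short_geodesic a 1 2) = ereal x12" "1 / a $ 2 \<le> x12"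
  proof -
    obtain \<gamma>' lam where "ellipse_geodesic a (short_geodesic a 1 2) \<gamma>' lam 1 2"
      by (rule ellipse_geodesic_short_geodesic[OF aD(1), of 1 2]) (use ord in auto)
    then interpret ellipse_geodesic a "short_geodesic a 1 2" \<gamma>' lam 1 2 .
    obtain \<nu> where \<nu>: "has_rotation_number (hill 0) \<nu>"
      "speed * sqrt (((a $ 1)\<^sup>2 - (a $ 0)\<^sup>2) / (a $ 2)\<^sup>2) / (pi * a $ 0) \<le> \<nu>"
      by (rule lower_rotation_number[OF aD(4)[OF ord(2)] aD(4)[OF ord(1)]])
    have K: "- {1, 2} = {0::3}"
    proof (rule set_eqI)
      show "k \<in> - {1, 2} \<longleftrightarrow> k \<in> {0::3}" for k using ex[of k] neq by auto
    qed
    have "has_rotation_number (hill k) \<nu>" if "k \<notin> {1, 2}" for k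
      using that ex[of k] \<nu>(1) by auto
    then have mf: "mean_frequency a (short_geodesic a 1 2) = ereal ((\<Sum>k\<in>-{1, 2::3}. \<nu>) / speed)"
      by (rule mean_frequency_eq[of "\<lambda>_. \<nu>"])
    have "(12 * a $ 0)\<^sup>2 \<le> (a $ 1)\<^sup>2" using lt pos by (intro power_mono) auto
    then have "144 * (a $ 0)\<^sup>2 \<le> (a $ 1)\<^sup>2" by (simp add: power_mult_distrib)
    \<comment> \<open>As \<open>17 = 16 + 1\<close>, the difference of squares is at least the
      square of \<open>4 * a $ 0\<close>, and 4 exceeds \<open>pi\<close>.\<close>
    from order_trans[OF mult_right_mono this] have "17 * (a $ 0)\<^sup>2 \<le> (a $ 1)\<^sup>2" by simp
    then have "(4 * a $ 0)\<^sup>2 \<le> (a $ 1)\<^sup>2 - (a $ 0)\<^sup>2" by (simp add: power_mult_distrib)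
    then have "4 * a $ 0 \<le> sqrt ((a $ 1)\<^sup>2 - (a $ 0)\<^sup>2)" using pos by (intro real_le_rsqrt)
    have "1 / a $ 2 = pi * a $ 0 / a $ 2 / (pi * a $ 0)" using pos by simp
    also have "\<dots> \<le> 4 * a $ 0 / a $ 2 / (pi * a $ 0)"
      using pos pi_less_4 by (intro divide_right_mono mult_right_mono) auto
    also have "\<dots> \<le> sqrt ((a $ 1)\<^sup>2 - (a $ 0)\<^sup>2) / a $ 2 / (pi * a $ 0)"
      using pos \<open>4 * a $ 0 \<le> _\<close> by (intro divide_right_mono) auto
    also have "sqrt ((a $ 1)\<^sup>2 - (a $ 0)\<^sup>2) / a $ 2 = sqrt (((a $ 1)\<^sup>2 - (a $ 0)\<^sup>2) / (a $ 2)\<^sup>2)"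
      using pos by (simp add: real_sqrt_divide)
    also have "\<dots> / (pi * a $ 0) = speed * sqrt (((a $ 1)\<^sup>2 - (a $ 0)\<^sup>2) / (a $ 2)\<^sup>2) / (pi * a $ 0) / speed"
      using speed_pos by simp
    also have "\<dots> \<le> \<nu> / speed" using speed_pos by (intro divide_right_mono \<nu>(2)) simp
    finally show thesis using that[of "\<nu> / speed"] mf by (simp add: K)
  qed
  \<comment> \<open>This puts the lower bound for \<open>x02\<close> above
    \<open>6 / (13 * a $ 2)\<close>, while \<open>x01\<close> is at most
    \<open>5 / (12 * a $ 2)\<close>, and \<open>5 / 12 < 6 / 13\<close>.\<close>
  have "a $ 0 < a $ 2 / 12" using lt pos by linarith
  then have "(5 / 4) / (3 * a $ 2) < 1 / (2 * (a $ 0 + a $ 2))" using pos by (simp add: field_simps)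
  then have "x01 < x02" using x01(2) x02(2) by linarith
  moreover have "1 / (2 * a $ 2) < 1 / a $ 2" using pos by (simp add: field_simps)
  then have "x02 < x12" using x02(3) x12(2) by linarith
  ultimately show ?thesis by (simp add: x01(1) x02(1) x12(1))
qed

theorem theorem1p7:
  shows "(\<exists>U :: (real ^ 3) set. open U \<and> U \<noteq> {} \<and> U \<subseteq> ellipsoid_params \<and>
            (\<forall>a\<in>U. distinct [mean_frequency a (short_geodesic a 0 1),
                             mean_frequency a (short_geodesic a 0 2),
                             mean_frequency a (short_geodesic a 1 2)]))
       \<and> (\<forall>n\<ge>3. CARD('n::{finite,linorder}) = n + 1 \<longrightarrow>
            (\<exists>U :: ((real, 'n) vec) set. open U \<and> U \<noteq> {} \<and> U \<subseteq> ellipsoid_params \<and>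
               (\<forall>a\<in>U. (real n + 1) / 2 \<le>
                  real (card {mean_frequency a (short_geodesic a i j) | i j. i < j}))))"
proof (intro conjI allI impI)
  show "\<exists>U :: (real ^ 3) set. open U \<and> U \<noteq> {} \<and> U \<subseteq> ellipsoid_params \<and>
            (\<forall>a\<in>U. distinct [mean_frequency a (short_geodesic a 0 1),
                             mean_frequency a (short_geodesic a 0 2),
                             mean_frequency a (short_geodesic a 1 2)])"
    by (intro exI[of _ spread_params] conjI ballI open_spread_params spread_params_nonempty
        spread_params_subset distinct_mean_frequencies_3)
next
  fix n assume n: "3 \<le> n" "CARD('n) = n + 1"
  show "\<exists>U :: ((real, 'n) vec) set. open U \<and> U \<noteq> {} \<and> U \<subseteq> ellipsoid_params \<and>
               (\<forall>a\<in>U. (real n + 1) / 2 \<le>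
                  real (card {mean_frequency a (short_geodesic a i j) | i j. i < j}))"
    by (intro exI[of _ spread_params] conjI ballI open_spread_params spread_params_nonempty
        spread_params_subset many_mean_frequencies n)
qed

end
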